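(* Let $X$ be a spectrally negative Lévy process (non-monotone paths) whose Lévy measure $\Pi$ has a density $\pi$ with respect to Lebesgue measure. For $q\ge 0$ and for positive numbers $x,y,z,a$ and $b$ such that $b<a\wedge x\wedge y$, $a>x$, $a>y$, $$E_x\big(e^{-qT},\ X(T-)\in dy,\ |X(T)|\in dz,\ I_{T-}>b,\ S_{T-}\le a,\ T<\infty\big)=\pi(-z-y)\left(\frac{W^{(q)}(x-b)}{W^{(q)}(a-b)}\,W^{(q)}(a-y)-W^{(q)}(x-y)\right)dy\,dz .$$
   Context: $X=\{X(t),t\ge 0\}$ is a real-valued spectrally negative Lévy process (càdlàg paths, no positive jumps, stationary independent increments) on a filtered probability space satisfying the usual conditions; the case of monotone paths is excluded. $P_x$ is the law of $X$ with $X(0)=x$, and $E_x$ the corresponding expectation. The Laplace exponent $\varphi$ is defined by $E_0 e^{\alpha X(t)}=e^{t\varphi(\alpha)}$, $\alpha\ge 0$, with $$\varphi(\alpha)=\mu\alpha+\tfrac12\sigma^2\alpha^2+\int_{-\infty}^0\big(e^{\alpha x}-1-\alpha x 1_{(x>-1)}\big)\Pi(dx),$$ where $\mu\in\mathbb{R}$, $\sigma\ge 0$ and the Lévy measure $\Pi$ on $(-\infty,0)$ satisfies $\int_{-\infty}^0(x^2\wedge 1)\Pi(dx)<\infty$. Standing assumption: $\Pi(dx)=\pi(x)dx$. For $q\ge 0$, $\Phi(q)=\sup\{\alpha\ge 0:\varphi(\alpha)=q\}$. The $q$-scale function $W^{(q)}:(-\infty,\infty)\to[0,\infty)$ is the unique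 function that is identically zero for $x<0$, continuous on $(0,\infty)$, and has Laplace transform $\int_0^\infty e^{-\alpha x}W^{(q)}(x)dx=\frac{1}{\varphi(\alpha)-q}$ for $\alpha>\Phi(q)$. $I_t=\inf_{0\le s\le t}X(s)$, $S_t=\sup_{0\le s\le t}X(s)$, and $I_{T-},S_{T-},X(T-)$ denote left limits at $T$. $T=\inf\{t\ge 0:X(t)<0\}$ (with $\inf\emptyset=\infty$). The notation $E_x(Y,A)$ means $E_x(Y1_A)$, and the identity is an identity of measures in $(y,z)$ on the indicated range. *)

theory Defs
  imports "HOL-Probability.Probability"
begin

section \<open>Path functionals\<close>

text \<open>A path is a function \<^typ>\<open>real \<Rightarrow> real\<close> of which only the values at times \<open>t \<ge> 0\<close> matter.\<close>

definition left_limit :: "(real \<Rightarrow> real) \<Rightarrow> real \<Rightarrow> real" where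
  "left_limit f t = Lim (at_left t) f"

definition cadlag :: "(real \<Rightarrow> real) \<Rightarrow> bool" where
  "cadlag f \<longleftrightarrow> (\<forall>t\<ge>0. (f \<longlongrightarrow> f t) (at_right t)) \<and> (\<forall>t>0. \<exists>l. (f \<longlongrightarrow> l) (at_left t))"

definition no_positive_jumps :: "(real \<Rightarrow> real) \<Rightarrow> bool" where
  "no_positive_jumps f \<longleftrightarrow> (\<forall>t>0. f t \<le> left_limit f t)"

definition running_inf :: "(real \<Rightarrow> real) \<Rightarrow> real \<Rightarrow> real" where
  "running_inf f t = (INF s\<in>{0..t}. f s)"

definition running_sup :: "(real \<Rightarrow> real) \<Rightarrow> real \<Rightarrow> real" where
  "running_sup f t = (SUP s\<in>{0..t}. f s)"

text \<open>Extended-real valued, so that the infimum of the empty set is \<open>\<infinity>\<close>.\<close>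

definition ruin_time :: "(real \<Rightarrow> real) \<Rightarrow> ereal" where
  "ruin_time f = (INF t\<in>{t. 0 \<le> t \<and> f t < 0}. ereal t)"


section \<open>Spectrally negative Levy processes\<close>

text \<open>The library locale \<^locale>\<open>filtration\<close> indexes by the whole type, here \<^typ>\<open>real\<close>. The
  \<open>\<sigma>\<close>-algebras at negative times carry no information beyond being contained in \<open>F 0\<close>.\<close>

locale usual_conditions =
  prob_space M + complete_measure M + filtration "space M" F
  for M :: "'a measure" and F :: "real \<Rightarrow> 'a measure" +
  assumes F_subalgebra: "\<And>t. 0 \<le> t \<Longrightarrow> subalgebra M (F t)"
    and F_null_sets: "null_sets M \<subseteq> sets (F 0)"
    and F_right_continuous: "\<And>t. 0 \<le> t \<Longrightarrow> sets (F t) = (\<Inter>u\<in>{t<..}. sets (F u))"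

text \<open>\<open>M\<close> plays the role of \<open>P\<^sub>0\<close>: the process starts at \<open>0\<close>.\<close>

locale levy_process = usual_conditions M F
  for M :: "'a measure" and F :: "real \<Rightarrow> 'a measure" +
  fixes X :: "real \<Rightarrow> 'a \<Rightarrow> real"
  assumes adapted: "\<And>t. 0 \<le> t \<Longrightarrow> X t \<in> borel_measurable (F t)"
    and start: "AE \<omega> in M. X 0 \<omega> = 0"
    and cadlag_paths: "AE \<omega> in M. cadlag (\<lambda>t. X t \<omega>)"
    and independent_increments: "\<And>s t. 0 \<le> s \<Longrightarrow> s \<le> t \<Longrightarrow>
          indep_set (sets (F s))
            (sets (vimage_algebra (space M) (\<lambda>\<omega>. X t \<omega> - X s \<omega>) borel))"
    and stationary_increments: "\<And>s t. 0 \<le> s \<Longrightarrow> s \<le> t \<Longrightarrow>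
          distr M borel (\<lambda>\<omega>. X t \<omega> - X s \<omega>) = distr M borel (X (t - s))"

definition levy_measure_neg :: "real measure \<Rightarrow> bool" where
  "levy_measure_neg \<nu> \<longleftrightarrow> sets \<nu> = sets borel \<and> emeasure \<nu> {0..} = 0 \<and>
     (\<integral>\<^sup>+ x\<in>{..<0}. ennreal (min (x\<^sup>2) 1) \<partial>\<nu>) < \<infinity>"

definition laplace_exponent :: "real \<Rightarrow> real \<Rightarrow> real measure \<Rightarrow> real \<Rightarrow> real" where
  "laplace_exponent \<mu> \<sigma> \<nu> \<alpha> = \<mu> * \<alpha> + 1 / 2 * \<sigma>\<^sup>2 * \<alpha>\<^sup>2 +
     (LINT x:{..<0}|\<nu>. exp (\<alpha> * x) - 1 - \<alpha> * x * indicator {-1<..} x)"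

locale spectrally_negative_levy = levy_process M F X
  for M :: "'a measure" and F :: "real \<Rightarrow> 'a measure" and X :: "real \<Rightarrow> 'a \<Rightarrow> real" +
  fixes \<mu> \<sigma> :: real and \<nu> :: "real measure"
  assumes no_positive_jumps: "AE \<omega> in M. no_positive_jumps (\<lambda>t. X t \<omega>)"
    and not_increasing: "\<not> (AE \<omega> in M. monotone_on {0..} (\<le>) (\<le>) (\<lambda>t. X t \<omega>))"
    and not_decreasing: "\<not> (AE \<omega> in M. monotone_on {0..} (\<le>) (\<ge>) (\<lambda>t. X t \<omega>))"
    and sigma_nonneg: "0 \<le> \<sigma>"
    and levy_measure: "levy_measure_neg \<nu>"
    and laplace: "\<And>t \<alpha>. 0 \<le> t \<Longrightarrow> 0 \<le> \<alpha> \<Longrightarrow>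
          has_bochner_integral M (\<lambda>\<omega>. exp (\<alpha> * X t \<omega>)) (exp (t * laplace_exponent \<mu> \<sigma> \<nu> \<alpha>))"

text \<open>\<open>E\<^sub>x (Y)\<close> for a path functional \<open>Y\<close>: the law of \<open>X\<close> under \<open>P\<^sub>x\<close> is that of \<open>x + X\<close> under
  \<open>P\<^sub>0 = M\<close>.\<close>

definition expectation_from ::
    "'a measure \<Rightarrow> (real \<Rightarrow> 'a \<Rightarrow> real) \<Rightarrow> real \<Rightarrow> ((real \<Rightarrow> real) \<Rightarrow> real) \<Rightarrow> real" where
  "expectation_from M X x Y = (\<integral>\<omega>. Y (\<lambda>t. x + X t \<omega>) \<partial>M)"


section \<open>Scale functions\<close>

definition right_inverse_exponent :: "(real \<Rightarrow> real) \<Rightarrow> real \<Rightarrow> real" where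
  "right_inverse_exponent \<phi> q = Sup {\<alpha>. 0 \<le> \<alpha> \<and> \<phi> \<alpha> = q}"

text \<open>The conditions leave the value of \<open>W\<close> at \<open>0\<close> open, hence a predicate rather than a
  definite description.\<close>

definition is_scale_function :: "(real \<Rightarrow> real) \<Rightarrow> real \<Rightarrow> (real \<Rightarrow> real) \<Rightarrow> bool" where
  "is_scale_function \<phi> q W \<longleftrightarrow>
     (\<forall>x. 0 \<le> W x) \<and> (\<forall>x<0. W x = 0) \<and> continuous_on {0<..} W \<and>
     (\<forall>\<alpha>>right_inverse_exponent \<phi> q.
        set_integrable lborel {0..} (\<lambda>x. exp (- \<alpha> * x) * W x) \<and>
        (LINT x:{0..}|lborel. exp (- \<alpha> * x) * W x) = 1 / (\<phi> \<alpha> - q))"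

end

theory Submission
  imports Defs
begin

text \<open>Let \<open>\<tau>\<close> be the first time at which the process started at \<open>x\<close> violates \<open>b < I\<close> or \<open>S \<le> a\<close>.
  Stopping the martingales \<open>exp (\<alpha> X\<^sub>t - \<phi> \<alpha> t)\<close> at \<open>\<tau>\<close> relates the \<open>q\<close>-occupation measure \<open>R\<close> up
  to \<open>\<tau>\<close> and the discounted law \<open>H\<close> of the exit position by
  \<open>\<integral> exp (\<alpha> y) H(dy) - exp (\<alpha> x) = (\<phi> \<alpha> - q) \<integral> exp (\<alpha> y) R(dy)\<close>.
  As \<open>1 / (\<phi> \<alpha> - q)\<close> is the transform of \<open>W\<close>, inversion yields
  \<open>R(dy) + W(x - y) dy = (\<integral> W(v - y) H(dv)) dy\<close>. Since \<open>H\<close> lives on \<open>{..b} \<union> {a}\<close> and \<open>W\<close> vanishes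
  on the negative half-line, the right-hand side is \<open>h W(a - y) dy\<close> with \<open>h = H {a}\<close> above \<open>b\<close> and at
  least that below \<open>b\<close>, where \<open>R\<close> vanishes. Comparing both sides at \<open>b\<close> gives
  \<open>h W(a - b) = W(x - b)\<close> without any discussion of creeping.

  The jump at \<open>\<tau>\<close> is compensated by discretizing time: if a test function of position and increment
  forces the path below zero, only one grid cell contributes, and the Markov property at grid times
  together with the small-time limit of the increment law turns the sum into \<open>R \<otimes> \<nu>\<close>.\<close>

section \<open>Moments, Laplace transforms and test functions\<close>

text \<open>The process is known through its exponential moments with exponent \<alpha> \<ge> 0, and
  these do several jobs. With \<open>w = exp u\<close> exponentials become powers, so Weierstrass
  approximation serves both for Laplace inversion on a half-line and for the small-time limit. In
  the latter a second difference of \<phi> in \<alpha> produces the weight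
  \<open>(1 - exp u)\<^sup>2\<close>: it removes the drift, makes the Levy measure finite, and
  leaves the Gaussian part as an atom at \<open>w = 1\<close>, invisible to test functions that
  vanish near \<open>u = 0\<close>. A path stopped on a grid may have climbed beyond
  \<open>a\<close>, so its exponentials have no constant bound; but their squares are the same
  expressions with \<open>2 * \<alpha>\<close> and \<open>2 * q\<close>, which gives uniform
  integrability. One \<alpha> with \<open>q < \<phi> \<alpha>\<close> bounds the mass of
  \<open>R\<close>, and for \<open>q = 0\<close> this shows that almost every path leaves. Finally
  \<open>W (a - b) \<noteq> 0\<close> follows by moving the starting point through the whole
  interval.\<close>

lemma continuous_exp_times: "continuous_on S (\<lambda>y. exp (\<alpha> * y))" for \<alpha> :: real
  by (intro continuous_intros)

lemma emeasure_lborel_greaterThan: "emeasure lborel {l::real<..} = \<infinity>"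
proof -
  have "of_nat n \<le> emeasure lborel {l<..}" for n
    using emeasure_mono[of "{l<..l + real n}" "{l<..}" lborel]
    by (simp add: ennreal_of_nat_eq_real_of_nat Ioc_subset_iff subset_iff)
  then show ?thesis by (metis ennreal_Ex_less_of_nat infinity_ennreal_def not_le top.not_eq_extremum)
qed

lemma polynomial_approximation:
  fixes G :: "real \<Rightarrow> real"
  assumes "continuous_on {0..B} G" and "0 < \<epsilon>"
  obtains c :: "nat \<Rightarrow> real" and d where "\<And>w. w \<in> {0..B} \<Longrightarrow> \<bar>G w - (\<Sum>i\<le>d. c i * w ^ i)\<bar> < \<epsilon>"
proof -
  obtain p where p: "real_polynomial_function p" "\<And>w. w \<in> {0..B} \<Longrightarrow> \<bar>G w - p w\<bar> < \<epsilon>"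
    using Stone_Weierstrass_real_polynomial_function[OF _ assms] by (metis compact_Icc)
  obtain c d where "p = (\<lambda>x. \<Sum>i\<le>d. c i * x ^ i)"
    using real_polynomial_function_imp_sum[OF p(1)] by blast
  with p(2) show ?thesis using that by blast
qed

text \<open>Mass that the approximating measures put beyond \<open>1\<close> is controlled by the high moments, which
  stay bounded because the limit moments are decreasing.\<close>

lemma moments_imp_integral_tendsto:
  fixes \<rho> :: "nat \<Rightarrow> real measure" and m :: "real measure" and h G :: "real \<Rightarrow> real" and s :: real
  assumes int: "\<And>n j. integrable (\<rho> n) (\<lambda>w. w ^ j)"
    and nonneg: "\<And>n. AE w in \<rho> n. 0 \<le> w"
    and int': "\<And>j. integrable m (\<lambda>w. w ^ j)"
    and unit: "AE w in m. 0 \<le> w \<and> w \<le> 1"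
    and lim: "\<And>j. (\<lambda>n. \<integral>w. w ^ j \<partial>\<rho> n) \<longlonglongrightarrow> s + (\<integral>w. w ^ j \<partial>m)"
    and s: "0 \<le> s"
    and sets: "\<And>n. sets (\<rho> n) = sets borel" "sets m = sets borel"
    and G: "continuous_on UNIV G" "\<And>w. 1 \<le> w \<Longrightarrow> G w = 0"
  shows "(\<lambda>n. \<integral>w. G w \<partial>\<rho> n) \<longlonglongrightarrow> (\<integral>w. G w \<partial>m)"
proof -
  have [measurable]: "G \<in> borel_measurable borel"
    using G(1) by (rule borel_measurable_continuous_onI)
  note [measurable_cong] = sets
  obtain g where g: "\<And>w. w \<in> {0..2} \<Longrightarrow> \<bar>G w\<bar> \<le> g"
    using compact_imp_bounded[OF compact_continuous_image[OF continuous_on_subset[OF G(1)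
        subset_UNIV] compact_Icc[of 0 2]]]
    unfolding bounded_iff by fastforce
  have g0: "0 \<le> g" using g[of 0] by auto
  have g': "\<bar>G w\<bar> \<le> g" if "0 \<le> w" for w
    using g[of w] G(2)[of w] g0 that by (cases "w \<le> 2") auto
  have intG: "integrable (\<rho> n) G" for n
  proof (rule Bochner_Integration.integrable_bound)
    show "integrable (\<rho> n) (\<lambda>w. g * w ^ 0)" by (intro integrable_mult_right int)
    show "AE w in \<rho> n. norm (G w) \<le> norm (g * w ^ 0)"
      using nonneg[of n] by eventually_elim (use g' g0 in auto)
  qed simp
  have intG': "integrable m G"
  proof (rule Bochner_Integration.integrable_bound)
    show "integrable m (\<lambda>w. g * w ^ 0)" by (intro integrable_mult_right int')
    show "AE w in m. norm (G w) \<le> norm (g * w ^ 0)"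
      using unit by eventually_elim (use g' g0 in auto)
  qed simp
  define m0 where "m0 = s + (\<integral>w. w ^ 0 \<partial>m)"
  have mj: "s + (\<integral>w. w ^ j \<partial>m) \<le> m0" for j
    unfolding m0_def
    by (intro add_left_mono integral_mono_AE int') (use unit in \<open>eventually_elim, auto simp:
        power_le_one\<close>)
  have m0: "0 \<le> (\<integral>w. w ^ 0 \<partial>m)" by simp
  then have m0': "s \<le> m0" "0 \<le> m0" "(\<integral>w. w ^ 0 \<partial>m) \<le> m0" using s unfolding m0_def by auto
  show ?thesis
  proof (rule LIMSEQ_I)
    fix r :: real assume r: "0 < r"
    \<comment> \<open>The errors collected at the end are
      \<open>2 * \<epsilon> * m0 + \<epsilon>\<close> for \<open>Q\<close>, \<epsilon> for the
      convergence of \<open>P\<close>, and \<open>\<epsilon> * m0\<close> each for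
      \<open>s * P 1\<close> and for replacing \<open>P\<close> by \<open>G\<close> under
      \<open>m\<close>. Their sum is below \<open>5 * \<epsilon> * (m0 + 1)\<close>.\<close>
    define \<epsilon> where "\<epsilon> = r / (5 * (m0 + 1))"
    have \<epsilon>: "0 < \<epsilon>" using r m0' by (simp add: \<epsilon>_def)
    obtain c d where c: "\<And>w. w \<in> {0..2} \<Longrightarrow> \<bar>G w - (\<Sum>i\<le>d. c i * w ^ i)\<bar> < \<epsilon>"
      using polynomial_approximation[OF continuous_on_subset[OF G(1) subset_UNIV] \<epsilon>] by metis
    define P where "P = (\<lambda>w. \<Sum>i\<le>d. c i * w ^ i)"
    define S where "S = (\<Sum>i\<le>d. \<bar>c i\<bar>)"
    have S: "0 \<le> S" by (auto simp: S_def sum_nonneg)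
    have "(\<lambda>l. S * (1/2) ^ l) \<longlonglongrightarrow> S * 0" by (intro tendsto_intros LIMSEQ_power_zero) auto
    then have "eventually (\<lambda>l. S * (1/2) ^ l < \<epsilon>) sequentially"
      using \<epsilon> by (intro order_tendstoD(2)) auto
    then obtain l where l: "S * (1/2) ^ l < \<epsilon>" by (auto simp: eventually_sequentially)
    \<comment> \<open>A majorant of the approximation error on the whole half-line. On
      \<open>{0..2}\<close> the term \<epsilon> suffices. Beyond 2 the error is \<open>P\<close>
      alone and \<open>(w / 2) ^ l\<close> is at least 1; the choice of \<open>l\<close> makes the
      total weight of these terms smaller than \<epsilon>.\<close>
    define Q where "Q = (\<lambda>w. \<epsilon> * w ^ 0 + (\<Sum>i\<le>d. (\<bar>c i\<bar> * (1/2) ^ l) * w ^ (i + l)))"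
    have GP: "\<bar>G w - P w\<bar> \<le> Q w" if w: "0 \<le> w" for w
    proof (cases "w \<le> 2")
      case True
      have "0 \<le> (\<Sum>i\<le>d. (\<bar>c i\<bar> * (1/2) ^ l) * w ^ (i + l))" using w by (intro sum_nonneg) auto
      then show ?thesis using c[of w] w True by (auto simp: P_def Q_def)
    next
      case False
      then have "\<bar>G w - P w\<bar> = \<bar>P w\<bar>" using G(2) by simp
      also have "\<dots> \<le> (\<Sum>i\<le>d. \<bar>c i\<bar> * w ^ i)"
        unfolding P_def using w by (intro order.trans[OF sum_abs] sum_mono) (auto simp: abs_mult)
      also have "\<dots> \<le> (\<Sum>i\<le>d. (\<bar>c i\<bar> * (1/2) ^ l) * w ^ (i + l))"
      proof (rule sum_mono)
        fix i
        have "1 \<le> (w / 2) ^ l" using False by (intro one_le_power) auto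
        then have "1 * (\<bar>c i\<bar> * w ^ i) \<le> (w / 2) ^ l * (\<bar>c i\<bar> * w ^ i)"
          using w by (intro mult_right_mono) auto
        then show "\<bar>c i\<bar> * w ^ i \<le> \<bar>c i\<bar> * (1 / 2) ^ l * w ^ (i + l)"
          by (simp add: power_add power_divide power_one_over field_simps)
      qed
      also have "\<dots> \<le> Q w" using \<epsilon> by (simp add: Q_def)
      finally show ?thesis .
    qed
    have [measurable]: "P \<in> borel_measurable borel" "Q \<in> borel_measurable borel"
      by (auto simp: P_def Q_def)
    have iP: "integrable (\<rho> n) P" "integrable (\<rho> n) Q" for n
      unfolding P_def Q_def by (intro Bochner_Integration.integrable_add
          Bochner_Integration.integrable_sum integrable_mult_right int)+
    have iP': "integrable m P" 
      unfolding P_def by (intro Bochner_Integration.integrable_sum integrable_mult_right int')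
    \<comment> \<open>The limit moments are those of \<open>m\<close> plus an atom of mass
      \<open>s\<close> at 1. Since \<open>G\<close> vanishes at 1, \<open>P 1\<close> is within
      \<epsilon> of 0 and the atom disappears together with \<epsilon>.\<close>
    have limP: "(\<lambda>n. \<integral>w. P w \<partial>\<rho> n) \<longlonglongrightarrow> s * P 1 + (\<integral>w. P w \<partial>m)"
    proof -
      have "(\<lambda>n. \<Sum>i\<le>d. c i * (\<integral>w. w ^ i \<partial>\<rho> n)) \<longlonglongrightarrow> (\<Sum>i\<le>d. c i * (s + (\<integral>w. w ^ i \<partial>m)))"
        by (intro tendsto_intros lim)
      moreover have "(\<integral>w. P w \<partial>\<rho> n) = (\<Sum>i\<le>d. c i * (\<integral>w. w ^ i \<partial>\<rho> n))" for n
        unfolding P_def by (subst Bochner_Integration.integral_sum) (auto intro!: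
            integrable_mult_right int)
      moreover have "(\<integral>w. P w \<partial>m) = (\<Sum>i\<le>d. c i * (\<integral>w. w ^ i \<partial>m))"
        unfolding P_def by (subst Bochner_Integration.integral_sum) (auto intro!:
            integrable_mult_right int')
      ultimately show ?thesis
        by (simp add: P_def algebra_simps sum.distrib sum_distrib_left)
    qed
    have limQ: "(\<lambda>n. \<integral>w. Q w \<partial>\<rho> n) \<longlonglongrightarrow>
       \<epsilon> * (s + (\<integral>w. w ^ 0 \<partial>m)) + (\<Sum>i\<le>d. (\<bar>c i\<bar> * (1/2) ^ l) * (s + (\<integral>w. w ^ (i + l) \<partial>m)))"
    proof -
      have "(\<lambda>n. \<epsilon> * (\<integral>w. w ^ 0 \<partial>\<rho> n) + (\<Sum>i\<le>d. (\<bar>c i\<bar> * (1/2) ^ l) * (\<integral>w. w ^ (i + l) \<partial>\<rho> n)))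
        \<longlonglongrightarrow> \<epsilon> * (s + (\<integral>w. w ^ 0 \<partial>m)) + (\<Sum>i\<le>d. (\<bar>c i\<bar> * (1/2) ^ l) * (s + (\<integral>w. w ^ (i + l) \<partial>m)))"
        by (intro tendsto_intros lim)
      moreover have "(\<integral>w. Q w \<partial>\<rho> n) = \<epsilon> * (\<integral>w. w ^ 0 \<partial>\<rho> n) + (\<Sum>i\<le>d. (\<bar>c i\<bar> * (1/2) ^ l) * (\<integral>w. w ^
          (i + l) \<partial>\<rho> n))" for n
        unfolding Q_def
        apply (subst Bochner_Integration.integral_add)
        apply (intro Bochner_Integration.integrable_add Bochner_Integration.integrable_sum
            integrable_mult_right int)+
        apply (subst Bochner_Integration.integral_sum)
         apply (intro integrable_mult_right int)
        apply simp
        done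
      ultimately show ?thesis by simp
    qed
    have "\<epsilon> * (s + (\<integral>w. w ^ 0 \<partial>m)) + (\<Sum>i\<le>d. (\<bar>c i\<bar> * (1/2) ^ l) * (s + (\<integral>w. w ^ (i + l) \<partial>m)))
      \<le> \<epsilon> * m0 + (\<Sum>i\<le>d. (\<bar>c i\<bar> * (1/2) ^ l) * m0)"
      using \<epsilon> by (intro add_mono mult_left_mono sum_mono mj) auto
    also have "\<dots> = (\<epsilon> + S * (1/2) ^ l) * m0"
      by (simp add: S_def sum_distrib_right distrib_right)
    also have "\<dots> \<le> 2 * \<epsilon> * m0" using l m0' by (intro mult_right_mono) auto
    also have "\<dots> < 2 * \<epsilon> * m0 + \<epsilon>" using \<epsilon> by simp
    finally have evQ: "eventually (\<lambda>n. (\<integral>w. Q w \<partial>\<rho> n) < 2 * \<epsilon> * m0 + \<epsilon>) sequentially"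
      using limQ by (intro order_tendstoD(2))
    have evP: "eventually (\<lambda>n. \<bar>(\<integral>w. P w \<partial>\<rho> n) - (s * P 1 + (\<integral>w. P w \<partial>m))\<bar> < \<epsilon>) sequentially"
      using tendstoD[OF limP \<epsilon>] by (simp add: dist_real_def)
    have "\<bar>P 1\<bar> \<le> \<epsilon>" using c[of 1] G(2)[of 1] by (auto simp: P_def)
    then have sP: "\<bar>s * P 1\<bar> \<le> m0 * \<epsilon>"
      using s m0' \<epsilon> by (auto simp: abs_mult intro!: mult_mono)
    have "\<bar>(\<integral>w. P w \<partial>m) - (\<integral>w. G w \<partial>m)\<bar> \<le> (\<integral>w. \<epsilon> * w ^ 0 \<partial>m)"
      unfolding Bochner_Integration.integral_diff[OF iP' intG', symmetric]
    proof (rule integral_abs_bound[THEN order.trans], rule integral_mono_AE)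
      show "AE w in m. \<bar>P w - G w\<bar> \<le> \<epsilon> * w ^ 0" using unit
      proof eventually_elim
        case (elim w) then show ?case using c[of w] by (auto simp: P_def abs_minus_commute)
      qed
    qed (intro integrable_mult_right int' integrable_abs Bochner_Integration.integrable_diff iP' intG')+
    also have "\<dots> \<le> \<epsilon> * m0" using m0' \<epsilon> by simp
    finally have Pm: "\<bar>(\<integral>w. P w \<partial>m) - (\<integral>w. G w \<partial>m)\<bar> \<le> \<epsilon> * m0" .
    have GPn: "\<bar>(\<integral>w. G w \<partial>\<rho> n) - (\<integral>w. P w \<partial>\<rho> n)\<bar> \<le> (\<integral>w. Q w \<partial>\<rho> n)" for n
      unfolding Bochner_Integration.integral_diff[OF intG iP(1), symmetric]
    proof (rule integral_abs_bound[THEN order.trans], rule integral_mono_AE)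
      show "AE w in \<rho> n. \<bar>G w - P w\<bar> \<le> Q w" using nonneg[of n]
        by eventually_elim (rule GP)
    qed (intro integrable_abs Bochner_Integration.integrable_diff iP intG)+
    have r': "r = 5 * \<epsilon> * (m0 + 1)"
    proof -
      define D where "D = m0 + 1"
      have "0 < D" using m0' by (simp add: D_def)
      then show ?thesis unfolding \<epsilon>_def D_def[symmetric] by simp
    qed
    have "eventually (\<lambda>n. norm ((\<integral>w. G w \<partial>\<rho> n) - (\<integral>w. G w \<partial>m)) < r) sequentially"
      using evQ evP
    proof eventually_elim
      case (elim n)
      have "\<epsilon> * m0 \<ge> 0" using \<epsilon> m0' by simp
      with elim GPn[of n] Pm sP show ?case using \<epsilon>
        unfolding r' real_norm_def by (simp add: algebra_simps abs_le_iff abs_less_iff)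
    qed
    then show "\<exists>no. \<forall>n\<ge>no. norm ((\<integral>w. G w \<partial>\<rho> n) - (\<integral>w. G w \<partial>m)) < r"
      by (simp add: eventually_sequentially)
  qed
qed

text \<open>Laplace uniqueness from one arithmetic progression of exponents. Under
  \<open>w = exp (y - a)\<close> the half-line \<open>{..a}\<close> goes into the unit interval and
  the exponentials become \<open>exp (\<alpha> * y)\<close> times powers of \<open>w\<close>. As
  \<open>f\<close> vanishes near minus infinity, it is \<open>exp (\<alpha> * y)\<close> times a
  continuous function of \<open>w\<close>, which polynomials approximate uniformly; the error is
  weighted by the finite integrals of \<open>exp (\<alpha> * y)\<close>.\<close>

lemma laplace_additive_imp_integral_additive:
  fixes N1 N2 N3 :: "real measure" and f :: "real \<Rightarrow> real" and \<alpha> a l u :: real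
  assumes sets: "sets N1 = sets borel" "sets N2 = sets borel" "sets N3 = sets borel"
    and le: "AE y in N1. y \<le> a" "AE y in N2. y \<le> a" "AE y in N3. y \<le> a"
    and int: "\<And>j::nat. integrable N1 (\<lambda>y. exp ((\<alpha> + real j) * y))"
      "\<And>j::nat. integrable N2 (\<lambda>y. exp ((\<alpha> + real j) * y))"
      "\<And>j::nat. integrable N3 (\<lambda>y. exp ((\<alpha> + real j) * y))"
    and eq: "\<And>j::nat. (\<integral>y. exp ((\<alpha> + real j) * y) \<partial>N1) + (\<integral>y. exp ((\<alpha> + real j) * y) \<partial>N2)
        = (\<integral>y. exp ((\<alpha> + real j) * y) \<partial>N3)"
    and f: "continuous_on UNIV f" "\<And>y. y \<le> l \<Longrightarrow> f y = 0"
  shows "integrable N1 f" "integrable N2 f" "integrable N3 f"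
    "(\<integral>y. f y \<partial>N1) + (\<integral>y. f y \<partial>N2) = (\<integral>y. f y \<partial>N3)"
proof -
  \<comment> \<open>Truncating at \<open>exp (l - a)\<close> keeps the logarithm away from 0 and
    changes nothing, because \<open>f\<close> is 0 up to \<open>l\<close>.\<close>
  define G where "G = (\<lambda>w. f (a + ln (max w (exp (l - a)))) * exp (- \<alpha> * (a + ln (max w (exp (l -
      a))))))"
  have pos: "0 < max w (exp (l - a))" for w :: real by (simp add: less_max_iff_disj)
  have contG: "continuous_on S G" for S
    unfolding G_def
    by (intro continuous_intros continuous_on_compose2[OF f(1)]) (use pos in \<open>auto simp:
        less_imp_neq[symmetric]\<close>)
  have fG: "f y = exp (\<alpha> * y) * G (exp (y - a))" for y
  proof (cases "l \<le> y")
    case True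
    then have "max (exp (y - a)) (exp (l - a)) = exp (y - a)" by simp
    then show ?thesis by (simp add: G_def exp_minus)
  next
    case False
    then have "max (exp (y - a)) (exp (l - a)) = exp (l - a)" by simp
    then show ?thesis using False f(2) by (simp add: G_def)
  qed
  obtain g where g: "\<And>w. w \<in> {0..1} \<Longrightarrow> \<bar>G w\<bar> \<le> g"
    using compact_imp_bounded[OF compact_continuous_image[OF contG compact_Icc[of 0 1]]]
    unfolding bounded_iff by fastforce
  have [measurable]: "f \<in> borel_measurable borel"
    using f(1) by (rule borel_measurable_continuous_onI)
  have w01: "exp (y - a) \<in> {0..1}" if "y \<le> a" for y using that by auto
  have intf: "integrable N f"
    if s: "sets N = sets borel" and "AE y in N. y \<le> a"
      and i: "\<And>j::nat. integrable N (\<lambda>y. exp ((\<alpha> + real j) * y))" for N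
  proof (rule Bochner_Integration.integrable_bound)
    show "integrable N (\<lambda>y. g * exp ((\<alpha> + real 0) * y))" by (intro integrable_mult_right i)
    show "f \<in> borel_measurable N" using s by (simp cong: measurable_cong_sets)
    show "AE y in N. norm (f y) \<le> norm (g * exp ((\<alpha> + real 0) * y))"
      using that(2)
    proof eventually_elim
      case (elim y)
      then show ?case using g[OF w01[OF elim]] by (auto simp: fG abs_mult)
    qed
  qed
  show iN: "integrable N1 f" "integrable N2 f" "integrable N3 f"
    by (intro intf sets le int)+
  define I where "I N = (\<integral>y. exp (\<alpha> * y) \<partial>N)" for N :: "real measure"
  have I0: "0 \<le> I N" for N unfolding I_def by simp
  define T where "T = \<bar>(\<integral>y. f y \<partial>N1) + (\<integral>y. f y \<partial>N2) - (\<integral>y. f y \<partial>N3)\<bar>"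
  have T: "T \<le> \<epsilon> * (I N1 + I N2 + I N3)" if \<epsilon>: "0 < \<epsilon>" for \<epsilon>
  proof -
    obtain c d where c: "\<And>w. w \<in> {0..1} \<Longrightarrow> \<bar>G w - (\<Sum>i\<le>d. c i * w ^ i)\<bar> < \<epsilon>"
      using polynomial_approximation[OF contG \<epsilon>] by metis
    define P where "P = (\<lambda>y. \<Sum>i\<le>d. (c i * exp (- real i * a)) * exp ((\<alpha> + real i) * y))"
    have P: "P y = exp (\<alpha> * y) * (\<Sum>i\<le>d. c i * exp (y - a) ^ i)" for y
      unfolding P_def sum_distrib_left
      by (intro sum.cong) (auto simp: exp_of_nat_mult[symmetric] exp_add[symmetric] algebra_simps
          simp flip: exp_diff)
    have *: "integrable N P" "\<bar>(\<integral>y. f y \<partial>N) - (\<integral>y. P y \<partial>N)\<bar> \<le> \<epsilon> * I N"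
      "(\<integral>y. P y \<partial>N) = (\<Sum>i\<le>d. (c i * exp (- real i * a)) * (\<integral>y. exp ((\<alpha> + real i) * y) \<partial>N))"
      if s: "sets N = sets borel" and l: "AE y in N. y \<le> a"
        and i: "\<And>j::nat. integrable N (\<lambda>y. exp ((\<alpha> + real j) * y))" for N
    proof -
      show iP: "integrable N P"
        unfolding P_def by (intro Bochner_Integration.integrable_sum integrable_mult_right i)
      show "(\<integral>y. P y \<partial>N) = (\<Sum>i\<le>d. (c i * exp (- real i * a)) * (\<integral>y. exp ((\<alpha> + real i) * y) \<partial>N))"
        unfolding P_def by (subst Bochner_Integration.integral_sum) (auto intro!:
            integrable_mult_right i)
      have i0: "integrable N (\<lambda>y. \<epsilon> * exp (\<alpha> * y))" using i[of 0] by simp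
      have "\<bar>(\<integral>y. f y \<partial>N) - (\<integral>y. P y \<partial>N)\<bar> \<le> (\<integral>y. \<epsilon> * exp (\<alpha> * y) \<partial>N)"
        unfolding Bochner_Integration.integral_diff[OF intf[OF that] iP, symmetric]
      proof (rule integral_abs_bound[THEN order.trans], rule integral_mono_AE)
        show "AE y in N. \<bar>f y - P y\<bar> \<le> \<epsilon> * exp (\<alpha> * y)"
          using l
        proof eventually_elim
          case (elim y)
          then show ?case using c[OF w01[OF elim]]
            by (simp add: fG P right_diff_distrib[symmetric] abs_mult)
        qed
      qed (intro i0 integrable_abs Bochner_Integration.integrable_diff iP intf that)+
      then show "\<bar>(\<integral>y. f y \<partial>N) - (\<integral>y. P y \<partial>N)\<bar> \<le> \<epsilon> * I N" by (simp add: I_def)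
    qed
    have "(\<integral>y. P y \<partial>N1) + (\<integral>y. P y \<partial>N2) = (\<integral>y. P y \<partial>N3)"
      unfolding *(3)[OF sets(1) le(1) int(1)] *(3)[OF sets(2) le(2) int(2)] *(3)[OF sets(3) le(3) int(3)]
        eq[symmetric] by (simp add: distrib_left sum.distrib)
    then show ?thesis
      using *(2)[OF sets(1) le(1) int(1)] *(2)[OF sets(2) le(2) int(2)] *(2)[OF sets(3) le(3) int(3)]
      unfolding T_def by (simp add: algebra_simps abs_le_iff)
  qed
  have "T \<le> 0"
  proof (rule field_le_epsilon)
    fix e :: real assume "0 < e"
    have "T \<le> e / (I N1 + I N2 + I N3 + 1) * (I N1 + I N2 + I N3)"
      using \<open>0 < e\<close> I0[of N1] I0[of N2] I0[of N3] by (intro T) auto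
    also have "\<dots> \<le> e" using \<open>0 < e\<close> I0[of N1] I0[of N2] I0[of N3] by (simp add: field_simps)
    finally show "T \<le> 0 + e" by simp
  qed
  then show "(\<integral>y. f y \<partial>N1) + (\<integral>y. f y \<partial>N2) = (\<integral>y. f y \<partial>N3)" by (simp add: T_def)
qed

text \<open>A trapezoid with edges of slope \<open>n\<close>, cut off at height 1. As
  \<open>n\<close> grows it increases to the indicator of the open interval, so identities for
  continuous test functions pass to open intervals by monotone convergence.\<close>

definition tent :: "real \<Rightarrow> real \<Rightarrow> nat \<Rightarrow> real \<Rightarrow> real" where
  "tent l u n y = min 1 (real n * max 0 (min (y - l) (u - y)))"

lemma tent_nonneg: "0 \<le> tent l u n y"
  and tent_le_1: "tent l u n y \<le> 1"
  and tent_eq_0_left: "y \<le> l \<Longrightarrow> tent l u n y = 0"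
  and tent_eq_0_right: "u \<le> y \<Longrightarrow> tent l u n y = 0"
  by (auto simp: tent_def)

lemma continuous_on_tent: "continuous_on S (tent l u n)"
  unfolding tent_def by (intro continuous_intros)

lemma tent_measurable [measurable]: "tent l u n \<in> borel_measurable borel"
  by (intro borel_measurable_continuous_onI continuous_on_tent)

lemma tent_mono: "m \<le> n \<Longrightarrow> tent l u m y \<le> tent l u n y"
  unfolding tent_def by (intro min.mono mult_right_mono) auto

lemma tent_eventually_eq_1:
  assumes "l < y" "y < u"
  shows "eventually (\<lambda>n. tent l u n y = 1) sequentially"
proof -
  define c where "c = max 0 (min (y - l) (u - y))"
  have c: "0 < c" using assms by (auto simp: c_def)
  obtain N where N: "1 / c < real N" using reals_Archimedean2 by blast
  have "tent l u n y = 1" if "N \<le> n" for n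
  proof -
    have "1 < real N * c" using N c by (simp add: field_simps)
    also have "\<dots> \<le> real n * c" using that c by (intro mult_right_mono) auto
    finally show ?thesis by (simp add: tent_def c_def[symmetric])
  qed
  then show ?thesis by (auto simp: eventually_sequentially)
qed

lemma nn_integral_tent_tendsto:
  assumes [measurable_cong]: "sets N = sets borel" and [measurable]: "w \<in> borel_measurable borel"
  shows "(\<lambda>n. \<integral>\<^sup>+y. ennreal (tent l u n y) * w y \<partial>N) \<longlonglongrightarrow> (\<integral>\<^sup>+y\<in>{l<..<u}. w y \<partial>N)"
proof (rule nn_integral_LIMSEQ)
  show "incseq (\<lambda>n y. ennreal (tent l u n y) * w y)"
    by (auto simp: incseq_def le_fun_def intro!: mult_right_mono ennreal_leI tent_mono)
  show "(\<lambda>n. ennreal (tent l u n y) * w y) \<longlonglongrightarrow> w y * indicator {l<..<u} y" for y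
  proof (cases "l < y \<and> y < u")
    case True
    with tent_eventually_eq_1[of l y u]
    have "eventually (\<lambda>n. ennreal (tent l u n y) * w y = w y) sequentially"
      by (auto elim: eventually_mono)
    then show ?thesis using True by (intro tendsto_eventually) (auto elim: eventually_mono)
  next
    case False
    then have "tent l u n y = 0" for n by (auto simp: tent_def)
    then show ?thesis using False by (auto simp: indicator_def)
  qed
qed measurable

section \<open>Small-time behaviour of the increments\<close>

text \<open>With \<open>s = - t\<close>, the Taylor bound
  \<open>1 + s + s\<^sup>2 / 2 \<le> exp s\<close> is inverted: its left side times
  \<open>1 - s + s\<^sup>2 / 2\<close> equals \<open>1 + s ^ 4 / 4\<close>, which is at least
  1.\<close>

lemma exp_le_quadratic: "exp t \<le> 1 + t + t\<^sup>2 / 2" if "t \<le> 0" for t :: real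
proof -
  define s where "s = - t"
  have s: "0 \<le> s" using that by (simp add: s_def)
  have "1 + s + s\<^sup>2 / 2 \<le> exp s" by (rule exp_lower_Taylor_quadratic[OF s])
  moreover have "0 < 1 + s + s\<^sup>2 / 2" using s by (simp add: add_pos_nonneg)
  ultimately have "exp (- s) * (1 + s + s\<^sup>2 / 2) \<le> 1"
    by (simp add: exp_minus field_simps)
  also have "1 \<le> 1 + s ^ 4 / 4" using s by simp
  also have "\<dots> = (1 - s + s\<^sup>2 / 2) * (1 + s + s\<^sup>2 / 2)"
    by (simp add: field_simps power2_eq_square power4_eq_xxxx)
  finally have "exp (- s) \<le> 1 - s + s\<^sup>2 / 2"
    using \<open>0 < 1 + s + s\<^sup>2 / 2\<close> by (simp only: mult_le_cancel_right_pos)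
  then show ?thesis by (simp add: s_def)
qed

lemma levy_measure_set_integrable:
  assumes \<nu>: "levy_measure_neg \<nu>" and g: "g \<in> borel_measurable borel"
    and bound: "\<And>u. u < 0 \<Longrightarrow> \<bar>g u\<bar> \<le> C * min (u\<^sup>2) 1"
  shows "set_integrable \<nu> {..<0} (g :: real \<Rightarrow> real)"
proof -
  have [measurable_cong]: "sets \<nu> = sets borel" using \<nu> by (simp add: levy_measure_neg_def)
  note g[measurable]
  have "integrable \<nu> (\<lambda>u. indicator {..<0} u * min (u\<^sup>2) 1)"
  proof (rule integrableI_bounded)
    have "(\<integral>\<^sup>+ u. ennreal (norm (indicator {..<0} u * min (u\<^sup>2) 1 :: real)) \<partial>\<nu>)
       = (\<integral>\<^sup>+ x\<in>{..<0}. ennreal (min (x\<^sup>2) 1) \<partial>\<nu>)"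
      by (intro nn_integral_cong) (auto simp: indicator_def)
    then show "(\<integral>\<^sup>+ u. ennreal (norm (indicator {..<0} u * min (u\<^sup>2) 1 :: real)) \<partial>\<nu>) < \<infinity>"
      using \<nu> by (simp add: levy_measure_neg_def)
  qed measurable
  then have "integrable \<nu> (\<lambda>u. C * (indicator {..<0} u * min (u\<^sup>2) 1))"
    by (rule integrable_mult_right)
  then show ?thesis
    unfolding set_integrable_def
  proof (rule Bochner_Integration.integrable_bound)
    show "AE u in \<nu>. norm (indicat_real {..<0} u *\<^sub>R g u) \<le> norm (C * (indicator {..<0} u * min
        (u\<^sup>2) 1))"
      using bound by (intro AE_I2) (fastforce simp: indicator_def)
  qed measurable
qed

definition levy_integrand :: "real \<Rightarrow> real \<Rightarrow> real" where
  "levy_integrand \<alpha> u = exp (\<alpha> * u) - 1 - \<alpha> * u * indicator {-1<..} u"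

lemma levy_integrand_set_integrable:
  assumes "levy_measure_neg \<nu>" "0 \<le> \<alpha>"
  shows "set_integrable \<nu> {..<0} (levy_integrand \<alpha>)"
proof (rule levy_measure_set_integrable[OF assms(1)])
  show "levy_integrand \<alpha> \<in> borel_measurable borel"
    unfolding levy_integrand_def[abs_def] by measurable
  fix u :: real assume u: "u < 0"
  have t: "\<alpha> * u \<le> 0" using u assms by (simp add: mult_nonneg_nonpos)
  \<comment> \<open>The constant \<open>\<alpha>\<^sup>2 / 2\<close> comes from the Taylor bound
    near 0; the 1 serves \<open>u \<le> -1\<close>, where the integrand is
    \<open>exp (\<alpha> * u) - 1\<close>.\<close>
  show "\<bar>levy_integrand \<alpha> u\<bar> \<le> (\<alpha>\<^sup>2 / 2 + 1) * min (u\<^sup>2) 1"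
  proof (cases "-1 < u")
    case True
    have "1 + \<alpha> * u \<le> exp (\<alpha> * u)" by (rule exp_ge_add_one_self)
    moreover have "u\<^sup>2 \<le> 1" using u True abs_square_le_1[of u] by simp
    ultimately show ?thesis
      using exp_le_quadratic[OF t] True
      by (simp add: levy_integrand_def power_mult_distrib algebra_simps)
         (use zero_le_power2[of u] in linarith)
  next
    case False
    then have "1 \<le> u\<^sup>2" using one_le_power[of "- u" 2] by simp
    then show ?thesis using t False by (simp add: levy_integrand_def abs_le_iff add_increasing)
  qed
qed

lemma one_minus_exp_square_le:
  "(1 - exp u)\<^sup>2 \<le> min (u\<^sup>2) 1" if "u < 0" for u :: real
proof -
  have "0 \<le> 1 - exp u" "1 - exp u \<le> - u" "1 - exp u \<le> 1"
    using that exp_ge_add_one_self[of u] by (simp, linarith, simp)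
  then have "(1 - exp u)\<^sup>2 \<le> (- u)\<^sup>2" "(1 - exp u)\<^sup>2 \<le> 1"
    by (intro power_mono power_le_one; simp)+
  then show ?thesis by simp
qed

lemma exp_weight_set_integrable:
  assumes "levy_measure_neg \<nu>"
  shows "set_integrable \<nu> {..<0} (\<lambda>u. (1 - exp u)\<^sup>2 * exp u ^ j)"
proof (rule levy_measure_set_integrable[OF assms])
  fix u :: real assume u: "u < 0"
  have "(1 - exp u)\<^sup>2 * exp u ^ j \<le> (1 - exp u)\<^sup>2 * 1"
    using u by (intro mult_left_mono power_le_one) auto
  with one_minus_exp_square_le[OF u]
  show "\<bar>(1 - exp u)\<^sup>2 * exp u ^ j\<bar> \<le> 1 * min (u\<^sup>2) 1" by (simp add: abs_mult)
qed measurable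

text \<open>The second difference removes the drift and the compensator, which are linear in the
  exponent, turns the Gaussian term into \<open>\<sigma>\<^sup>2\<close> and turns
  \<open>exp (\<alpha> * u)\<close> into \<open>(1 - exp u)\<^sup>2 * exp u ^ j\<close>. In the
  variable \<open>w = exp u\<close> the right side is the j-th moment of a finite measure on the
  unit interval plus an atom of mass \<open>\<sigma>\<^sup>2\<close> at 1.\<close>

lemma laplace_exponent_second_difference:
  assumes "levy_measure_neg \<nu>"
  shows "laplace_exponent \<mu> \<sigma> \<nu> (real j) - 2 * laplace_exponent \<mu> \<sigma> \<nu> (real j + 1) +
      laplace_exponent \<mu> \<sigma> \<nu> (real j + 2)
    = \<sigma>\<^sup>2 + (LINT u:{..<0}|\<nu>. (1 - exp u)\<^sup>2 * exp u ^ j)"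
proof -
  let ?I = "\<lambda>\<alpha>. LINT u:{..<0}|\<nu>. levy_integrand \<alpha> u"
  note int = levy_integrand_set_integrable[OF assms]
  have *: "(1 - exp u)\<^sup>2 * exp u ^ j = levy_integrand (real j) u - 2 * levy_integrand (real j + 1)
      u + levy_integrand (real j + 2) u" for u
    using exp_double[of u]
    by (simp add: levy_integrand_def exp_of_nat_mult[symmetric] exp_add algebra_simps power2_eq_square)
  have "(LINT u:{..<0}|\<nu>. (1 - exp u)\<^sup>2 * exp u ^ j) = ?I (real j) - 2 * ?I (real j + 1) + ?I (real
      j + 2)"
    unfolding * using int[of "real j"] int[of "real j + 1"] int[of "real j + 2"]
    by (subst set_integral_add; (subst set_integral_diff)?; simp?) 
  then show ?thesis
    unfolding laplace_exponent_def levy_integrand_def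
    by (simp add: field_simps power2_eq_square)
qed

lemma exp_difference_quotient_tendsto:
  "(\<lambda>n. real (Suc n) * (exp (c / real (Suc n)) - 1)) \<longlonglongrightarrow> c" for c :: real
proof -
  have "((\<lambda>h. (exp (0 + h) - exp 0) / h) \<longlongrightarrow> exp (0::real)) (at 0)"
    using DERIV_exp[of "0::real"] unfolding DERIV_def .
  then have 1: "((\<lambda>h. (exp h - 1) / h) \<longlongrightarrow> (1::real)) (at 0)" by simp
  show ?thesis
  proof (cases "c = 0")
    case False
    have "filterlim (\<lambda>n. c / real (Suc n)) (at 0) sequentially"
      unfolding filterlim_at
      using LIMSEQ_Suc[OF lim_const_over_n[of c]] False by auto
    from filterlim_compose[OF 1 this]
    have "(\<lambda>n. c * ((exp (c / real (Suc n)) - 1) / (c / real (Suc n)))) \<longlonglongrightarrow> c * 1"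
      by (intro tendsto_intros)
    moreover have "c * (e / (c / N)) = N * e" if "N \<noteq> 0" for e N
      using False that by (simp add: field_simps)
    ultimately show ?thesis by simp
  qed simp
qed

text \<open>Here \<open>\<rho> n\<close> stands for the increment law over time
  \<open>1 / Suc n\<close>. Weighted by \<open>Suc n * (1 - exp u)\<^sup>2\<close> and read in
  \<open>w = exp u\<close>, its moments are scaled second differences of
  \<open>exp (\<phi> j / Suc n)\<close> in \<open>j\<close>, which tend to the second differences of
  \<phi>. The moment lemma applies with the atom \<open>s = \<sigma>\<^sup>2\<close>, and dividing
  the test function by the weight is possible because \<open>k\<close> vanishes near 0.\<close>

lemma small_time_limit:
  fixes \<rho> :: "nat \<Rightarrow> real measure"
  assumes \<nu>: "levy_measure_neg \<nu>"
    and sets: "\<And>n. sets (\<rho> n) = sets borel"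
    and \<rho>: "\<And>n \<alpha>. 0 \<le> \<alpha> \<Longrightarrow> has_bochner_integral (\<rho> n) (\<lambda>u. exp (\<alpha> * u)) (exp (laplace_exponent \<mu> \<sigma> \<nu>
        \<alpha> / real (Suc n)))"
    and k: "continuous_on UNIV k" "\<And>u. u \<le> c \<Longrightarrow> k u = 0" "\<And>u. d \<le> u \<Longrightarrow> k u = 0" and d: "d < 0"
  shows "(\<lambda>n. real (Suc n) * (\<integral>u. k u \<partial>\<rho> n)) \<longlonglongrightarrow> (\<integral>u. k u \<partial>\<nu>)"
proof -
  let ?\<phi> = "laplace_exponent \<mu> \<sigma> \<nu>"
  have s\<nu>[measurable_cong]: "sets \<nu> = sets borel" using \<nu> by (simp add: levy_measure_neg_def)
  note sets[measurable_cong]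
  have [measurable]: "k \<in> borel_measurable borel"
    using k(1) by (rule borel_measurable_continuous_onI)
  define N where "N n = distr (density (\<rho> n) (\<lambda>u. ennreal (real (Suc n) * (1 - exp u)\<^sup>2))) borel
      exp" for n
  define m where "m = distr (density \<nu> (\<lambda>u. ennreal (indicator {..<0} u * (1 - exp u)\<^sup>2))) borel exp"
  have exp_m: "(exp :: real \<Rightarrow> real) \<in> borel_measurable borel" by measurable
  have N_int: "integrable (N n) g \<longleftrightarrow> integrable (\<rho> n) (\<lambda>u. real (Suc n) * (1 - exp u)\<^sup>2 * g (exp u))"
    "(\<integral>w. g w \<partial>N n) = (\<integral>u. real (Suc n) * (1 - exp u)\<^sup>2 * g (exp u) \<partial>\<rho> n)"
    if [measurable]: "g \<in> borel_measurable borel" for n and g :: "real \<Rightarrow> real"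
    unfolding N_def
    by (subst integrable_distr_eq integral_distr; (subst integrable_real_density
        integral_real_density)?; simp)+
  have m_int: "integrable m g \<longleftrightarrow> integrable \<nu> (\<lambda>u. indicator {..<0} u * (1 - exp u)\<^sup>2 * g (exp u))"
    "(\<integral>w. g w \<partial>m) = (\<integral>u. indicator {..<0} u * (1 - exp u)\<^sup>2 * g (exp u) \<partial>\<nu>)"
    if [measurable]: "g \<in> borel_measurable borel" for g :: "real \<Rightarrow> real"
    unfolding m_def
    by (subst integrable_distr_eq integral_distr; (subst integrable_real_density
        integral_real_density)?; simp)+
  have mom: "has_bochner_integral (\<rho> n) (\<lambda>u. real (Suc n) * (1 - exp u)\<^sup>2 * exp u ^ j)
    (real (Suc n) * (exp (?\<phi> j / real (Suc n)) - 2 * exp (?\<phi> (j + 1) / real (Suc n)) + exp (?\<phi> (j +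
        2) / real (Suc n))))" for n j
  proof -
    have "real (Suc n) * (1 - exp u)\<^sup>2 * exp u ^ j
       = real (Suc n) * (exp (real j * u) - 2 * exp ((real j + 1) * u) + exp ((real j + 2) * u))"
           for u :: real
      using exp_double[of u]
      by (simp add: exp_of_nat_mult[symmetric] distrib_right exp_add power2_eq_square algebra_simps)
    then show ?thesis
      by (simp only: of_nat_add of_nat_1 of_nat_numeral) (intro has_bochner_integral_mult_right
          has_bochner_integral_add has_bochner_integral_diff \<rho>; simp)
  qed
  \<comment> \<open>The quotient of \<open>k\<close> by the weight, in the variable
    \<open>w\<close>. The \<open>max\<close> and the \<open>min\<close> keep the logarithm and the
    denominator away from their singularities; they act only where \<open>k\<close> is 0.\<close>
  define G where "G = (\<lambda>w. k (ln (max w (exp c))) / (1 - min w (exp d))\<^sup>2)"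
  have pos: "0 < max w (exp c)" for w by (simp add: less_max_iff_disj)
  have ne: "(1 - min w (exp d))\<^sup>2 \<noteq> 0" for w
  proof -
    have "min w (exp d) < 1" using d by (simp add: min_less_iff_disj)
    then show ?thesis by simp
  qed
  have G: "continuous_on UNIV G"
    unfolding G_def using ne pos
    by (intro continuous_intros continuous_on_compose2[OF k(1)]) (auto simp: less_imp_neq[symmetric])
  then have [measurable]: "G \<in> borel_measurable borel" by (rule borel_measurable_continuous_onI)
  have G1: "G w = 0" if "1 \<le> w" for w
  proof -
    have "0 \<le> ln (max w (exp c))" using that by (intro ln_ge_zero) (simp add: le_max_iff_disj)
    then show ?thesis using k(3) d by (simp add: G_def)
  qed
  have kG: "(1 - exp u)\<^sup>2 * G (exp u) = k u" for u
  proof -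
    consider "u < c" | "c \<le> u" "u \<le> d" | "c \<le> u" "d < u" by linarith
    then show ?thesis
    proof cases
      case 1
      then have "max (exp u) (exp c) = exp c" by simp
      then show ?thesis using 1 k(2) by (simp add: G_def)
    next
      case 2
      then have "max (exp u) (exp c) = exp u" "min (exp u) (exp d) = exp u" by simp_all
      then show ?thesis using 2 d by (simp add: G_def)
    next
      case 3
      then have "max (exp u) (exp c) = exp u" by simp
      then show ?thesis using 3 k(3) by (simp add: G_def)
    qed
  qed
  have AE\<nu>: "AE u in \<nu>. u < 0"
    using \<nu> by (intro AE_I[where N="{0..}"]) (auto simp: levy_measure_neg_def)
  have "(\<lambda>n. \<integral>w. G w \<partial>N n) \<longlonglongrightarrow> (\<integral>w. G w \<partial>m)"
  proof (rule moments_imp_integral_tendsto[where s="\<sigma>\<^sup>2"])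
    show "integrable (N n) (\<lambda>w. w ^ j)" for n j
      using mom[of n j] by (simp add: N_int has_bochner_integral_iff)
    show "AE w in N n. 0 \<le> w" for n
      unfolding N_def by (subst AE_distr_iff) (auto simp: AE_density)
    show "integrable m (\<lambda>w. w ^ j)" for j
      using exp_weight_set_integrable[OF \<nu>, of j] by (simp add: m_int set_integrable_def mult.assoc)
    show "AE w in m. 0 \<le> w \<and> w \<le> 1"
      unfolding m_def by (subst AE_distr_iff) (auto simp: AE_density indicator_def)
    show "(\<lambda>n. \<integral>w. w ^ j \<partial>N n) \<longlonglongrightarrow> \<sigma>\<^sup>2 + (\<integral>w. w ^ j \<partial>m)" for j
    proof -
      \<comment> \<open>The subtracted ones cancel, since 1 - 2 + 1 = 0; they turn each summand into
        a difference quotient of the exponential at 0.\<close>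
      have "(\<lambda>n. real (Suc n) * (exp (?\<phi> j / real (Suc n)) - 1)
          - 2 * (real (Suc n) * (exp (?\<phi> (j + 1) / real (Suc n)) - 1))
          + real (Suc n) * (exp (?\<phi> (j + 2) / real (Suc n)) - 1))
        \<longlonglongrightarrow> ?\<phi> j - 2 * ?\<phi> (j + 1) + ?\<phi> (j + 2)"
        by (intro tendsto_intros exp_difference_quotient_tendsto)
      also have "?\<phi> j - 2 * ?\<phi> (j + 1) + ?\<phi> (j + 2) = \<sigma>\<^sup>2 + (\<integral>w. w ^ j \<partial>m)"
        using laplace_exponent_second_difference[OF \<nu>, of \<mu> \<sigma> j]
        by (simp add: m_int set_lebesgue_integral_def mult.assoc add.commute)
      finally have lim: "(\<lambda>n. real (Suc n) * (exp (?\<phi> j / real (Suc n)) - 1)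
          - 2 * (real (Suc n) * (exp (?\<phi> (j + 1) / real (Suc n)) - 1))
          + real (Suc n) * (exp (?\<phi> (j + 2) / real (Suc n)) - 1))
        \<longlonglongrightarrow> \<sigma>\<^sup>2 + (\<integral>w. w ^ j \<partial>m)" .
      have "(\<integral>w. w ^ j \<partial>N n) = real (Suc n) * (exp (?\<phi> j / real (Suc n)) - 2 * exp (?\<phi> (j + 1) /
          real (Suc n)) + exp (?\<phi> (j + 2) / real (Suc n)))" for n
        using has_bochner_integral_integral_eq[OF mom[of n j]] by (subst N_int(2)) simp_all
      also have "\<dots> n = real (Suc n) * (exp (?\<phi> j / real (Suc n)) - 1)
          - 2 * (real (Suc n) * (exp (?\<phi> (j + 1) / real (Suc n)) - 1))
          + real (Suc n) * (exp (?\<phi> (j + 2) / real (Suc n)) - 1)" for n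
        by (simp only: right_diff_distrib distrib_left)
      finally show ?thesis using lim by simp
    qed
    show "sets (N n) = sets borel" for n by (simp add: N_def)
    show "sets m = sets borel" by (simp add: m_def)
  qed (use G G1 in auto)
  also have "(\<integral>w. G w \<partial>m) = (\<integral>u. k u \<partial>\<nu>)"
    by (simp add: m_int, intro integral_cong_AE) (use AE\<nu> in \<open>auto simp: kG indicator_def\<close>)
  also have "(\<lambda>n. \<integral>w. G w \<partial>N n) = (\<lambda>n. real (Suc n) * (\<integral>u. k u \<partial>\<rho> n))"
    by (simp add: N_int mult.assoc kG)
  finally show ?thesis .
qed

section \<open>Paths killed on leaving an interval\<close>

text \<open>The lower condition asks for a margin \<open>c\<close>, so it says that the infimum up
  to \<open>t\<close> exceeds \<open>b\<close>: a left limit equal to \<open>b\<close> kills as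
  well. The upper barrier may be touched.\<close>

definition alive :: "real \<Rightarrow> real \<Rightarrow> (real \<Rightarrow> real) \<Rightarrow> real \<Rightarrow> bool" where
  "alive a b f t \<longleftrightarrow> (\<forall>s\<in>{0..t}. f s \<le> a) \<and> (\<exists>c>b. \<forall>s\<in>{0..t}. c \<le> f s)"

definition exits :: "real \<Rightarrow> real \<Rightarrow> (real \<Rightarrow> real) \<Rightarrow> bool" where
  "exits a b f \<longleftrightarrow> (\<exists>t\<ge>0. \<not> alive a b f t)"

text \<open>Meaningful only under \<open>exits\<close>: otherwise the set is unbounded and
  \<open>Sup\<close> has no useful value, which is why \<open>exit_before\<close> tests
  \<open>exits\<close> first.\<close>

definition exit_time :: "real \<Rightarrow> real \<Rightarrow> (real \<Rightarrow> real) \<Rightarrow> real" where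
  "exit_time a b f = Sup {t. 0 \<le> t \<and> alive a b f t}"

definition exit_before :: "real \<Rightarrow> real \<Rightarrow> nat \<Rightarrow> (real \<Rightarrow> real) \<Rightarrow> real" where
  "exit_before a b N f = (if exits a b f \<and> exit_time a b f \<le> real N then exit_time a b f else real N)"

text \<open>The cap \<open>N * Suc n\<close> is the index of time \<open>N\<close> on the grid of
  mesh \<open>1 / Suc n\<close>; it makes \<open>LEAST\<close> well defined for paths that
  survive.\<close>

definition exit_index :: "real \<Rightarrow> real \<Rightarrow> nat \<Rightarrow> nat \<Rightarrow> (real \<Rightarrow> real) \<Rightarrow> nat" where
  "exit_index a b N n f = (LEAST k. k = N * Suc n \<or> \<not> alive a b f (real k / real (Suc n)))"

lemma alive_antimono: "alive a b f t \<Longrightarrow> s \<le> t \<Longrightarrow> alive a b f s"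
  unfolding alive_def by (meson atLeastAtMost_iff order_trans)

lemma alive_bounds: "alive a b f t \<Longrightarrow> 0 \<le> t \<Longrightarrow> b < f t \<and> f t \<le> a"
  unfolding alive_def by (meson atLeastAtMost_iff less_le_trans order_refl)

lemma cadlag_right_sequence:
  assumes "cadlag f" "0 \<le> s" "\<And>n. s \<le> S n" "S \<longlonglongrightarrow> s"
  shows "(\<lambda>n. f (S n)) \<longlonglongrightarrow> f s"
proof -
  have "(f \<longlongrightarrow> f s) (at s within {s<..})" using assms by (simp add: cadlag_def)
  then have "continuous (at s within {s..}) f"
    by (simp add: continuous_within at_within_Ici_at_right)
  then show ?thesis
    unfolding continuous_within_sequentially using assms by (auto simp: o_def)
qed

lemma cadlag_left_limit:
  assumes "cadlag f" "0 < s"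
  shows "(f \<longlongrightarrow> left_limit f s) (at_left s)"
proof -
  obtain l where "(f \<longlongrightarrow> l) (at_left s)" using assms by (auto simp: cadlag_def)
  then show ?thesis unfolding left_limit_def using tendsto_Lim trivial_limit_at_left_real by metis
qed

lemma cadlag_left_sequence:
  assumes "cadlag f" "0 < s" "\<And>n. S n < s" "S \<longlonglongrightarrow> s"
  shows "(\<lambda>n. f (S n)) \<longlonglongrightarrow> left_limit f s"
proof -
  have "filterlim S (at_left s) sequentially"
    using assms by (auto simp: filterlim_at less_imp_neq intro!: always_eventually)
  then show ?thesis by (rule filterlim_compose[OF cadlag_left_limit[OF assms(1,2)]])
qed

lemma ceiling_grid:
  fixes s :: real
  assumes "0 \<le> s"
  shows "s \<le> real (nat \<lceil>s * real (Suc n)\<rceil>) / real (Suc n)"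
    and "real (nat \<lceil>s * real (Suc n)\<rceil>) / real (Suc n) \<le> s + 1 / real (Suc n)"
proof -
  define r where "r = s * real (Suc n)"
  have "0 \<le> r" using assms by (simp add: r_def)
  then have "real (nat \<lceil>r\<rceil>) = of_int \<lceil>r\<rceil>" by simp
  then have *: "r \<le> real (nat \<lceil>r\<rceil>)" "real (nat \<lceil>r\<rceil>) \<le> r + 1"
    using ceiling_correct[of r] by linarith+
  have "s \<le> c / N" "c / N \<le> s + 1 / N" if "s * N \<le> c" "c \<le> s * N + 1" "0 < N" for c N :: real
    using that by (simp_all add: field_simps)
  from this[OF *[unfolded r_def]]
  show "s \<le> real (nat \<lceil>s * real (Suc n)\<rceil>) / real (Suc n)"
    "real (nat \<lceil>s * real (Suc n)\<rceil>) / real (Suc n) \<le> s + 1 / real (Suc n)" by simp_all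
qed

lemma ceiling_grid_tendsto:
  fixes s :: real
  assumes "0 \<le> s"
  shows "(\<lambda>n. real (nat \<lceil>s * real (Suc n)\<rceil>) / real (Suc n)) \<longlonglongrightarrow> s"
proof (rule tendsto_sandwich[OF _ _ tendsto_const])
  have "(\<lambda>n. s + 1 / real (Suc n)) \<longlonglongrightarrow> s + 0"
    by (intro tendsto_intros LIMSEQ_Suc[OF lim_const_over_n[of 1]])
  then show "(\<lambda>n. s + 1 / real (Suc n)) \<longlonglongrightarrow> s" by simp
qed (use ceiling_grid[OF assms] in auto)

text \<open>Right-continuity makes the path a limit of step functions read off at the next grid
  point to the right. The \<open>max 0 s\<close> avoids negative times, about which
  \<open>cadlag\<close> says nothing.\<close>

lemma cadlag_measurable:
  assumes "cadlag f"
  shows "(\<lambda>s. f (max 0 s)) \<in> borel_measurable borel"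
proof (rule borel_measurable_LIMSEQ_real)
  show "(\<lambda>n. f (real (nat \<lceil>max 0 s * real (Suc n)\<rceil>) / real (Suc n))) \<longlonglongrightarrow> f (max 0 s)" for s
    by (rule cadlag_right_sequence[OF assms _ ceiling_grid(1) ceiling_grid_tendsto]) auto
  show "(\<lambda>s. f (real (nat \<lceil>max 0 s * real (Suc n)\<rceil>) / real (Suc n))) \<in> borel_measurable borel" for n
    by (rule measurable_compose[where N="count_space UNIV" and g="\<lambda>k. f (real k / real (Suc n))"]) auto
qed

section \<open>First exit of a single path from an interval\<close>

locale spectrally_negative_path =
  fixes f :: "real \<Rightarrow> real" and a b :: real
  assumes cadlag: "cadlag f" and no_jumps: "no_positive_jumps f"
    and start_gt: "b < f 0" and start_less: "f 0 < a"
begin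

lemma near_right:
  assumes "0 \<le> t" "f t < u" "l < f t"
  obtains \<epsilon> where "0 < \<epsilon>" "\<And>s. s \<in> {t..t + \<epsilon>} \<Longrightarrow> l < f s \<and> f s < u"
proof -
  have "(f \<longlongrightarrow> f t) (at_right t)" using cadlag assms(1) by (auto simp: cadlag_def)
  then have "eventually (\<lambda>s. l < f s \<and> f s < u) (at_right t)"
    using assms by (intro eventually_conj order_tendstoD)
  then obtain v where v: "t < v" "\<And>s. t < s \<Longrightarrow> s < v \<Longrightarrow> l < f s \<and> f s < u"
    by (auto simp: eventually_at_right_field)
  show ?thesis
  proof (rule that[of "(v - t) / 2"])
    fix s assume "s \<in> {t..t + (v - t) / 2}"
    then show "l < f s \<and> f s < u" using v(1) v(2)[of s] assms by (cases "s = t") (auto simp: field_simps)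
  qed (use v in auto)
qed

lemma alive_extend:
  assumes "alive a b f t" "0 \<le> t" "f t < a"
  obtains \<epsilon> where "0 < \<epsilon>" "alive a b f (t + \<epsilon>)"
proof -
  obtain c where c: "b < c" "\<And>s. s \<in> {0..t} \<Longrightarrow> c \<le> f s" "\<And>s. s \<in> {0..t} \<Longrightarrow> f s \<le> a"
    using assms(1) by (auto simp: alive_def)
  have bt: "b < f t" using c(1) c(2)[of t] assms by auto
  obtain \<epsilon> where \<epsilon>: "0 < \<epsilon>" "\<And>s. s \<in> {t..t + \<epsilon>} \<Longrightarrow> (b + f t) / 2 < f s \<and> f s < a"
    using near_right[OF assms(2,3), of "(b + f t) / 2"] bt by (auto simp: field_simps)
  have "alive a b f (t + \<epsilon>)"
    unfolding alive_def
  proof (intro conjI ballI exI)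
    fix s assume s: "s \<in> {0..t + \<epsilon>}"
    show "f s \<le> a" using c(3)[of s] \<epsilon>(2)[of s] s by (cases "s \<le> t") auto
    show "min c ((b + f t) / 2) \<le> f s" using c(2)[of s] \<epsilon>(2)[of s] s
      by (cases "s \<le> t") (auto simp: min_le_iff_disj field_simps)
  qed (use c(1) bt in simp)
  with \<epsilon>(1) show ?thesis by (rule that)
qed

lemma alive_0: "alive a b f 0"
  using start_gt start_less unfolding alive_def by (auto intro!: exI[of _ "f 0"])

lemma exits_imp_bdd:
  assumes "exits a b f"
  obtains B where "0 \<le> B" "\<And>t. 0 \<le> t \<Longrightarrow> alive a b f t \<Longrightarrow> t \<le> B"
proof -
  obtain B where B: "0 \<le> B" "\<not> alive a b f B" using assms by (auto simp: exits_def)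
  show ?thesis by (rule that[OF B(1)]) (use B(2) alive_antimono linorder_le_cases in blast)
qed

lemma alive_imp_le_exit_time:
  assumes "exits a b f" "0 \<le> t" "alive a b f t" shows "t \<le> exit_time a b f"
proof -
  obtain B where "\<And>t. 0 \<le> t \<Longrightarrow> alive a b f t \<Longrightarrow> t \<le> B" using exits_imp_bdd[OF assms(1)] by metis
  then show ?thesis unfolding exit_time_def using assms by (intro cSup_upper bdd_aboveI[of _ B]) auto
qed

lemma less_exit_time_imp_alive:
  assumes "exits a b f" "t < exit_time a b f" shows "alive a b f t"
proof -
  have "\<exists>s\<in>{t. 0 \<le> t \<and> alive a b f t}. t < s"
    using assms(2) alive_0 unfolding exit_time_def by (intro less_cSupD) auto
  then show ?thesis using alive_antimono[of a b f _ t] by auto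
qed

lemma exit_time_pos: assumes "exits a b f" shows "0 < exit_time a b f"
  using alive_extend[OF alive_0 order_refl start_less] alive_imp_le_exit_time[OF assms]
  by (metis add_0 less_le_trans less_imp_le)

lemma not_alive_imp_exit_time_le:
  assumes "0 \<le> t" "\<not> alive a b f t" shows "exit_time a b f \<le> t"
  using assms less_exit_time_imp_alive[of t] by (force simp: exits_def)

lemma left_limit_ge:
  assumes "0 < t" "\<And>s. 0 \<le> s \<Longrightarrow> s < t \<Longrightarrow> l \<le> f s" shows "l \<le> left_limit f t"
proof (rule tendsto_lowerbound[OF cadlag_left_limit[OF cadlag assms(1)]])
  show "eventually (\<lambda>s. l \<le> f s) (at_left t)"
    using assms by (auto simp: eventually_at_left_field intro!: exI[of _ 0])
qed auto

lemma left_limit_le: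
  assumes "0 < t" "\<And>s. 0 \<le> s \<Longrightarrow> s < t \<Longrightarrow> f s \<le> u" shows "left_limit f t \<le> u"
proof (rule tendsto_upperbound[OF cadlag_left_limit[OF cadlag assms(1)]])
  show "eventually (\<lambda>s. f s \<le> u) (at_left t)"
    using assms by (auto simp: eventually_at_left_field intro!: exI[of _ 0])
qed auto

text \<open>The bound on \<open>f t\<close> itself uses the absence of positive jumps: the path
  cannot leap over \<open>a\<close>.\<close>

lemma alive_before_bounds:
  assumes "\<And>s. 0 \<le> s \<Longrightarrow> s < t \<Longrightarrow> alive a b f s" "0 < t"
  shows "b \<le> left_limit f t" "left_limit f t \<le> a" "f t \<le> a"
proof -
  show *: "b \<le> left_limit f t" "left_limit f t \<le> a"
    using alive_bounds[OF assms(1)] less_imp_le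
    by (blast intro: left_limit_ge[OF assms(2)] left_limit_le[OF assms(2)])+
  show "f t \<le> a"
    using no_jumps assms * by (auto simp: no_positive_jumps_def intro: order_trans)
qed

text \<open>Each time before \<open>t\<close> has its own margin above \<open>b\<close>. A left
  limit above \<open>b\<close> supplies one common margin near \<open>t\<close>, and a single alive
  time covers the rest.\<close>

lemma alive_if_left_limit:
  assumes "\<And>s. 0 \<le> s \<Longrightarrow> s < t \<Longrightarrow> alive a b f s" "0 < t" "b < left_limit f t"
  obtains c where "b < c" "\<And>s. 0 \<le> s \<Longrightarrow> s < t \<Longrightarrow> c \<le> f s"
proof -
  have "eventually (\<lambda>s. (b + left_limit f t) / 2 < f s) (at_left t)"
    using assms by (intro order_tendstoD(1)[OF cadlag_left_limit[OF cadlag]]) (auto simp: field_simps)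
  then obtain v where v: "v < t" "\<And>s. v < s \<Longrightarrow> s < t \<Longrightarrow> (b + left_limit f t) / 2 < f s"
    by (auto simp: eventually_at_left_field)
  have "0 \<le> (max v 0 + t) / 2" "(max v 0 + t) / 2 < t" using v(1) assms(2) by (simp_all add: max_def)
  then have "alive a b f ((max v 0 + t) / 2)" by (rule assms(1))
  then obtain c where c: "b < c" "\<And>s. s \<in> {0..(max v 0 + t) / 2} \<Longrightarrow> c \<le> f s"
    by (auto simp: alive_def)
  show ?thesis
  proof (rule that[of "min c ((b + left_limit f t) / 2)"])
    fix s assume s: "0 \<le> s" "s < t"
    show "min c ((b + left_limit f t) / 2) \<le> f s"
    proof (cases "s \<le> (max v 0 + t) / 2")
      case True then show ?thesis using c(2)[of s] s by auto
    next
      case False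
      then have "v < s" using v s by auto
      then show ?thesis using v(2)[of s] s by (simp add: min_le_iff_disj field_simps)
    qed
  qed (use c(1) assms(3) in simp)
qed

text \<open>If \<open>f t\<close> were above \<open>b\<close>, so would be the left limit, as jumps
  only go down; the common margin before \<open>t\<close> would then extend to \<open>t\<close> and
  the path would still be alive. This includes death through a left limit equal to
  \<open>b\<close>.\<close>

lemma first_dead_time_le:
  assumes "\<And>s. 0 \<le> s \<Longrightarrow> s < t \<Longrightarrow> alive a b f s" "0 < t" "\<not> alive a b f t"
  shows "f t \<le> b"
proof (rule ccontr)
  assume "\<not> f t \<le> b"
  then have "b < f t" by simp
  also have "f t \<le> left_limit f t" using no_jumps assms by (auto simp: no_positive_jumps_def)
  finally obtain c where c: "b < c" "\<And>s. 0 \<le> s \<Longrightarrow> s < t \<Longrightarrow> c \<le> f s"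
    using alive_if_left_limit[OF assms(1,2)] by metis
  have "alive a b f t"
    unfolding alive_def
  proof (intro conjI ballI exI)
    fix s assume s: "s \<in> {0..t}"
    show "f s \<le> a"
    proof (cases "s = t")
      case True then show ?thesis using alive_before_bounds(3)[OF assms(1,2)] by simp
    next
      case False
      then have "alive a b f s" using s by (intro assms(1)) auto
      then show ?thesis using alive_bounds s by simp
    qed
    show "min c (f t) \<le> f s" using s c(2)[of s] by (cases "s = t") auto
  qed (use c(1) \<open>b < f t\<close> in simp)
  with assms show False by simp
qed

lemma exit_value_down:
  assumes "exits a b f" "\<not> alive a b f (exit_time a b f)"
  shows "f (exit_time a b f) \<le> b"
  using first_dead_time_le[OF less_exit_time_imp_alive[OF assms(1)] exit_time_pos[OF assms(1)]
      assms(2)] by simp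

text \<open>To be alive at the exit time means to leave upwards: strictly below \<open>a\<close>,
  right-continuity would keep the path alive a little longer.\<close>

lemma exit_value_up:
  assumes "exits a b f" "alive a b f (exit_time a b f)"
  shows "f (exit_time a b f) = a"
proof (rule ccontr)
  have p: "0 \<le> exit_time a b f" using exit_time_pos[OF assms(1)] by simp
  assume "f (exit_time a b f) \<noteq> a"
  then have "f (exit_time a b f) < a" using alive_bounds[OF assms(2) p] by auto
  from alive_extend[OF assms(2) p this] obtain \<epsilon> where "0 < \<epsilon>" "alive a b f (exit_time a b f + \<epsilon>)"
      by blast
  then show False using alive_imp_le_exit_time[OF assms(1), of "exit_time a b f + \<epsilon>"] p by simp
qed

lemma exit_before_le: "exit_before a b N f \<le> real N"
  by (simp add: exit_before_def)

lemma exit_before_pos: "0 < N \<Longrightarrow> 0 < exit_before a b N f"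
  using exit_time_pos by (simp add: exit_before_def)

lemma exit_before_nonneg: "0 \<le> exit_before a b N f"
  using exit_time_pos by (auto simp: exit_before_def less_imp_le)

lemma less_exit_before_imp_alive: "t < exit_before a b N f \<Longrightarrow> alive a b f t"
proof (cases "0 \<le> t")
  case True
  assume t: "t < exit_before a b N f"
  show ?thesis
  proof (rule ccontr)
    assume *: "\<not> ?thesis"
    then have "exits a b f" "exit_time a b f \<le> t"
      using True not_alive_imp_exit_time_le[of t] by (auto simp: exits_def)
    then show False using t by (auto simp: exit_before_def split: if_splits)
  qed
next
  case False then show ?thesis using alive_antimono[OF alive_0, of t] by simp
qed

lemma alive_imp_le_exit_before:
  "0 \<le> t \<Longrightarrow> t \<le> real N \<Longrightarrow> alive a b f t \<Longrightarrow> t \<le> exit_before a b N f"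
  using alive_imp_le_exit_time by (auto simp: exit_before_def)

lemma not_alive_imp_exit_before_le:
  "0 \<le> t \<Longrightarrow> \<not> alive a b f t \<Longrightarrow> exit_before a b N f \<le> t"
  using less_exit_before_imp_alive[of t N] by (meson not_le)

lemma exit_before_value_le: assumes "0 < N" shows "f (exit_before a b N f) \<le> a"
  using alive_before_bounds(3)[OF less_exit_before_imp_alive exit_before_pos[OF assms]] by auto

lemma not_alive_exit_before:
  assumes "\<not> alive a b f (exit_before a b N f)"
  shows "exits a b f" "exit_before a b N f = exit_time a b f" "exit_time a b f \<le> N"
proof -
  show "exits a b f" using assms exit_before_nonneg by (auto simp: exits_def)
  have "exit_time a b f \<le> exit_before a b N f"
    by (rule not_alive_imp_exit_time_le[OF exit_before_nonneg assms])
  then show "exit_time a b f \<le> N" using exit_before_le[of N] by simp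
  then show "exit_before a b N f = exit_time a b f"
    using \<open>exits a b f\<close> by (simp add: exit_before_def)
qed

section \<open>Exit times read off from a grid\<close>

lemma exit_index_le: "exit_index a b N n f \<le> N * Suc n"
  unfolding exit_index_def by (rule Least_le) simp

lemma exit_index_cases:
  "exit_index a b N n f = N * Suc n \<or> \<not> alive a b f (real (exit_index a b N n f) / real (Suc n))"
  unfolding exit_index_def by (rule LeastI[of _ "N * Suc n"]) simp

lemma less_exit_index_imp_alive:
  "k < exit_index a b N n f \<Longrightarrow> alive a b f (real k / real (Suc n))"
  unfolding exit_index_def by (auto dest: not_less_Least)

lemma exit_index_iff:
  assumes "k < N * Suc n"
  shows "k < exit_index a b N n f \<longleftrightarrow> alive a b f (real k / real (Suc n))"
proof
  assume k: "alive a b f (real k / real (Suc n))"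
  show "k < exit_index a b N n f"
  proof (rule ccontr)
    assume *: "\<not> ?thesis"
    then have "alive a b f (real (exit_index a b N n f) / real (Suc n))"
      by (intro alive_antimono[OF k] divide_right_mono) auto
    then show False using exit_index_cases[of N n] * assms by auto
  qed
qed (rule less_exit_index_imp_alive)

lemma exit_index_pos: "0 < N \<Longrightarrow> 0 < exit_index a b N n f"
  using exit_index_iff[of 0 N n] alive_0 by simp

lemma exit_index_lower: "exit_before a b N f \<le> real (exit_index a b N n f) / real (Suc n)"
proof (cases "exit_index a b N n f = N * Suc n")
  case True
  then have "real (exit_index a b N n f) / real (Suc n) = real N"
    by (metis nonzero_mult_div_cancel_right of_nat_0_eq_iff of_nat_mult old.nat.distinct(2))
  then show ?thesis using exit_before_le by simp
next
  case False
  then show ?thesis using exit_index_cases[of N n] by (intro not_alive_imp_exit_before_le) auto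
qed

lemma exit_index_upper:
  assumes "0 < N"
  shows "real (exit_index a b N n f - 1) / real (Suc n) \<le> exit_before a b N f"
proof (rule alive_imp_le_exit_before)
  have "real (exit_index a b N n f - 1) \<le> real (N * Suc n)" using exit_index_le[of N n] by linarith
  then show "real (exit_index a b N n f - 1) / real (Suc n) \<le> real N"
    by (simp add: field_simps)
  show "alive a b f (real (exit_index a b N n f - 1) / real (Suc n))"
    using exit_index_pos[OF assms, of n] by (intro less_exit_index_imp_alive[of _ N]) simp
qed simp

text \<open>The last alive grid point differs from an exit time at which the path is dead, so it
  approaches that time strictly from the left. This produces left limits at a jump, whereas
  \<open>exit_index\<close> itself approaches from the right.\<close>

lemma exit_index_upper_strict:
  assumes "0 < N" "\<not> alive a b f (exit_before a b N f)"
  shows "real (exit_index a b N n f - 1) / real (Suc n) < exit_before a b N f"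
proof -
  have "alive a b f (real (exit_index a b N n f - 1) / real (Suc n))"
    using exit_index_pos[OF assms(1), of n] by (intro less_exit_index_imp_alive[of _ N]) simp
  with assms(2) exit_index_upper[OF assms(1), of n] show ?thesis by (metis order_le_less)
qed

lemma exit_index_tendsto:
  assumes "0 < N"
  shows "(\<lambda>n. real (exit_index a b N n f) / real (Suc n)) \<longlonglongrightarrow> exit_before a b N f"
    and "(\<lambda>n. real (exit_index a b N n f - 1) / real (Suc n)) \<longlonglongrightarrow> exit_before a b N f"
proof -
  have eq: "real (exit_index a b N n f) / real (Suc n) = real (exit_index a b N n f - 1) / real
      (Suc n) + 1 / real (Suc n)" for n
    using exit_index_pos[OF assms, of n] by (simp add: of_nat_diff add_divide_distrib[symmetric] Suc_leI)
  have l: "(\<lambda>n. 1 / real (Suc n)) \<longlonglongrightarrow> 0" by (intro LIMSEQ_Suc[OF lim_const_over_n[of 1]])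
  have "(\<lambda>n. exit_before a b N f + 1 / real (Suc n)) \<longlonglongrightarrow> exit_before a b N f + 0"
    by (intro tendsto_intros l)
  then have u: "(\<lambda>n. exit_before a b N f + 1 / real (Suc n)) \<longlonglongrightarrow> exit_before a b N f" by simp
  show *: "(\<lambda>n. real (exit_index a b N n f) / real (Suc n)) \<longlonglongrightarrow> exit_before a b N f"
  proof (rule tendsto_sandwich[OF _ _ tendsto_const u])
    show "eventually (\<lambda>n. exit_before a b N f \<le> real (exit_index a b N n f) / real (Suc n)) sequentially"
      by (intro always_eventually allI exit_index_lower)
    show "eventually (\<lambda>n. real (exit_index a b N n f) / real (Suc n) \<le> exit_before a b N f + 1 /
        real (Suc n)) sequentially"
      unfolding eq by (intro always_eventually allI add_right_mono exit_index_upper assms)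
  qed
  from tendsto_diff[OF * l]
  show "(\<lambda>n. real (exit_index a b N n f - 1) / real (Suc n)) \<longlonglongrightarrow> exit_before a b N f"
    by (simp only: eq add_diff_cancel_right' diff_zero)
qed

lemma exit_index_value_tendsto:
  assumes "0 < N"
  shows "(\<lambda>n. f (real (exit_index a b N n f) / real (Suc n))) \<longlonglongrightarrow> f (exit_before a b N f)"
  by (intro cadlag_right_sequence[OF cadlag exit_before_nonneg exit_index_lower
      exit_index_tendsto(1)] assms)

lemma exit_index_value_tendsto_left:
  assumes "0 < N" "\<not> alive a b f (exit_before a b N f)"
  shows "(\<lambda>n. f (real (exit_index a b N n f - 1) / real (Suc n))) \<longlonglongrightarrow> left_limit f (exit_before a b N f)"
  by (intro cadlag_left_sequence[OF cadlag exit_before_pos exit_index_upper_strict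
      exit_index_tendsto(2)] assms)

lemma exit_before_eq_exit_time:
  "exits a b f \<Longrightarrow> exit_time a b f \<le> real N \<Longrightarrow> exit_before a b N f = exit_time a b f"
  by (simp add: exit_before_def)

lemma exit_before_eventually:
  assumes "exits a b f"
  shows "eventually (\<lambda>N. exit_before a b N f = exit_time a b f) sequentially"
proof -
  obtain N0 where "exit_time a b f \<le> real N0" using real_arch_simple by blast
  then show ?thesis
    using assms unfolding eventually_sequentially
    by (intro exI[of _ N0]) (force intro!: exit_before_eq_exit_time)
qed

end

section \<open>Sums over the alive grid points\<close>

context spectrally_negative_path
begin

text \<open>Being alive is inherited by earlier times, so the alive indices form an initial segment
  that stops just before \<open>exit_index\<close>.\<close>

lemma sum_alive_telescope:
  fixes u :: "nat \<Rightarrow> real"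
  shows "(\<Sum>k<N * Suc n. if alive a b f (real k / real (Suc n)) then u (Suc k) - u k else 0)
    = u (exit_index a b N n f) - u 0"
proof -
  have "(\<Sum>k<N * Suc n. if alive a b f (real k / real (Suc n)) then u (Suc k) - u k else 0)
      = (\<Sum>k<exit_index a b N n f. u (Suc k) - u k)"
  proof (rule sum.mono_neutral_cong_right)
    show "{..<exit_index a b N n f} \<subseteq> {..<N * Suc n}" using exit_index_le[of N n] by auto
    show "\<forall>i\<in>{..<N * Suc n} - {..<exit_index a b N n f}.
      (if alive a b f (real i / real (Suc n)) then u (Suc i) - u i else 0) = 0"
      using exit_index_iff[of _ N n] by (metis DiffE lessThan_iff)
  qed (use less_exit_index_imp_alive[of _ N n] in \<open>auto simp del: of_nat_Suc mult_Suc_right\<close>)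
  then show ?thesis by (simp add: sum_lessThan_telescope)
qed

text \<open>A nonzero term needs a left end point below \<open>v\<close> and an increment below
  \<open>- v\<close>, so its cell ends below zero. A cell whose right end is still alive ends above
  \<open>b\<close>, which is nonnegative. What remains is the cell from the last alive grid point to
  \<open>exit_index\<close>.\<close>

lemma sum_alive_jump:
  fixes g h :: "real \<Rightarrow> real"
  assumes b: "0 \<le> b" and N: "0 < N"
    and g: "\<And>y. v \<le> y \<Longrightarrow> g y = 0" and h: "\<And>y. - v \<le> y \<Longrightarrow> h y = 0"
  shows "(\<Sum>k<N * Suc n. if alive a b f (real k / real (Suc n))
      then exp (- q * (real k / real (Suc n))) * g (f (real k / real (Suc n))) *
        h (f (real (Suc k) / real (Suc n)) - f (real k / real (Suc n))) else 0)
    = exp (- q * (real (exit_index a b N n f - 1) / real (Suc n)))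
      * g (f (real (exit_index a b N n f - 1) / real (Suc n)))
      * h (f (real (exit_index a b N n f) / real (Suc n)) - f (real (exit_index a b N n f - 1) /
          real (Suc n)))"
    (is "(\<Sum>k<?K. if ?A k then ?t k else 0) = ?r")
proof -
  let ?m = "exit_index a b N n f"
  have m: "0 < ?m" "?m \<le> ?K" by (intro exit_index_pos N) (rule exit_index_le)
  have zero: "(if ?A k then ?t k else 0) = 0" if k: "k \<in> {..<?K} - {?m - 1}" for k
  proof (cases "k < ?m")
    case True
    then have "Suc k < ?m" using k m by auto
    then have "b < f (real (Suc k) / real (Suc n))"
      using less_exit_index_imp_alive[of "Suc k" N n] alive_bounds by (metis divide_nonneg_nonneg
          of_nat_0_le_iff)
    then have "v \<le> f (real k / real (Suc n)) \<or> - v \<le> f (real (Suc k) / real (Suc n)) - f (real k /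
        real (Suc n))"
      using b by linarith
    then show ?thesis using g h by auto
  next
    case False
    then show ?thesis using exit_index_iff[of k N n] k by auto
  qed
  have "(\<Sum>k<?K. if ?A k then ?t k else 0) = (if ?A (?m - 1) then ?t (?m - 1) else 0)"
    using m zero by (subst sum.mono_neutral_right[of _ "{?m - 1}"]) auto
  also have "?A (?m - 1)" using m by (intro less_exit_index_imp_alive[of _ N]) simp
  then have "(if ?A (?m - 1) then ?t (?m - 1) else 0) = ?r" using m by simp
  finally show ?thesis .
qed

lemma sum_alive_jump_tendsto:
  fixes g h :: "real \<Rightarrow> real"
  assumes b: "0 \<le> b" and N: "0 < N"
    and g: "\<And>y. v \<le> y \<Longrightarrow> g y = 0" and h: "\<And>y. - v \<le> y \<Longrightarrow> h y = 0"
    and cont: "continuous_on UNIV g" "continuous_on UNIV h"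
  shows "(\<lambda>n. \<Sum>k<N * Suc n. if alive a b f (real k / real (Suc n))
      then exp (- q * (real k / real (Suc n))) * g (f (real k / real (Suc n))) *
        h (f (real (Suc k) / real (Suc n)) - f (real k / real (Suc n))) else 0)
    \<longlonglongrightarrow> (if alive a b f (exit_before a b N f) then 0
      else exp (- q * exit_before a b N f) * g (left_limit f (exit_before a b N f))
        * h (f (exit_before a b N f) - left_limit f (exit_before a b N f)))"
proof -
  have "(\<lambda>n. exp (- q * (real (exit_index a b N n f - 1) / real (Suc n)))
      * g (f (real (exit_index a b N n f - 1) / real (Suc n)))
      * h (f (real (exit_index a b N n f) / real (Suc n)) - f (real (exit_index a b N n f - 1) /
          real (Suc n))))
    \<longlonglongrightarrow> (if alive a b f (exit_before a b N f) then 0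
      else exp (- q * exit_before a b N f) * g (left_limit f (exit_before a b N f))
        * h (f (exit_before a b N f) - left_limit f (exit_before a b N f)))"
  proof (cases "alive a b f (exit_before a b N f)")
    case False
    have "isCont g y" "isCont h y" for y
      using cont by (auto simp: continuous_on_eq_continuous_at)
    note * = isCont_tendsto_compose[OF this(1)] isCont_tendsto_compose[OF this(2)]
    show ?thesis
      unfolding if_not_P[OF False]
      by (intro tendsto_intros * exit_index_tendsto exit_index_value_tendsto
        exit_index_value_tendsto_left N False)
  next
    \<comment> \<open>This case contains both leaving at \<open>a\<close> and surviving up to the
      horizon \<open>N\<close>. The value at the stopping time is positive, so the last cell
      eventually ends above zero and contributes nothing.\<close>
    case True
    then have "0 < f (exit_before a b N f)" using alive_bounds[OF True exit_before_nonneg] b by simp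
    with exit_index_value_tendsto[OF N]
    have "eventually (\<lambda>n. 0 < f (real (exit_index a b N n f) / real (Suc n))) sequentially"
      by (rule order_tendstoD)
    then have "eventually (\<lambda>n. exp (- q * (real (exit_index a b N n f - 1) / real (Suc n)))
        * g (f (real (exit_index a b N n f - 1) / real (Suc n)))
        * h (f (real (exit_index a b N n f) / real (Suc n)) - f (real (exit_index a b N n f - 1) /
            real (Suc n))) = 0) sequentially"
    proof eventually_elim
      case (elim n)
      then have "v \<le> f (real (exit_index a b N n f - 1) / real (Suc n)) \<or>
        - v \<le> f (real (exit_index a b N n f) / real (Suc n)) - f (real (exit_index a b N n f - 1) /
            real (Suc n))"
        by linarith
      then show ?case using g h by auto
    qed
    then show ?thesis
      using True by (simp add: tendsto_eventually)
  qed
  moreover note sum_alive_jump[OF b N, where v = v and g = g and h = h and q = q, OF g h]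
  ultimately show ?thesis by presburger
qed

lemma riemann_sum_alive_tendsto:
  fixes h :: "real \<Rightarrow> real"
  assumes q: "0 \<le> q" and cont: "continuous_on UNIV h" and C: "\<And>y. b \<le> y \<Longrightarrow> y \<le> a \<Longrightarrow> \<bar>h y\<bar> \<le> C"
  shows "(\<lambda>n. (\<Sum>k<N * Suc n. if alive a b f (real k / real (Suc n))
      then exp (- q * (real k / real (Suc n))) * h (f (real k / real (Suc n))) else 0) / real (Suc n))
    \<longlonglongrightarrow> (LINT s:{0<..<exit_before a b N f}|lborel. exp (- q * s) * h (f s))"
proof -
  define v where "v n k = (if alive a b f (real k / real (Suc n))
      then exp (- q * (real k / real (Suc n))) * h (f (real k / real (Suc n))) else 0)" for n k
  have C0: "0 \<le> C" using C[of "f 0"] start_gt start_less by linarith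
  have v: "\<bar>v n k\<bar> \<le> C" for n k
  proof (cases "alive a b f (real k / real (Suc n))")
    case True
    have "\<bar>h (f (real k / real (Suc n)))\<bar> \<le> C"
      using alive_bounds[OF True] by (intro C) auto
    moreover have "exp (- q * (real k / real (Suc n))) \<le> 1" using q by simp
    ultimately have "exp (- q * (real k / real (Suc n))) * \<bar>h (f (real k / real (Suc n)))\<bar> \<le> 1 * C"
      by (intro mult_mono) auto
    then show ?thesis using True by (simp add: v_def abs_mult)
  qed (simp add: v_def C0)
  \<comment> \<open>On each cell the value at the right end point is taken, so that right-continuity
    of the path gives pointwise convergence. The price is a sum over \<open>Suc k\<close> instead of
    \<open>k\<close>; the two sums differ by boundary terms of order \<open>1 / Suc n\<close>, added
    back at the end.\<close>
  define G where "G n s = (\<Sum>k<N * Suc n. indicator {real k / real (Suc n)<..real (Suc k) / real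
      (Suc n)} s * v n (Suc k))" for n s
  have G_eq: "G n s = (if 0 < s \<and> s \<le> real N then v n (nat \<lceil>s * real (Suc n)\<rceil>) else 0)" for n s
  proof -
    have iff: "s \<in> {real k / real (Suc n)<..real (Suc k) / real (Suc n)} \<longleftrightarrow> \<lceil>s * real (Suc n)\<rceil> = int
        (Suc k)" for k
    proof -
      have "s \<in> {real k / real (Suc n)<..real (Suc k) / real (Suc n)} \<longleftrightarrow> real k < s * real (Suc n) \<and>
          s * real (Suc n) \<le> real (Suc k)"
        by (simp del: of_nat_Suc add: pos_divide_less_eq pos_le_divide_eq)
      also have "\<dots> \<longleftrightarrow> \<lceil>s * real (Suc n)\<rceil> = int (Suc k)"
        by (simp add: ceiling_eq_iff)
      finally show ?thesis .
    qed
    show ?thesis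
    proof (cases "0 < s \<and> s \<le> real N")
      case True
      define j where "j = nat \<lceil>s * real (Suc n)\<rceil> - 1"
      have "0 < s * real (Suc n)" using True by simp
      then have c: "0 < \<lceil>s * real (Suc n)\<rceil>" by simp
      have "s * real (Suc n) \<le> real (N * Suc n)" using True by (simp add: mult_right_mono del:
          of_nat_Suc mult_Suc_right)
      then have c': "\<lceil>s * real (Suc n)\<rceil> \<le> int (N * Suc n)" by (simp add: ceiling_le_iff)
      have j: "j < N * Suc n" "\<lceil>s * real (Suc n)\<rceil> = int (Suc j)" "nat \<lceil>s * real (Suc n)\<rceil> = Suc j"
        using c c' unfolding j_def by linarith+
      have "G n s = (\<Sum>k<N * Suc n. if k = j then v n (Suc k) else 0)"
        unfolding G_def indicator_def iff j(2) by (intro sum.cong refl) simp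
      also have "\<dots> = v n (Suc j)" using j by simp
      finally show ?thesis using True j by simp
    next
      case False
      have "indicator {real k / real (Suc n)<..real (Suc k) / real (Suc n)} s * v n (Suc k) = 0" if
          "k < N * Suc n" for k
      proof -
        have "real (Suc k) \<le> real (N * Suc n)" using that by linarith
        then have "real (Suc k) / real (Suc n) \<le> real N" by (simp add: field_simps)
        moreover have "0 \<le> real k / real (Suc n)" by simp
        ultimately have "s \<notin> {real k / real (Suc n)<..real (Suc k) / real (Suc n)}"
          using False unfolding greaterThanAtMost_iff by linarith
        then show ?thesis by simp
      qed
      then have "G n s = 0" unfolding G_def by (intro sum.neutral) auto
      then show ?thesis using False by auto
    qed
  qed
  have Gb: "norm (G n s) \<le> C * indicator {0..real N} s" for n s
    using v[of n] C0 by (auto simp: G_eq indicator_def)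
  have iC: "integrable lborel (\<lambda>s. C * indicator {0..real N} s)"
    by (intro integrable_mult_right integrable_real_indicator) auto
  have [measurable]: "h \<in> borel_measurable borel" using cont by (rule borel_measurable_continuous_onI)
  note cadlag_measurable[OF cadlag, measurable]
  let ?L = "\<lambda>s. indicator {0<..<exit_before a b N f} s * (exp (- q * s) * h (f (max 0 s)))"
  have "(\<lambda>n. \<integral>s. G n s \<partial>lborel) \<longlonglongrightarrow> (\<integral>s. ?L s \<partial>lborel)"
  proof (rule integral_dominated_convergence[where w="\<lambda>s. C * indicator {0..real N} s"])
    show "?L \<in> borel_measurable lborel" by measurable
    show "G n \<in> borel_measurable lborel" for n unfolding G_def by measurable
    show "AE s in lborel. (\<lambda>n. G n s) \<longlonglongrightarrow> ?L s"
      using AE_lborel_singleton[of "exit_before a b N f"] AE_lborel_singleton[of 0]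
    proof eventually_elim
      case (elim s)
      consider "s < 0" | "0 < s" "s < exit_before a b N f" | "exit_before a b N f < s" "s \<le> real N"
          | "real N < s"
        using elim by linarith
      then show ?case
      proof cases
        case 1 then show ?thesis by (simp add: G_eq)
      next
        case 4 then show ?thesis using exit_before_le[of N] by (simp add: G_eq)
      next
        case 3
        then have s0: "0 \<le> s" using exit_before_nonneg[of N] by simp
        have "v n (nat \<lceil>s * real (Suc n)\<rceil>) = 0" for n
        proof -
          have "\<not> alive a b f (real (nat \<lceil>s * real (Suc n)\<rceil>) / real (Suc n))"
          proof
            assume "alive a b f (real (nat \<lceil>s * real (Suc n)\<rceil>) / real (Suc n))"
            then have "alive a b f s" using ceiling_grid(1)[OF s0, of n] by (rule alive_antimono)
            then show False using alive_imp_le_exit_before[OF s0] 3 by fastforce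
          qed
          then show ?thesis by (simp add: v_def)
        qed
        then have "G n s = 0" for n by (simp add: G_eq del: of_nat_Suc)
        then show ?thesis using 3 by simp
      next
        case 2
        then have s0: "0 \<le> s" by simp
        note lim = ceiling_grid_tendsto[OF s0]
        have "eventually (\<lambda>n. real (nat \<lceil>s * real (Suc n)\<rceil>) / real (Suc n) < exit_before a b N f)
            sequentially"
          using lim 2(2) by (rule order_tendstoD)
        then have ev: "eventually (\<lambda>n. exp (- q * (real (nat \<lceil>s * real (Suc n)\<rceil>) / real (Suc n))) *
            h (f (real (nat \<lceil>s * real (Suc n)\<rceil>) / real (Suc n))) = G n s) sequentially"
        proof eventually_elim
          case (elim n)
          have "s \<le> real N" using 2 exit_before_le[of N] by linarith
          then show ?case using less_exit_before_imp_alive[OF elim] 2 by (simp add: G_eq v_def)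
        qed
        have "isCont h y" for y using cont by (auto simp: continuous_on_eq_continuous_at)
        then have "(\<lambda>n. exp (- q * (real (nat \<lceil>s * real (Suc n)\<rceil>) / real (Suc n))) *
            h (f (real (nat \<lceil>s * real (Suc n)\<rceil>) / real (Suc n)))) \<longlonglongrightarrow> exp (- q * s) * h (f s)"
          by (intro tendsto_intros lim isCont_tendsto_compose[of _ h] cadlag_right_sequence[OF
              cadlag s0 ceiling_grid(1)[OF s0] lim])
        then have "(\<lambda>n. G n s) \<longlonglongrightarrow> exp (- q * s) * h (f s)"
          by (rule Lim_transform_eventually) (rule ev)
        then show ?thesis using 2 by simp
      qed
    qed
  qed (use iC Gb in auto)
  moreover have "(\<integral>s. ?L s \<partial>lborel) = (LINT s:{0<..<exit_before a b N f}|lborel. exp (- q * s) * h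
      (f s))"
    unfolding set_lebesgue_integral_def by (intro Bochner_Integration.integral_cong) (auto simp:
        indicator_def)
  moreover have "(\<integral>s. G n s \<partial>lborel) = (\<Sum>k<N * Suc n. v n (Suc k)) / real (Suc n)" for n
  proof -
    have "(\<integral>s. G n s \<partial>lborel) = (\<Sum>k<N * Suc n. \<integral>s. indicator {real k / real (Suc n)<..real (Suc k)
        / real (Suc n)} s * v n (Suc k) \<partial>lborel)"
      unfolding G_def
    proof (intro Bochner_Integration.integral_sum integrable_mult_left integrable_real_indicator)
      fix k
      have "real k / real (Suc n) \<le> real (Suc k) / real (Suc n)" by (intro divide_right_mono) auto
      then show "emeasure lborel {real k / real (Suc n)<..real (Suc k) / real (Suc n)} < \<infinity>"
        by (simp only: emeasure_lborel_Ioc ennreal_less_top infinity_ennreal_def)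
    qed simp
    also have "\<dots> = (\<Sum>k<N * Suc n. v n (Suc k) / real (Suc n))"
    proof (intro sum.cong refl)
      fix k
      have "real k / real (Suc n) \<le> real (Suc k) / real (Suc n)" by (intro divide_right_mono) auto
      moreover have "real (Suc k) / real (Suc n) - real k / real (Suc n) = 1 / real (Suc n)"
        by (simp add: field_simps)
      ultimately show "(\<integral>s. indicator {real k / real (Suc n)<..real (Suc k) / real (Suc n)} s * v n
          (Suc k) \<partial>lborel) = v n (Suc k) / real (Suc n)"
        by (simp del: of_nat_Suc)
    qed
    finally show ?thesis by (simp add: sum_divide_distrib)
  qed
  ultimately have lim: "(\<lambda>n. (\<Sum>k<N * Suc n. v n (Suc k)) / real (Suc n))
    \<longlonglongrightarrow> (LINT s:{0<..<exit_before a b N f}|lborel. exp (- q * s) * h (f s))" by simp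
  have "(\<lambda>n. (v n 0 - v n (N * Suc n)) / real (Suc n)) \<longlonglongrightarrow> 0"
  proof (rule Lim_null_comparison)
    show "eventually (\<lambda>n. norm ((v n 0 - v n (N * Suc n)) / real (Suc n)) \<le> 2 * C / real (Suc n))
        sequentially"
    proof (intro always_eventually allI)
      fix n
      have "\<bar>v n 0 - v n (N * Suc n)\<bar> \<le> 2 * C" using v[of n 0] v[of n "N * Suc n"] by linarith
      then show "norm ((v n 0 - v n (N * Suc n)) / real (Suc n)) \<le> 2 * C / real (Suc n)"
        by (simp del: of_nat_Suc add: abs_divide divide_right_mono)
    qed
    show "(\<lambda>n. 2 * C / real (Suc n)) \<longlonglongrightarrow> 0" by (rule LIMSEQ_Suc[OF lim_const_over_n])
  qed
  from tendsto_add[OF lim this]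
  have "(\<lambda>n. (\<Sum>k<N * Suc n. v n (Suc k)) / real (Suc n) + (v n 0 - v n (N * Suc n)) / real (Suc n))
    \<longlonglongrightarrow> (LINT s:{0<..<exit_before a b N f}|lborel. exp (- q * s) * h (f s))" by simp
  moreover have "(\<Sum>k<N * Suc n. v n (Suc k)) / real (Suc n) + (v n 0 - v n (N * Suc n)) / real (Suc n)
    = (\<Sum>k<N * Suc n. v n k) / real (Suc n)" for n
  proof -
    have "(\<Sum>k<K. v n (Suc k)) + (v n 0 - v n K) = (\<Sum>k<K. v n k)" for K by (induction K) auto
    then show ?thesis by (metis add_divide_distrib)
  qed
  ultimately show ?thesis by (simp add: v_def)
qed

end

section \<open>The killed process\<close>

text \<open>A bound in L2 controls the part cut off at level \<open>L\<close>:
  \<open>U - min U L\<close> is at most \<open>U\<^sup>2 / L\<close> and so has mean at most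
  \<open>B / L\<close>. The truncated means converge by dominated convergence, and a level above
  \<open>C\<close> leaves the limit \<open>V\<close> untouched.\<close>

lemma (in prob_space) expectation_tendsto_if_L2_bounded:
  fixes U :: "nat \<Rightarrow> 'a \<Rightarrow> real"
  assumes U: "\<And>n. U n \<in> borel_measurable M" and nonneg: "\<And>n \<omega>. \<omega> \<in> space M \<Longrightarrow> 0 \<le> U n \<omega>"
    and sq: "\<And>n. integrable M (\<lambda>\<omega>. (U n \<omega>)\<^sup>2)" and B: "\<And>n. expectation (\<lambda>\<omega>. (U n \<omega>)\<^sup>2) \<le> B"
    and lim: "\<And>\<omega>. \<omega> \<in> space M \<Longrightarrow> (\<lambda>n. U n \<omega>) \<longlonglongrightarrow> V \<omega>"
    and C: "\<And>\<omega>. \<omega> \<in> space M \<Longrightarrow> V \<omega> \<le> C"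
  shows "(\<lambda>n. expectation (U n)) \<longlonglongrightarrow> expectation V"
proof (rule LIMSEQ_I)
  note U[measurable]
  have V[measurable]: "V \<in> borel_measurable M" by (rule borel_measurable_LIMSEQ_real[OF lim U])
  have iU: "integrable M (U n)" for n
    by (rule square_integrable_imp_integrable) (use sq in auto)
  fix r :: real assume r: "0 < r"
  have B0: "0 \<le> B" using B[of 0] by (rule order_trans[rotated]) simp
  define L where "L = \<bar>C\<bar> + 4 * B / r + 1"
  have "0 \<le> 4 * B / r" using r B0 by simp
  then have L: "0 < L" "C \<le> L" unfolding L_def by linarith+
  have "4 * B / r < L" unfolding L_def by simp
  then have BL: "B / L < r / 2" using r L B0 by (simp add: field_simps)
  have imin: "integrable M (\<lambda>\<omega>. min (U n \<omega>) L)" for n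
    by (rule Bochner_Integration.integrable_bound[OF iU[of n]]) (use nonneg L in auto)
  have "(\<lambda>n. expectation (\<lambda>\<omega>. min (U n \<omega>) L)) \<longlonglongrightarrow> expectation V"
  proof (rule integral_dominated_convergence[where w="\<lambda>_. L"])
    show "AE \<omega> in M. (\<lambda>n. min (U n \<omega>) L) \<longlonglongrightarrow> V \<omega>"
    proof (rule AE_I2)
      fix \<omega> assume \<omega>: "\<omega> \<in> space M"
      have "(\<lambda>n. min (U n \<omega>) L) \<longlonglongrightarrow> min (V \<omega>) L" by (intro tendsto_intros lim \<omega>)
      then show "(\<lambda>n. min (U n \<omega>) L) \<longlonglongrightarrow> V \<omega>" using C[OF \<omega>] L by (simp add: min_absorb1)
    qed
  qed (use nonneg L in auto)
  then have ev: "eventually (\<lambda>n. \<bar>expectation (\<lambda>\<omega>. min (U n \<omega>) L) - expectation V\<bar> < r / 2) sequentially"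
    using tendstoD[of _ _ _ "r / 2"] r by (fastforce simp: dist_real_def)
  have d: "\<bar>expectation (U n) - expectation (\<lambda>\<omega>. min (U n \<omega>) L)\<bar> \<le> B / L" for n
  proof -
    have "expectation (U n) - expectation (\<lambda>\<omega>. min (U n \<omega>) L) = expectation (\<lambda>\<omega>. U n \<omega> - min (U n \<omega>) L)"
      by (intro Bochner_Integration.integral_diff[symmetric] iU imin)
    moreover have "0 \<le> expectation (\<lambda>\<omega>. U n \<omega> - min (U n \<omega>) L)" by (intro integral_nonneg_AE) auto
    moreover have "expectation (\<lambda>\<omega>. U n \<omega> - min (U n \<omega>) L) \<le> expectation (\<lambda>\<omega>. (U n \<omega>)\<^sup>2 / L)"
    proof (intro integral_mono_AE AE_I2)
      fix \<omega> assume \<omega>: "\<omega> \<in> space M"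
      show "U n \<omega> - min (U n \<omega>) L \<le> (U n \<omega>)\<^sup>2 / L"
      proof (cases "U n \<omega> \<le> L")
        case False
        then have "L * U n \<omega> \<le> (U n \<omega>)\<^sup>2" using L by (simp add: power2_eq_square)
        then have "U n \<omega> \<le> (U n \<omega>)\<^sup>2 / L" using L by (simp add: field_simps)
        then show ?thesis using L False by simp
      qed (use L in simp)
    qed (use iU imin sq in auto)
    moreover have "expectation (\<lambda>\<omega>. (U n \<omega>)\<^sup>2 / L) \<le> B / L" using B[of n] L by (simp add:
        divide_right_mono)
    ultimately show ?thesis by linarith
  qed
  from ev have "eventually (\<lambda>n. norm (expectation (U n) - expectation V) < r) sequentially"
  proof eventually_elim
    case (elim n) then show ?case using d[of n] BL unfolding real_norm_def by linarith
  qed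
  then show "\<exists>no. \<forall>n\<ge>no. norm (expectation (U n) - expectation V) < r"
    by (simp add: eventually_sequentially)
qed

lemma cadlag_rational_sequence:
  assumes f: "cadlag f" and s: "0 \<le> s" "s < t"
  obtains S where "\<And>n. S n \<in> \<rat>" "\<And>n. s < S n" "\<And>n. S n < t" "(\<lambda>n. f (S n)) \<longlonglongrightarrow> f s"
proof -
  have "\<exists>r\<in>\<rat>. s < r \<and> r < min t (s + 1 / real (Suc n))" for n
    using s by (intro Rats_dense_in_real) auto
  then obtain S where S: "\<And>n. S n \<in> \<rat>" "\<And>n. s < S n" "\<And>n. S n < t" "\<And>n. S n < s + 1 / real (Suc n)"
    by (metis min_less_iff_conj)
  have "(\<lambda>n. s + 1 / real (Suc n)) \<longlonglongrightarrow> s + 0"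
    by (intro tendsto_intros LIMSEQ_Suc[OF lim_const_over_n[of 1]])
  then have u: "(\<lambda>n. s + 1 / real (Suc n)) \<longlonglongrightarrow> s" by simp
  have "S \<longlonglongrightarrow> s"
    by (rule tendsto_sandwich[OF _ _ tendsto_const u])
      (use S in \<open>auto intro!: always_eventually less_imp_le simp del: of_nat_Suc\<close>)
  then have "(\<lambda>n. f (S n)) \<longlonglongrightarrow> f s"
    using s S(2) by (intro cadlag_right_sequence[OF f]) (auto simp: less_imp_le)
  with S show ?thesis using that by blast
qed

text \<open>By right-continuity rational times suffice, except at \<open>t\<close>: it can be
  approached from the right only from outside the interval and is therefore added. Together with
  margins of the form \<open>1 / Suc j\<close> this makes \<open>alive\<close> an adapted
  event.\<close>

lemma alive_countable_iff:
  assumes f: "cadlag f" and t: "0 \<le> t"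
  defines "D \<equiv> insert t ({0..t} \<inter> \<rat>)"
  shows "alive a b f t \<longleftrightarrow> (\<forall>s\<in>D. f s \<le> a) \<and> (\<exists>j. \<forall>s\<in>D. b + 1 / real (Suc j) \<le> f s)"
proof -
  have dense: "\<exists>S. (\<forall>n. S n \<in> D) \<and> (\<lambda>n. f (S n)) \<longlonglongrightarrow> f s" if s: "s \<in> {0..t}" for s
  proof (cases "s = t")
    case True then show ?thesis by (intro exI[of _ "\<lambda>_. t"]) (simp add: D_def)
  next
    case False
    then have "0 \<le> s" "s < t" using s by auto
    then obtain S where S: "\<And>n. S n \<in> \<rat>" "\<And>n. s < S n" "\<And>n. S n < t" "(\<lambda>n. f (S n)) \<longlonglongrightarrow> f s"
      using cadlag_rational_sequence[OF f] by blast
    have "S n \<in> D" for n using S(1)[of n] S(2)[of n] S(3)[of n] s by (auto simp: D_def)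
    with S(4) show ?thesis by blast
  qed
  have D: "D \<subseteq> {0..t}" using t by (auto simp: D_def)
  have 1: "(\<forall>s\<in>{0..t}. f s \<le> c) \<longleftrightarrow> (\<forall>s\<in>D. f s \<le> c)" for c
  proof
    assume *: "\<forall>s\<in>D. f s \<le> c"
    show "\<forall>s\<in>{0..t}. f s \<le> c"
    proof
      fix s assume "s \<in> {0..t}"
      from dense[OF this] obtain S where "\<And>n. S n \<in> D" "(\<lambda>n. f (S n)) \<longlonglongrightarrow> f s" by auto
      then show "f s \<le> c" using * by (intro LIMSEQ_le_const2[of "\<lambda>n. f (S n)"]) auto
    qed
  qed (use D in auto)
  have 2: "(\<forall>s\<in>{0..t}. c \<le> f s) \<longleftrightarrow> (\<forall>s\<in>D. c \<le> f s)" for c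
  proof
    assume *: "\<forall>s\<in>D. c \<le> f s"
    show "\<forall>s\<in>{0..t}. c \<le> f s"
    proof
      fix s assume "s \<in> {0..t}"
      from dense[OF this] obtain S where "\<And>n. S n \<in> D" "(\<lambda>n. f (S n)) \<longlonglongrightarrow> f s" by auto
      then show "c \<le> f s" using * by (intro LIMSEQ_le_const[of "\<lambda>n. f (S n)"]) auto
    qed
  qed (use D in auto)
  have "(\<exists>c>b. \<forall>s\<in>D. c \<le> f s) \<longleftrightarrow> (\<exists>j. \<forall>s\<in>D. b + 1 / real (Suc j) \<le> f s)"
  proof
    assume "\<exists>c>b. \<forall>s\<in>D. c \<le> f s"
    then obtain c where c: "b < c" "\<And>s. s \<in> D \<Longrightarrow> c \<le> f s" by auto
    then obtain j where "inverse (real (Suc j)) < c - b" using reals_Archimedean[of "c - b"] by auto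
    then have "b + 1 / real (Suc j) \<le> c" by (simp add: inverse_eq_divide del: of_nat_Suc)
    then show "\<exists>j. \<forall>s\<in>D. b + 1 / real (Suc j) \<le> f s" using c(2) order_trans by blast
  next
    assume "\<exists>j. \<forall>s\<in>D. b + 1 / real (Suc j) \<le> f s"
    then obtain j where "\<forall>s\<in>D. b + 1 / real (Suc j) \<le> f s" by auto
    moreover have "b < b + 1 / real (Suc j)" by simp
    ultimately show "\<exists>c>b. \<forall>s\<in>D. c \<le> f s" by blast
  qed
  then show ?thesis unfolding alive_def 1 2 by blast
qed

text \<open>Path properties are required at every point of the space, which keeps the pathwise
  lemmas free of null sets; a version of \<open>x + X\<close> with this property is built near the
  end. The assumption \<open>increments\<close> is independence and stationarity of increments in
  integrated form, with \<open>\<rho> t\<close> the law of an increment over time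
  \<open>t\<close>.\<close>

locale killed_levy = prob_space M
  for M :: "'a measure" and F :: "real \<Rightarrow> 'a measure" and Y :: "real \<Rightarrow> 'a \<Rightarrow> real"
    and a b x q :: real and \<phi> :: "real \<Rightarrow> real" and \<rho> :: "real \<Rightarrow> real measure" +
  assumes subalg: "\<And>t. 0 \<le> t \<Longrightarrow> subalgebra M (F t)"
    and adapted: "\<And>t. 0 \<le> t \<Longrightarrow> Y t \<in> borel_measurable (F t)"
    and cadlag: "\<And>\<omega>. \<omega> \<in> space M \<Longrightarrow> cadlag (\<lambda>t. Y t \<omega>)"
    and no_jumps: "\<And>\<omega>. \<omega> \<in> space M \<Longrightarrow> no_positive_jumps (\<lambda>t. Y t \<omega>)"
    and start: "\<And>\<omega>. \<omega> \<in> space M \<Longrightarrow> Y 0 \<omega> = x"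
    and F_mono: "\<And>s t. 0 \<le> s \<Longrightarrow> s \<le> t \<Longrightarrow> sets (F s) \<subseteq> sets (F t)"
    and b_less: "b < x" and less_a: "x < a" and q_nonneg: "0 \<le> q"
    and sets_\<rho>: "\<And>t. sets (\<rho> t) = sets borel"
    and increments: "\<And>s t (V :: 'a \<Rightarrow> real) (g :: real \<Rightarrow> real). 0 \<le> s \<Longrightarrow> s \<le> t \<Longrightarrow> V \<in> borel_measurable
        (F s) \<Longrightarrow> integrable M V \<Longrightarrow>
        integrable (\<rho> (t - s)) g \<Longrightarrow>
        has_bochner_integral M (\<lambda>\<omega>. V \<omega> * g (Y t \<omega> - Y s \<omega>)) (expectation V * (\<integral>u. g u \<partial>\<rho> (t - s)))"
    and \<phi>_0: "\<phi> 0 = 0"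
    and \<phi>_large: "eventually (\<lambda>\<alpha>. q < \<phi> \<alpha>) at_top"
    and laplace: "\<And>t \<alpha>. 0 \<le> t \<Longrightarrow> 0 \<le> \<alpha> \<Longrightarrow>
        has_bochner_integral (\<rho> t) (\<lambda>u. exp (\<alpha> * u)) (exp (t * \<phi> \<alpha>))"
begin

abbreviation path :: "'a \<Rightarrow> real \<Rightarrow> real" where "path \<omega> \<equiv> \<lambda>t. Y t \<omega>"

section \<open>Measurability of the killed path, and stopping on the grid\<close>

lemma spectrally_negative_path: "\<omega> \<in> space M \<Longrightarrow> spectrally_negative_path (path \<omega>) a b"
  by unfold_locales (use cadlag no_jumps start b_less less_a in auto)

lemma space_F: "0 \<le> t \<Longrightarrow> space (F t) = space M"
  using subalg by (auto simp: subalgebra_def)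

lemma measurable_F_imp: "0 \<le> t \<Longrightarrow> f \<in> measurable (F t) N \<Longrightarrow> f \<in> measurable M N"
  using subalg measurable_from_subalg by blast

lemma measurable_F_mono: "0 \<le> s \<Longrightarrow> s \<le> t \<Longrightarrow> f \<in> measurable (F s) N \<Longrightarrow> f \<in> measurable (F t) N"
  using F_mono[of s t] space_F[of s] space_F[of t] by (auto simp: measurable_def)

lemma Y_measurable: "0 \<le> t \<Longrightarrow> Y t \<in> borel_measurable M"
  using adapted measurable_F_imp by blast

lemma alive_adapted:
  assumes t: "0 \<le> t"
  shows "Measurable.pred (F t) (\<lambda>\<omega>. alive a b (path \<omega>) t)"
proof -
  have [measurable]: "Y s \<in> borel_measurable (F t)" if "s \<in> insert t ({0..t} \<inter> \<rat>)" for s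
    using that t by (intro measurable_F_mono[OF _ _ adapted]) auto
  have c[simp]: "countable (insert t ({0..t} \<inter> \<rat>))"
    by (meson Int_lower2 countable_insert countable_rat countable_subset)
  have "Measurable.pred (F t) (\<lambda>\<omega>. (\<forall>s\<in>insert t ({0..t} \<inter> \<rat>). Y s \<omega> \<le> a) \<and>
      (\<exists>j. \<forall>s\<in>insert t ({0..t} \<inter> \<rat>). b + 1 / real (Suc j) \<le> Y s \<omega>))"
    unfolding pred_def
    by (intro sets.sets_Collect_conj sets.sets_Collect_countable_Ex
        sets.sets_Collect_countable_All' c; measurable)
  then show ?thesis
    by (rule measurable_cong[THEN iffD1, rotated])
       (use cadlag t in \<open>auto simp only: alive_countable_iff[OF cadlag t] space_F\<close>)
qed

lemma alive_measurable [measurable]: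
  "Measurable.pred M (\<lambda>\<omega>. alive a b (path \<omega>) (real k / real (Suc n)))"
  by (rule measurable_F_imp[OF _ alive_adapted]) auto

lemma Y_grid_measurable [measurable]: "(\<lambda>\<omega>. Y (real k / real (Suc n)) \<omega>) \<in> borel_measurable M"
  by (rule Y_measurable) simp

lemma exit_index_measurable [measurable]:
  "(\<lambda>\<omega>. exit_index a b N n (path \<omega>)) \<in> measurable M (count_space UNIV)"
  unfolding exit_index_def by measurable

lemma Y_exit_index_measurable [measurable]:
  "(\<lambda>\<omega>. Y (real (exit_index a b N n (path \<omega>)) / real (Suc n)) \<omega>) \<in> borel_measurable M"
  "(\<lambda>\<omega>. Y (real (exit_index a b N n (path \<omega>) - 1) / real (Suc n)) \<omega>) \<in> borel_measurable M"
  by (rule measurable_compose_countable[where f="\<lambda>k \<omega>. Y (real k / real (Suc n)) \<omega>"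
        and g="\<lambda>\<omega>. exit_index a b N n (path \<omega>)"]; measurable)
     (rule measurable_compose_countable[where f="\<lambda>k \<omega>. Y (real (k - 1) / real (Suc n)) \<omega>"
        and g="\<lambda>\<omega>. exit_index a b N n (path \<omega>)"]; measurable)

lemma exit_before_measurable [measurable]:
  "(\<lambda>\<omega>. exit_before a b N (path \<omega>)) \<in> borel_measurable M"
proof (cases "N = 0")
  case True
  have "exit_before a b N (path \<omega>) = 0" if "\<omega> \<in> space M" for \<omega>
    using True spectrally_negative_path.exit_before_le[OF spectrally_negative_path[OF that], of N]
      spectrally_negative_path.exit_before_nonneg[OF spectrally_negative_path[OF that], of N] by simp
  then show ?thesis by (simp cong: measurable_cong)
next
  case False
  then show ?thesis
    by (intro borel_measurable_LIMSEQ_real[OF spectrally_negative_path.exit_index_tendsto(1)[OF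
        spectrally_negative_path]]) measurable
qed

lemma Y_exit_before_measurable [measurable]:
  "0 < N \<Longrightarrow> (\<lambda>\<omega>. Y (exit_before a b N (path \<omega>)) \<omega>) \<in> borel_measurable M"
  by (rule borel_measurable_LIMSEQ_real[OF spectrally_negative_path.exit_index_value_tendsto[OF
      spectrally_negative_path]])
     measurable

text \<open>Reduces aliveness at a random time, a condition on the whole past, to the single value
  of the path at that time, which is already known to be measurable.\<close>

lemma alive_exit_before_iff:
  assumes "\<omega> \<in> space M"
  shows "alive a b (path \<omega>) (exit_before a b N (path \<omega>)) \<longleftrightarrow> b < Y (exit_before a b N (path \<omega>)) \<omega>"
proof -
  interpret spectrally_negative_path "path \<omega>" a b using assms by (rule spectrally_negative_path)
  show ?thesis
    using alive_bounds[OF _ exit_before_nonneg] not_alive_exit_before exit_value_down by (metis not_le)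
qed

lemma alive_exit_before_measurable [measurable]:
  assumes "0 < N"
  shows "Measurable.pred M (\<lambda>\<omega>. alive a b (path \<omega>) (exit_before a b N (path \<omega>)))"
proof -
  note Y_exit_before_measurable[OF assms, measurable]
  show ?thesis by (simp add: alive_exit_before_iff cong: measurable_cong)
qed

lemma left_limit_exit_before_measurable [measurable]:
  assumes "0 < N"
  shows "(\<lambda>\<omega>. if alive a b (path \<omega>) (exit_before a b N (path \<omega>)) then 0
      else left_limit (path \<omega>) (exit_before a b N (path \<omega>))) \<in> borel_measurable M"
proof (rule borel_measurable_LIMSEQ_real)
  fix \<omega> assume \<omega>: "\<omega> \<in> space M"
  show "(\<lambda>n. if alive a b (path \<omega>) (exit_before a b N (path \<omega>)) then 0
      else Y (real (exit_index a b N n (path \<omega>) - 1) / real (Suc n)) \<omega>) \<longlonglongrightarrow>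
     (if alive a b (path \<omega>) (exit_before a b N (path \<omega>)) then 0
      else left_limit (path \<omega>) (exit_before a b N (path \<omega>)))"
    using spectrally_negative_path.exit_index_value_tendsto_left[OF spectrally_negative_path[OF \<omega>] assms]
    by simp
next
  note alive_exit_before_measurable[OF assms, measurable]
  show "(\<lambda>\<omega>. if alive a b (path \<omega>) (exit_before a b N (path \<omega>)) then 0
      else Y (real (exit_index a b N n (path \<omega>) - 1) / real (Suc n)) \<omega>) \<in> borel_measurable M" for n
    by measurable
qed

lemma exits_measurable [measurable]: "Measurable.pred M (\<lambda>\<omega>. exits a b (path \<omega>))"
proof -
  have "exits a b (path \<omega>) \<longleftrightarrow> (\<exists>k::nat. \<not> alive a b (path \<omega>) (real k / real (Suc 0)))" for \<omega>
  proof
    assume "exits a b (path \<omega>)"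
    then obtain t where "0 \<le> t" "\<not> alive a b (path \<omega>) t" by (auto simp: exits_def)
    moreover obtain k where "t \<le> real k" using real_arch_simple by blast
    ultimately show "\<exists>k::nat. \<not> alive a b (path \<omega>) (real k / real (Suc 0))"
      using alive_antimono[of a b "path \<omega>" "real k" t] by auto
  next
    assume "\<exists>k::nat. \<not> alive a b (path \<omega>) (real k / real (Suc 0))"
    then obtain k :: nat where "\<not> alive a b (path \<omega>) (real k / real (Suc 0))" by blast
    then show "exits a b (path \<omega>)" unfolding exits_def by (intro exI[of _ "real k"]) simp
  qed
  then show ?thesis by (simp only:) measurable
qed

text \<open>Optional stopping on the grid. Over an alive cell the increment of \<open>v\<close> is
  its value at the left end times \<open>g\<close> of an increment independent of the past, and
  \<open>g\<close> has mean \<open>exp ((\<phi> \<alpha> - r) / Suc n) - 1\<close>. The rate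
  \<open>r\<close> is kept apart from \<open>q\<close> because the identity is needed at
  \<open>2 * q\<close> too.\<close>

lemma sum_alive_exponential:
  assumes \<alpha>: "0 \<le> \<alpha>" and r: "0 \<le> r"
  defines "v n \<omega> k \<equiv> exp (- r * (real k / real (Suc n))) * exp (\<alpha> * Y (real k / real (Suc n)) \<omega>)"
  shows "has_bochner_integral M (\<lambda>\<omega>. v n \<omega> (exit_index a b N n (path \<omega>)))
     (exp (\<alpha> * x) + (exp ((\<phi> \<alpha> - r) / real (Suc n)) - 1) *
        expectation (\<lambda>\<omega>. \<Sum>k<N * Suc n. if alive a b (path \<omega>) (real k / real (Suc n)) then v n \<omega> k
            else 0))"
proof -
  let ?A = "\<lambda>\<omega> k. alive a b (path \<omega>) (real k / real (Suc n))"
  define V where "V k \<omega> = (if ?A \<omega> k then v n \<omega> k else 0)" for k \<omega>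
  define c where "c = \<phi> \<alpha> - r"
  define g where "g y = exp (- r / real (Suc n)) * exp (\<alpha> * y) - 1" for y :: real
  have VF: "V k \<in> borel_measurable (F (real k / real (Suc n)))" for k
  proof -
    have [measurable]: "Measurable.pred (F (real k / real (Suc n))) (\<lambda>\<omega>. ?A \<omega> k)"
      "Y (real k / real (Suc n)) \<in> borel_measurable (F (real k / real (Suc n)))"
      by (intro alive_adapted adapted; simp)+
    show ?thesis unfolding V_def v_def by measurable
  qed
  have Vb: "0 \<le> V k \<omega> \<and> V k \<omega> \<le> exp (\<alpha> * a)" for k \<omega>
  proof (cases "?A \<omega> k")
    case True
    then have "\<alpha> * Y (real k / real (Suc n)) \<omega> \<le> \<alpha> * a"
      using alive_bounds[OF True] \<alpha> by (intro mult_left_mono) auto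
    moreover have "exp (- r * (real k / real (Suc n))) \<le> 1" using r by simp
    ultimately have "v n \<omega> k \<le> 1 * exp (\<alpha> * a)" unfolding v_def by (intro mult_mono) auto
    then show ?thesis using True by (simp add: V_def v_def)
  qed (simp add: V_def)
  have iV: "integrable M (V k)" for k
    by (rule integrable_const_bound[where B="exp (\<alpha> * a)"]) (use Vb measurable_F_imp[OF _ VF] in auto)
  have g: "has_bochner_integral (\<rho> (1 / real (Suc n))) g (exp (c / real (Suc n)) - 1)"
  proof -
    have 1: "has_bochner_integral (\<rho> (1 / real (Suc n))) (\<lambda>y. 1 :: real) 1"
      using laplace[of "1 / real (Suc n)" 0] by (simp add: \<phi>_0)
    have "has_bochner_integral (\<rho> (1 / real (Suc n))) g (exp (- r / real (Suc n)) * exp (1 / real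
        (Suc n) * \<phi> \<alpha>) - 1)"
      unfolding g_def by (intro has_bochner_integral_diff has_bochner_integral_mult_right laplace \<alpha>
          1) auto
    then show ?thesis by (simp add: c_def exp_add[symmetric] diff_divide_distrib del: of_nat_Suc)
  qed
  have step: "has_bochner_integral M (\<lambda>\<omega>. if ?A \<omega> k then v n \<omega> (Suc k) - v n \<omega> k else 0)
      (expectation (V k) * (exp (c / real (Suc n)) - 1))" for k
  proof -
    have t: "real k / real (Suc n) \<le> real (Suc k) / real (Suc n)" by (intro divide_right_mono) auto
    have d: "real (Suc k) / real (Suc n) - real k / real (Suc n) = 1 / real (Suc n)"
      by (simp add: diff_divide_distrib[symmetric])
    have "has_bochner_integral M (\<lambda>\<omega>. V k \<omega> * g (Y (real (Suc k) / real (Suc n)) \<omega> - Y (real k /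
        real (Suc n)) \<omega>))
       (expectation (V k) * (exp (c / real (Suc n)) - 1))"
      using increments[OF _ t VF iV, of g] has_bochner_integral_integrable g
      unfolding d has_bochner_integral_iff by simp
    moreover have "V k \<omega> * g (Y (real (Suc k) / real (Suc n)) \<omega> - Y (real k / real (Suc n)) \<omega>)
      = (if ?A \<omega> k then v n \<omega> (Suc k) - v n \<omega> k else 0)" for \<omega>
    proof -
      have "exp (- r * (real (Suc k) / real (Suc n))) = exp (- r * (real k / real (Suc n))) * exp
          (- r / real (Suc n))"
        using d by (simp add: exp_add[symmetric] algebra_simps del: of_nat_Suc)
      then show ?thesis
        by (simp add: V_def v_def g_def exp_diff right_diff_distrib field_simps del: of_nat_Suc)
    qed
    ultimately show ?thesis by simp
  qed
  have "has_bochner_integral M (\<lambda>\<omega>. exp (\<alpha> * x) + (\<Sum>k<N * Suc n. if ?A \<omega> k then v n \<omega> (Suc k) - v n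
      \<omega> k else 0))
      (exp (\<alpha> * x) + (\<Sum>k<N * Suc n. expectation (V k) * (exp (c / real (Suc n)) - 1)))"
    by (intro has_bochner_integral_add has_bochner_integral_sum step)
       (simp add: has_bochner_integral_iff prob_space)
  also have "(\<Sum>k<N * Suc n. expectation (V k) * (exp (c / real (Suc n)) - 1))
     = (exp ((\<phi> \<alpha> - r) / real (Suc n)) - 1) * expectation (\<lambda>\<omega>. \<Sum>k<N * Suc n. V k \<omega>)"
    by (subst Bochner_Integration.integral_sum) (auto simp: iV c_def sum_distrib_left mult.commute
        simp del: of_nat_Suc)
  also have "has_bochner_integral M (\<lambda>\<omega>. exp (\<alpha> * x) + (\<Sum>k<N * Suc n. if ?A \<omega> k then v n \<omega> (Suc k)
      - v n \<omega> k else 0)) y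
     \<longleftrightarrow> has_bochner_integral M (\<lambda>\<omega>. v n \<omega> (exit_index a b N n (path \<omega>))) y" for y
  proof (rule has_bochner_integral_cong)
    fix \<omega> assume \<omega>: "\<omega> \<in> space M"
    show "exp (\<alpha> * x) + (\<Sum>k<N * Suc n. if ?A \<omega> k then v n \<omega> (Suc k) - v n \<omega> k else 0) = v n \<omega>
        (exit_index a b N n (path \<omega>))"
      unfolding spectrally_negative_path.sum_alive_telescope[OF spectrally_negative_path[OF \<omega>]]
      using start[OF \<omega>] by (simp add: v_def)
  qed simp_all
  finally show ?thesis by (simp add: V_def)
qed

end

section \<open>From the grid to continuous time\<close>

context killed_levy
begin

abbreviation stop :: "nat \<Rightarrow> 'a \<Rightarrow> real" where "stop N \<omega> \<equiv> exit_before a b N (path \<omega>)"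

abbreviation grid_sum :: "real \<Rightarrow> nat \<Rightarrow> nat \<Rightarrow> (real \<Rightarrow> real) \<Rightarrow> 'a \<Rightarrow> real" where
  "grid_sum r N n h \<omega> \<equiv> (\<Sum>k<N * Suc n. if alive a b (path \<omega>) (real k / real (Suc n))
      then exp (- r * (real k / real (Suc n))) * h (Y (real k / real (Suc n)) \<omega>) else 0)"

definition occupation_before :: "real \<Rightarrow> nat \<Rightarrow> (real \<Rightarrow> real) \<Rightarrow> real" where
  "occupation_before r N h = expectation (\<lambda>\<omega>. LINT s:{0<..<stop N \<omega>}|lborel. exp (- r * s) * h (Y s \<omega>))"

lemma grid_sum_bound:
  assumes r: "0 \<le> r" and C: "\<And>y. b \<le> y \<Longrightarrow> y \<le> a \<Longrightarrow> \<bar>h y\<bar> \<le> C"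
  shows "\<bar>grid_sum r N n h \<omega>\<bar> \<le> real (N * Suc n) * C"
proof -
  have C0: "0 \<le> C" using C[of x] b_less less_a by linarith
  have "\<bar>if alive a b (path \<omega>) (real k / real (Suc n)) then exp (- r * (real k / real (Suc n))) * h
      (Y (real k / real (Suc n)) \<omega>) else 0\<bar> \<le> C" for k
  proof (cases "alive a b (path \<omega>) (real k / real (Suc n))")
    case True
    have "\<bar>h (Y (real k / real (Suc n)) \<omega>)\<bar> \<le> C" using alive_bounds[OF True] by (intro C) auto
    moreover have "exp (- r * (real k / real (Suc n))) \<le> 1" using r by simp
    ultimately have "exp (- r * (real k / real (Suc n))) * \<bar>h (Y (real k / real (Suc n)) \<omega>)\<bar> \<le> 1 * C"
      by (intro mult_mono) auto
    then show ?thesis using True by (simp add: abs_mult)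
  qed (simp add: C0)
  then have "\<bar>grid_sum r N n h \<omega>\<bar> \<le> (\<Sum>k<N * Suc n. C)"
    by (intro order_trans[OF sum_abs] sum_mono)
  then show ?thesis by simp
qed

lemma grid_sum_measurable [measurable]:
  assumes [measurable]: "h \<in> borel_measurable borel"
  shows "grid_sum r N n h \<in> borel_measurable M"
  by measurable

lemma occupation_before_limit:
  assumes r: "0 \<le> r" and cont: "continuous_on UNIV h"
    and C: "\<And>y. b \<le> y \<Longrightarrow> y \<le> a \<Longrightarrow> \<bar>h y\<bar> \<le> C"
  shows "(\<lambda>n. expectation (grid_sum r N n h) / real (Suc n)) \<longlonglongrightarrow> occupation_before r N h"
    and "(\<lambda>\<omega>. LINT s:{0<..<stop N \<omega>}|lborel. exp (- r * s) * h (Y s \<omega>)) \<in> borel_measurable M"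
    and "\<And>\<omega>. \<omega> \<in> space M \<Longrightarrow> \<bar>LINT s:{0<..<stop N \<omega>}|lborel. exp (- r * s) * h (Y s \<omega>)\<bar> \<le> real N * C"
proof -
  have [measurable]: "h \<in> borel_measurable borel" using cont by (rule borel_measurable_continuous_onI)
  have lim: "(\<lambda>n. grid_sum r N n h \<omega> / real (Suc n)) \<longlonglongrightarrow> (LINT s:{0<..<stop N \<omega>}|lborel. exp (- r *
      s) * h (Y s \<omega>))"
    if "\<omega> \<in> space M" for \<omega>
    by (rule spectrally_negative_path.riemann_sum_alive_tendsto[OF spectrally_negative_path[OF
        that] r cont C])
  have bound: "\<bar>grid_sum r N n h \<omega> / real (Suc n)\<bar> \<le> real N * C" for n \<omega>
    using grid_sum_bound[OF r C, where N=N and n=n and \<omega>=\<omega>]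
    by (simp add: abs_divide pos_divide_le_eq mult.commute mult.left_commute del: of_nat_Suc
        mult_Suc_right)
  show m: "(\<lambda>\<omega>. LINT s:{0<..<stop N \<omega>}|lborel. exp (- r * s) * h (Y s \<omega>)) \<in> borel_measurable M"
    by (rule borel_measurable_LIMSEQ_real[OF lim]) measurable
  show "\<bar>LINT s:{0<..<stop N \<omega>}|lborel. exp (- r * s) * h (Y s \<omega>)\<bar> \<le> real N * C" if "\<omega> \<in> space M" for \<omega>
    using tendsto_rabs[OF lim[OF that]] bound by (intro LIMSEQ_le_const2) auto
  have "(\<lambda>n. expectation (\<lambda>\<omega>. grid_sum r N n h \<omega> / real (Suc n))) \<longlonglongrightarrow> occupation_before r N h"
    unfolding occupation_before_def
    by (rule integral_dominated_convergence[where w="\<lambda>_. real N * C"])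
       (use bound lim m in \<open>auto simp del: of_nat_Suc mult_Suc_right\<close>)
  then show "(\<lambda>n. expectation (grid_sum r N n h) / real (Suc n)) \<longlonglongrightarrow> occupation_before r N h"
    by simp
qed

lemma exp_bound: "0 \<le> \<alpha> \<Longrightarrow> y \<le> a \<Longrightarrow> \<bar>exp (\<alpha> * y)\<bar> \<le> exp (\<alpha> * a)" for \<alpha> y :: real
  by (simp add: mult_left_mono)

lemma exit_exponential_grid_tendsto:
  assumes \<alpha>: "0 \<le> \<alpha>" and r: "0 \<le> r"
  shows "(\<lambda>n. expectation (\<lambda>\<omega>. exp (- r * (real (exit_index a b N n (path \<omega>)) / real (Suc n)))
        * exp (\<alpha> * Y (real (exit_index a b N n (path \<omega>)) / real (Suc n)) \<omega>)))
    \<longlonglongrightarrow> exp (\<alpha> * x) + (\<phi> \<alpha> - r) * occupation_before r N (\<lambda>y. exp (\<alpha> * y))"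
proof -
  have "(\<lambda>n. exp (\<alpha> * x) + (real (Suc n) * (exp ((\<phi> \<alpha> - r) / real (Suc n)) - 1)) *
      (expectation (grid_sum r N n (\<lambda>y. exp (\<alpha> * y))) / real (Suc n)))
    \<longlonglongrightarrow> exp (\<alpha> * x) + (\<phi> \<alpha> - r) * occupation_before r N (\<lambda>y. exp (\<alpha> * y))"
    by (intro tendsto_intros exp_difference_quotient_tendsto
        occupation_before_limit(1)[OF r continuous_exp_times exp_bound[OF \<alpha>]])
  moreover have "expectation (\<lambda>\<omega>. exp (- r * (real (exit_index a b N n (path \<omega>)) / real (Suc n)))
        * exp (\<alpha> * Y (real (exit_index a b N n (path \<omega>)) / real (Suc n)) \<omega>))
     = exp (\<alpha> * x) + (real (Suc n) * (exp ((\<phi> \<alpha> - r) / real (Suc n)) - 1)) *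
      (expectation (grid_sum r N n (\<lambda>y. exp (\<alpha> * y))) / real (Suc n))" for n
    using has_bochner_integral_integral_eq[OF sum_alive_exponential[OF \<alpha> r, of N n]] by (simp del:
        of_nat_Suc)
  ultimately show ?thesis by simp
qed

text \<open>The grid stops late, possibly after the path has passed \<open>a\<close>, so no constant
  dominates the stopped exponentials. Their squares are the same expressions at
  \<open>2 * \<alpha>\<close> and \<open>2 * q\<close>, whose means converge by
  \<open>exit_exponential_grid_tendsto\<close> and hence are bounded; the L2 criterion then moves
  the limit inside the mean.\<close>

lemma exit_before_exponential:
  assumes \<alpha>: "0 \<le> \<alpha>" and N: "0 < N"
  shows "expectation (\<lambda>\<omega>. exp (- q * stop N \<omega>) * exp (\<alpha> * Y (stop N \<omega>) \<omega>))
    = exp (\<alpha> * x) + (\<phi> \<alpha> - q) * occupation_before q N (\<lambda>y. exp (\<alpha> * y))"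
proof (rule LIMSEQ_unique[OF _ exit_exponential_grid_tendsto[OF \<alpha> q_nonneg]])
  let ?U = "\<lambda>\<alpha> r n \<omega>. exp (- r * (real (exit_index a b N n (path \<omega>)) / real (Suc n)))
        * exp (\<alpha> * Y (real (exit_index a b N n (path \<omega>)) / real (Suc n)) \<omega>)"
  have sq: "(?U \<alpha> q n \<omega>)\<^sup>2 = ?U (2 * \<alpha>) (2 * q) n \<omega>" for n \<omega>
    by (simp add: power_mult_distrib mult.assoc flip: exp_double)
  have \<alpha>2: "0 \<le> 2 * \<alpha>" "0 \<le> 2 * q" using \<alpha> q_nonneg by auto
  have "Bseq (\<lambda>n. expectation (?U (2 * \<alpha>) (2 * q) n))"
    using exit_exponential_grid_tendsto[OF \<alpha>2] by (intro convergent_imp_Bseq convergentI)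
  then obtain B where "\<forall>n. norm (expectation (?U (2 * \<alpha>) (2 * q) n)) \<le> B" by (rule BseqE)
  then have B: "\<And>n. \<bar>expectation (?U (2 * \<alpha>) (2 * q) n)\<bar> \<le> B" by simp
  show "(\<lambda>n. expectation (?U \<alpha> q n)) \<longlonglongrightarrow> expectation (\<lambda>\<omega>. exp (- q * stop N \<omega>) * exp (\<alpha> * Y (stop N \<omega>) \<omega>))"
  proof (rule expectation_tendsto_if_L2_bounded)
    show "integrable M (\<lambda>\<omega>. (?U \<alpha> q n \<omega>)\<^sup>2)" for n
      unfolding sq using sum_alive_exponential[OF \<alpha>2, of N n] by (simp add:
          has_bochner_integral_iff del: of_nat_Suc)
    show "expectation (\<lambda>\<omega>. (?U \<alpha> q n \<omega>)\<^sup>2) \<le> B" for n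
      unfolding sq using B[of n] by linarith
    fix \<omega> assume \<omega>: "\<omega> \<in> space M"
    interpret spectrally_negative_path "path \<omega>" a b using \<omega> by (rule spectrally_negative_path)
    show "(\<lambda>n. ?U \<alpha> q n \<omega>) \<longlonglongrightarrow> exp (- q * stop N \<omega>) * exp (\<alpha> * Y (stop N \<omega>) \<omega>)"
      by (intro tendsto_intros exit_index_tendsto exit_index_value_tendsto N)
    have "exp (- q * stop N \<omega>) \<le> 1" using q_nonneg exit_before_nonneg by simp
    moreover have "exp (\<alpha> * Y (stop N \<omega>) \<omega>) \<le> exp (\<alpha> * a)"
      using exit_before_value_le[OF N] \<alpha> by (simp add: mult_left_mono)
    ultimately show "exp (- q * stop N \<omega>) * exp (\<alpha> * Y (stop N \<omega>) \<omega>) \<le> 1 * exp (\<alpha> * a)"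
      by (intro mult_mono) auto
  next
    show "?U \<alpha> q n \<in> borel_measurable M" for n by measurable
  qed simp
qed

lemma integrable_\<rho>:
  assumes "0 \<le> t" and [measurable]: "h \<in> borel_measurable borel" and C: "\<And>u. \<bar>h u\<bar> \<le> C"
  shows "integrable (\<rho> t) (h :: real \<Rightarrow> real)"
proof (rule Bochner_Integration.integrable_bound)
  show "integrable (\<rho> t) (\<lambda>u. C * exp (0 * u))"
    using laplace[OF assms(1) order_refl] by (intro integrable_mult_right) (simp only:
        has_bochner_integral_iff)
  show "h \<in> borel_measurable (\<rho> t)" by (simp add: measurable_cong_sets[OF sets_\<rho> refl])
  show "AE u in \<rho> t. norm (h u) \<le> norm (C * exp (0 * u))"
    using C by (intro AE_I2) (auto intro: order_trans[OF C])
qed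

text \<open>It vanishes unless the stopping time is an exit through \<open>b\<close>: leaving at
  \<open>a\<close> and reaching the horizon both count as alive.\<close>

definition exit_jump :: "nat \<Rightarrow> (real \<Rightarrow> real) \<Rightarrow> (real \<Rightarrow> real) \<Rightarrow> 'a \<Rightarrow> real" where
  "exit_jump N g h \<omega> = (if alive a b (path \<omega>) (stop N \<omega>) then 0
      else exp (- q * stop N \<omega>) * g (left_limit (path \<omega>) (stop N \<omega>))
        * h (Y (stop N \<omega>) \<omega> - left_limit (path \<omega>) (stop N \<omega>)))"

text \<open>Compensation: the only grid cell that contributes is the one in which the path jumps below zero.\<close>

lemma expectation_exit_jump:
  assumes b: "0 \<le> b" and N: "0 < N"
    and g: "\<And>y. v \<le> y \<Longrightarrow> g y = 0" and h: "\<And>y. - v \<le> y \<Longrightarrow> h y = 0"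
    and cont: "continuous_on UNIV g" "continuous_on UNIV h"
    and g1: "\<And>y. \<bar>g y\<bar> \<le> 1" and h1: "\<And>y. \<bar>h y\<bar> \<le> 1"
    and lim: "(\<lambda>n. real (Suc n) * (\<integral>u. h u \<partial>\<rho> (1 / real (Suc n)))) \<longlonglongrightarrow> l"
  shows "expectation (exit_jump N g h) = occupation_before q N g * l"
    and "exit_jump N g h \<in> borel_measurable M"
    and "\<And>\<omega>. \<omega> \<in> space M \<Longrightarrow> \<bar>exit_jump N g h \<omega>\<bar> \<le> 1"
proof -
  have [measurable]: "g \<in> borel_measurable borel" "h \<in> borel_measurable borel"
    using cont by (auto intro: borel_measurable_continuous_onI)
  define J where "J n \<omega> = (\<Sum>k<N * Suc n. if alive a b (path \<omega>) (real k / real (Suc n))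
      then exp (- q * (real k / real (Suc n))) * g (Y (real k / real (Suc n)) \<omega>) *
        h (Y (real (Suc k) / real (Suc n)) \<omega> - Y (real k / real (Suc n)) \<omega>) else 0)" for n \<omega>
  have [measurable]: "J n \<in> borel_measurable M" for n unfolding J_def by measurable
  have J_lim: "(\<lambda>n. J n \<omega>) \<longlonglongrightarrow> exit_jump N g h \<omega>" if "\<omega> \<in> space M" for \<omega>
    unfolding J_def exit_jump_def
    by (rule spectrally_negative_path.sum_alive_jump_tendsto[OF spectrally_negative_path[OF that] b
        N g h cont])
  have J_bound: "\<bar>J n \<omega>\<bar> \<le> 1" if "\<omega> \<in> space M" for n \<omega>
  proof -
    interpret spectrally_negative_path "path \<omega>" a b using that by (rule spectrally_negative_path)
    have "\<bar>e * g y * h z\<bar> \<le> 1 * 1 * 1" if "0 \<le> e" "e \<le> 1" for e y z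
      unfolding abs_mult using that g1 h1 by (intro mult_mono) auto
    then show ?thesis unfolding J_def
      using sum_alive_jump[OF b N, where v=v and g=g and h=h and q=q and n=n, OF g h] q_nonneg by
          (simp del: of_nat_Suc)
  qed
  show m: "exit_jump N g h \<in> borel_measurable M"
    by (rule borel_measurable_LIMSEQ_real[OF J_lim]) measurable
  show "\<bar>exit_jump N g h \<omega>\<bar> \<le> 1" if "\<omega> \<in> space M" for \<omega>
    using tendsto_rabs[OF J_lim[OF that]] J_bound[OF that] by (intro LIMSEQ_le_const2) auto
  have "(\<lambda>n. expectation (J n)) \<longlonglongrightarrow> expectation (exit_jump N g h)"
    by (rule integral_dominated_convergence[where w="\<lambda>_. 1"]) (use J_lim J_bound m in auto)
  \<comment> \<open>Independence of each increment from its past factors the mean of every term. The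
    factor \<open>Suc n\<close> is distributed so that one side is a Riemann sum for the occupation
    and the other the scaled small-time integral of \<open>h\<close>.\<close>
  moreover have "expectation (J n) = (expectation (grid_sum q N n g) / real (Suc n)) * (real (Suc
      n) * (\<integral>u. h u \<partial>\<rho> (1 / real (Suc n))))" for n
  proof -
    define V where "V k \<omega> = (if alive a b (path \<omega>) (real k / real (Suc n))
        then exp (- q * (real k / real (Suc n))) * g (Y (real k / real (Suc n)) \<omega>) else 0)" for k \<omega>
    have VF: "V k \<in> borel_measurable (F (real k / real (Suc n)))" for k
    proof -
      have [measurable]: "Measurable.pred (F (real k / real (Suc n))) (\<lambda>\<omega>. alive a b (path \<omega>) (real
          k / real (Suc n)))"
        "Y (real k / real (Suc n)) \<in> borel_measurable (F (real k / real (Suc n)))"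
        by (intro alive_adapted adapted; simp)+
      show ?thesis unfolding V_def by measurable
    qed
    have iV: "integrable M (V k)" for k
    proof (rule integrable_const_bound[where B=1])
      show "AE \<omega> in M. norm (V k \<omega>) \<le> 1"
      proof (rule AE_I2)
        fix \<omega>
        have "exp (- q * (real k / real (Suc n))) * \<bar>g (Y (real k / real (Suc n)) \<omega>)\<bar> \<le> 1 * 1"
          using q_nonneg g1 by (intro mult_mono) auto
        then show "norm (V k \<omega>) \<le> 1" by (simp add: V_def abs_mult)
      qed
    qed (use measurable_F_imp[OF _ VF] in auto)
    have step: "has_bochner_integral M (\<lambda>\<omega>. V k \<omega> * h (Y (real (Suc k) / real (Suc n)) \<omega> - Y (real
        k / real (Suc n)) \<omega>))
       (expectation (V k) * (\<integral>u. h u \<partial>\<rho> (1 / real (Suc n))))" for k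
    proof -
      have t: "real k / real (Suc n) \<le> real (Suc k) / real (Suc n)" by (intro divide_right_mono) auto
      have d: "real (Suc k) / real (Suc n) - real k / real (Suc n) = 1 / real (Suc n)"
        by (simp add: diff_divide_distrib[symmetric])
      show ?thesis
        using increments[OF _ t VF iV, of h] integrable_\<rho>[of "1 / real (Suc n)" h 1] h1 unfolding d
            by simp
    qed
    have J_eq: "J n \<omega> = (\<Sum>k<N * Suc n. V k \<omega> * h (Y (real (Suc k) / real (Suc n)) \<omega> - Y (real k /
        real (Suc n)) \<omega>))" for \<omega>
      unfolding J_def V_def by (intro sum.cong) auto
    have "expectation (J n) = (\<Sum>k<N * Suc n. expectation (V k) * (\<integral>u. h u \<partial>\<rho> (1 / real (Suc n))))"
      unfolding J_eq by (intro has_bochner_integral_integral_eq has_bochner_integral_sum step)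
    also have "\<dots> = expectation (\<lambda>\<omega>. \<Sum>k<N * Suc n. V k \<omega>) * (\<integral>u. h u \<partial>\<rho> (1 / real (Suc n)))"
      by (subst Bochner_Integration.integral_sum) (auto simp: iV sum_distrib_right simp del: of_nat_Suc)
    finally show ?thesis by (simp add: V_def del: of_nat_Suc)
  qed
  moreover have "(\<lambda>n. (expectation (grid_sum q N n g) / real (Suc n)) * (real (Suc n) * (\<integral>u. h u \<partial>\<rho>
      (1 / real (Suc n)))))
      \<longlonglongrightarrow> occupation_before q N g * l"
    by (intro tendsto_intros lim occupation_before_limit(1)[where C=1] q_nonneg cont g1)
  ultimately show "expectation (exit_jump N g h) = occupation_before q N g * l"
    using LIMSEQ_unique by simp
qed

end

section \<open>Occupation, exit and jump laws\<close>

context killed_levy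
begin

abbreviation escaped :: "'a \<Rightarrow> bool" where "escaped \<omega> \<equiv> exits a b (path \<omega>)"

definition exit_at :: "'a \<Rightarrow> real" where
  "exit_at \<omega> = (if escaped \<omega> then exit_time a b (path \<omega>) else 0)"

definition exit_value :: "'a \<Rightarrow> real" where
  "exit_value \<omega> = (if escaped \<omega> then Y (exit_time a b (path \<omega>)) \<omega> else x)"

text \<open>This covers every exit through \<open>b\<close>, also a continuous one. The actual jumps
  are selected later by test functions that force the path below zero.\<close>

definition jumped :: "'a \<Rightarrow> bool" where
  "jumped \<omega> \<longleftrightarrow> escaped \<omega> \<and> \<not> alive a b (path \<omega>) (exit_time a b (path \<omega>))"

definition exit_left :: "'a \<Rightarrow> real" where
  "exit_left \<omega> = (if jumped \<omega> then left_limit (path \<omega>) (exit_time a b (path \<omega>)) else 0)"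

definition running :: "'a \<Rightarrow> real \<Rightarrow> bool" where
  "running \<omega> s \<longleftrightarrow> 0 < s \<and> (escaped \<omega> \<longrightarrow> s < exit_at \<omega>)"

text \<open>The measure \<open>R\<close> of the overview. The argument \<open>max 0 s\<close> agrees
  with \<open>s\<close> wherever the weight is positive and avoids negative times, where nothing is
  known about \<open>Y\<close>.\<close>

definition occupation :: "real measure" where
  "occupation = distr (density (M \<Otimes>\<^sub>M lborel) (\<lambda>(\<omega>, s). ennreal (if running \<omega> s then exp (- q * s)
      else 0)))
     borel (\<lambda>(\<omega>, s). Y (max 0 s) \<omega>)"

text \<open>The measure \<open>H\<close> of the overview. Paths that never leave have weight 0, so
  the default \<open>x\<close> in \<open>exit_value\<close> carries no mass.\<close>

definition exit_law :: "real measure" where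
  "exit_law = distr (density M (\<lambda>\<omega>. ennreal (if escaped \<omega> then exp (- q * exit_at \<omega>) else 0)))
      borel exit_value"

text \<open>The second coordinate is the jump and not the position after it: in these coordinates
  the law is the product of \<open>occupation\<close> and the Levy measure wherever the jump leads
  below zero.\<close>

definition jump_law :: "(real \<times> real) measure" where
  "jump_law = distr (density M (\<lambda>\<omega>. ennreal (if jumped \<omega> then exp (- q * exit_at \<omega>) else 0)))
     borel (\<lambda>\<omega>. (exit_left \<omega>, exit_value \<omega> - exit_left \<omega>))"

lemma stop_eventually:
  assumes "\<omega> \<in> space M" "escaped \<omega>"
  shows "eventually (\<lambda>N. stop N \<omega> = exit_time a b (path \<omega>)) sequentially"
  using spectrally_negative_path.exit_before_eventually[OF spectrally_negative_path] assms by blast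

lemma exit_at_measurable [measurable]: "exit_at \<in> borel_measurable M"
proof (rule borel_measurable_LIMSEQ_real)
  show "(\<lambda>N. if escaped \<omega> then stop N \<omega> else 0) \<longlonglongrightarrow> exit_at \<omega>" if "\<omega> \<in> space M" for \<omega>
    using stop_eventually[OF that] by (auto simp: exit_at_def intro: tendsto_eventually)
qed measurable

lemma exit_value_measurable [measurable]: "exit_value \<in> borel_measurable M"
proof (rule borel_measurable_LIMSEQ_real)
  show "(\<lambda>N. if escaped \<omega> then Y (stop (Suc N) \<omega>) \<omega> else x) \<longlonglongrightarrow> exit_value \<omega>" if "\<omega> \<in> space M" for \<omega>
  proof (cases "escaped \<omega>")
    case True
    have "eventually (\<lambda>N. stop (Suc N) \<omega> = exit_time a b (path \<omega>)) sequentially"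
      using stop_eventually[OF that True] by (subst eventually_sequentially_Suc)
    then have "eventually (\<lambda>N. (if escaped \<omega> then Y (stop (Suc N) \<omega>) \<omega> else x) = exit_value \<omega>)
        sequentially"
      by eventually_elim (simp add: exit_value_def True)
    then show ?thesis by (rule tendsto_eventually)
  qed (simp add: exit_value_def)
  note Y_exit_before_measurable[OF zero_less_Suc, measurable]
  show "(\<lambda>\<omega>. if escaped \<omega> then Y (stop (Suc N) \<omega>) \<omega> else x) \<in> borel_measurable M" for N
    by measurable
qed

text \<open>An exit position is either \<open>a\<close> or at most \<open>b\<close>, so the kind of
  exit is visible in the exit value alone; measurability follows.\<close>

lemma jumped_iff: "\<omega> \<in> space M \<Longrightarrow> jumped \<omega> \<longleftrightarrow> escaped \<omega> \<and> exit_value \<omega> \<le> b"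
proof -
  assume "\<omega> \<in> space M"
  then interpret spectrally_negative_path "path \<omega>" a b by (rule spectrally_negative_path)
  show ?thesis
    using exit_value_down exit_value_up start_gt start_less
    by (auto simp: jumped_def exit_value_def)
qed

lemma jumped_measurable [measurable]: "Measurable.pred M jumped"
  by (simp add: jumped_iff cong: measurable_cong)

lemma exit_left_measurable [measurable]: "exit_left \<in> borel_measurable M"
proof (rule borel_measurable_LIMSEQ_real)
  let ?L = "\<lambda>N \<omega>. if alive a b (path \<omega>) (stop (Suc N) \<omega>) then 0 else left_limit (path \<omega>) (stop (Suc
      N) \<omega>)"
  show "(\<lambda>N. if jumped \<omega> then ?L N \<omega> else 0) \<longlonglongrightarrow> exit_left \<omega>" if "\<omega> \<in> space M" for \<omega>
  proof (cases "jumped \<omega>")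
    case True
    then have "escaped \<omega>" by (simp add: jumped_def)
    then have "eventually (\<lambda>N. stop (Suc N) \<omega> = exit_time a b (path \<omega>)) sequentially"
      using stop_eventually[OF that] by (subst eventually_sequentially_Suc)
    then have "eventually (\<lambda>N. (if jumped \<omega> then ?L N \<omega> else 0) = exit_left \<omega>) sequentially"
      by eventually_elim (use True in \<open>simp add: exit_left_def jumped_def\<close>)
    then show ?thesis by (rule tendsto_eventually)
  qed (simp add: exit_left_def)
  note left_limit_exit_before_measurable[OF zero_less_Suc, measurable]
  show "(\<lambda>\<omega>. if jumped \<omega> then ?L N \<omega> else 0) \<in> borel_measurable M" for N
    by measurable
qed

lemma Y_joint_measurable [measurable]:
  "(\<lambda>(\<omega>, s). Y (max 0 s) \<omega>) \<in> borel_measurable (M \<Otimes>\<^sub>M lborel)"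
proof (rule borel_measurable_LIMSEQ_real)
  fix p :: "'a \<times> real" assume p: "p \<in> space (M \<Otimes>\<^sub>M lborel)"
  have "(\<lambda>n. Y (real (nat \<lceil>max 0 (snd p) * real (Suc n)\<rceil>) / real (Suc n)) (fst p)) \<longlonglongrightarrow> Y (max 0 (snd
      p)) (fst p)"
    using p by (intro cadlag_right_sequence[OF cadlag _ ceiling_grid(1) ceiling_grid_tendsto])
      (auto simp: space_pair_measure)
  then show "(\<lambda>n. Y (real (nat \<lceil>max 0 (snd p) * real (Suc n)\<rceil>) / real (Suc n)) (fst p)) \<longlonglongrightarrow> (case p
      of (\<omega>, s) \<Rightarrow> Y (max 0 s) \<omega>)"
    by (simp add: case_prod_beta)
next
  fix n
  show "(\<lambda>p. Y (real (nat \<lceil>max 0 (snd p) * real (Suc n)\<rceil>) / real (Suc n)) (fst p)) \<in>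
      borel_measurable (M \<Otimes>\<^sub>M lborel)"
    by (rule measurable_compose_countable[where f="\<lambda>k p. Y (real k / real (Suc n)) (fst p)"
          and g="\<lambda>p. nat \<lceil>max 0 (snd p) * real (Suc n)\<rceil>"]) measurable
qed

lemma running_measurable [measurable]: "Measurable.pred (M \<Otimes>\<^sub>M lborel) (\<lambda>p. running (fst p) (snd p))"
  unfolding running_def by measurable

lemma running_imp_alive:
  assumes "\<omega> \<in> space M" "running \<omega> s"
  shows "b < Y s \<omega>" "Y s \<omega> \<le> a" "0 < s"
proof -
  interpret spectrally_negative_path "path \<omega>" a b using assms(1) by (rule spectrally_negative_path)
  show s: "0 < s" using assms by (simp add: running_def)
  have "alive a b (path \<omega>) s"
    using assms s less_exit_time_imp_alive[of s] by (cases "escaped \<omega>") (auto simp: running_def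
        exit_at_def exits_def)
  then show "b < Y s \<omega>" "Y s \<omega> \<le> a" using alive_bounds[of a b "path \<omega>" s] s by auto
qed

lemma sets_occupation [simp, measurable_cong]: "sets occupation = sets borel"
  and sets_exit_law [simp, measurable_cong]: "sets exit_law = sets borel"
  and sets_jump_law [simp, measurable_cong]: "sets jump_law = sets borel"
  by (simp_all add: occupation_def exit_law_def jump_law_def)

lemma nn_integral_occupation:
  assumes [measurable]: "h \<in> borel_measurable borel"
  shows "(\<integral>\<^sup>+y. h y \<partial>occupation) = (\<integral>\<^sup>+\<omega>. \<integral>\<^sup>+s. ennreal (if running \<omega> s then exp (- q * s) else 0)
      * h (Y (max 0 s) \<omega>) \<partial>lborel \<partial>M)"
proof -
  have "(\<integral>\<^sup>+y. h y \<partial>occupation) = (\<integral>\<^sup>+p. ennreal (if running (fst p) (snd p) then exp (- q * snd p)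
      else 0) * h (case p of (\<omega>, s) \<Rightarrow> Y (max 0 s) \<omega>) \<partial>(M \<Otimes>\<^sub>M lborel))"
    unfolding occupation_def
    by (subst nn_integral_distr, simp_all add: case_prod_beta')
       (subst nn_integral_density, simp_all add: case_prod_beta')
  also have "\<dots> = (\<integral>\<^sup>+\<omega>. \<integral>\<^sup>+s. ennreal (if running \<omega> s then exp (- q * s) else 0) * h (Y (max 0 s)
      \<omega>) \<partial>lborel \<partial>M)"
    by (subst lborel.nn_integral_fst[symmetric]) (simp_all cong: if_cong)
  finally show ?thesis .
qed

lemma AE_occupation: "AE y in occupation. b < y \<and> y \<le> a"
proof -
  have "AE p in M \<Otimes>\<^sub>M lborel. running (fst p) (snd p) \<longrightarrow> b < Y (max 0 (snd p)) (fst p) \<and> Y (max 0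
      (snd p)) (fst p) \<le> a"
  proof (rule AE_I2, rule impI)
    fix p assume "p \<in> space (M \<Otimes>\<^sub>M lborel)" "running (fst p) (snd p)"
    then show "b < Y (max 0 (snd p)) (fst p) \<and> Y (max 0 (snd p)) (fst p) \<le> a"
      using running_imp_alive[of "fst p" "snd p"] by (auto simp: space_pair_measure max_absorb2)
  qed
  then have "AE p in density (M \<Otimes>\<^sub>M lborel) (\<lambda>(\<omega>, s). ennreal (if running \<omega> s then exp (- q * s)
      else 0)).
      b < Y (max 0 (snd p)) (fst p) \<and> Y (max 0 (snd p)) (fst p) \<le> a"
    by (subst AE_density, simp add: case_prod_beta' cong: if_cong)
       (elim eventually_mono, auto simp: case_prod_beta' split: if_splits)
  then show ?thesis
    unfolding occupation_def by (subst AE_distr_iff) (simp_all add: case_prod_beta')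
qed

lemma AE_exit_law: "AE y in exit_law. y \<le> b \<or> y = a"
proof -
  have "AE \<omega> in M. escaped \<omega> \<longrightarrow> exit_value \<omega> \<le> b \<or> exit_value \<omega> = a"
  proof (rule AE_I2, rule impI)
    fix \<omega> assume "\<omega> \<in> space M" "escaped \<omega>"
    then interpret spectrally_negative_path "path \<omega>" a b by (intro spectrally_negative_path)
    show "exit_value \<omega> \<le> b \<or> exit_value \<omega> = a"
      using exit_value_down exit_value_up \<open>escaped \<omega>\<close> by (auto simp: exit_value_def)
  qed
  then show ?thesis
    unfolding exit_law_def
    by (subst AE_distr_iff, simp_all) (subst AE_density, auto elim!: eventually_mono)
qed

lemma exit_at_nonneg: "\<omega> \<in> space M \<Longrightarrow> 0 \<le> exit_at \<omega>"
  using spectrally_negative_path.exit_time_pos[OF spectrally_negative_path] by (auto simp: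
      exit_at_def less_imp_le)

lemma finite_measure_exit_law: "finite_measure exit_law"
proof
  have "emeasure exit_law (space exit_law) = (\<integral>\<^sup>+\<omega>. ennreal (if escaped \<omega> then exp (- q * exit_at
      \<omega>) else 0) \<partial>M)"
    unfolding exit_law_def by (simp add: emeasure_distr emeasure_density cong: nn_integral_cong)
  also have "\<dots> \<le> (\<integral>\<^sup>+\<omega>. 1 \<partial>M)"
    using exit_at_nonneg q_nonneg by (intro nn_integral_mono) (auto simp flip: ennreal_1 intro!:
        ennreal_leI)
  also have "\<dots> = 1" by (simp add: emeasure_space_1)
  finally show "emeasure exit_law (space exit_law) \<noteq> \<infinity>" by (auto simp: top_unique)
qed

section \<open>Letting the time horizon grow\<close>

lemma less_stop_iff:
  assumes "\<omega> \<in> space M" shows "0 < s \<and> s < stop N \<omega> \<longleftrightarrow> running \<omega> s \<and> s < real N"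
  by (auto simp: exit_before_def running_def exit_at_def)

text \<open>Tonelli turns the mean of the time integral into an integral over the product space, and
  there the horizon enters monotonically.\<close>

lemma occupation_before_tendsto:
  assumes cont: "continuous_on UNIV h" and nonneg: "\<And>y. 0 \<le> h y"
    and C: "\<And>y. b \<le> y \<Longrightarrow> y \<le> a \<Longrightarrow> h y \<le> C"
  shows "(\<lambda>N. ennreal (occupation_before q N h)) \<longlonglongrightarrow> (\<integral>\<^sup>+y. ennreal (h y) \<partial>occupation)"
proof -
  have [measurable]: "h \<in> borel_measurable borel" using cont by (rule borel_measurable_continuous_onI)
  have C': "\<bar>h y\<bar> \<le> C" if "b \<le> y" "y \<le> a" for y using C[OF that] nonneg[of y] by simp
  have C0: "0 \<le> C" using C'[of x] b_less less_a by linarith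
  let ?G = "\<lambda>N (p :: 'a \<times> real). ennreal (if running (fst p) (snd p) \<and> snd p < real N then exp (- q
      * snd p) else 0) * ennreal (h (case p of (\<omega>, s) \<Rightarrow> Y (max 0 s) \<omega>))"
  let ?G' = "\<lambda>(p :: 'a \<times> real). ennreal (if running (fst p) (snd p) then exp (- q * snd p) else 0)
      * ennreal (h (case p of (\<omega>, s) \<Rightarrow> Y (max 0 s) \<omega>))"
  have eq: "ennreal (occupation_before q N h) = (\<integral>\<^sup>+p. ?G N p \<partial>(M \<Otimes>\<^sub>M lborel))" for N
  proof -
    let ?I = "\<lambda>\<omega>. LINT s:{0<..<stop N \<omega>}|lborel. exp (- q * s) * h (Y s \<omega>)"
    have inner: "ennreal (?I \<omega>) = (\<integral>\<^sup>+s. ?G N (\<omega>, s) \<partial>lborel)" "0 \<le> ?I \<omega>" if \<omega>: "\<omega> \<in> space M" for \<omega>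
    proof -
      note cadlag_measurable[OF cadlag[OF \<omega>], measurable]
      let ?f = "\<lambda>s. indicator {0<..<stop N \<omega>} s * (exp (- q * s) * h (Y (max 0 s) \<omega>))"
      have nn: "0 \<le> ?f s" for s using nonneg by simp
      have "integrable lborel ?f"
      proof (rule Bochner_Integration.integrable_bound)
        show "integrable lborel (\<lambda>s. C * indicator {0..real N} s)"
          by (intro integrable_mult_right integrable_real_indicator) auto
        show "AE s in lborel. norm (?f s) \<le> norm (C * indicator {0..real N} s)"
        proof (rule AE_I2)
          fix s
          show "norm (?f s) \<le> norm (C * indicator {0..real N} s)"
          proof (cases "0 < s \<and> s < stop N \<omega>")
            case True
            then have r: "running \<omega> s" "s < real N" using less_stop_iff[OF \<omega>] by auto
            have "h (Y s \<omega>) \<le> C" using running_imp_alive[OF \<omega> r(1)] by (intro C) auto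
            moreover have "exp (- q * s) \<le> 1" using True q_nonneg by simp
            ultimately have "exp (- q * s) * h (Y s \<omega>) \<le> 1 * C" using nonneg by (intro mult_mono) auto
            then show ?thesis using True r nonneg C0 by (simp add: abs_mult max_absorb2)
          qed auto
        qed
      qed measurable
      from nn_integral_eq_integral[OF this] nn
      have "(\<integral>\<^sup>+s. ennreal (?f s) \<partial>lborel) = ennreal (integral\<^sup>L lborel ?f)" by simp
      moreover have "integral\<^sup>L lborel ?f = ?I \<omega>"
        unfolding set_lebesgue_integral_def by (intro Bochner_Integration.integral_cong) (auto
            simp: indicator_def max_absorb2)
      moreover have "ennreal (?f s) = ?G N (\<omega>, s)" for s
      proof (cases "0 < s \<and> s < stop N \<omega>")
        case True
        then have r: "running \<omega> s" "s < real N" using less_stop_iff[OF \<omega>] by auto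
        then show ?thesis using True nonneg by (simp add: ennreal_mult)
      next
        case False
        then have r: "\<not> (running \<omega> s \<and> s < real N)" using less_stop_iff[OF \<omega>] by auto
        then show ?thesis using False by auto
      qed
      ultimately show "ennreal (?I \<omega>) = (\<integral>\<^sup>+s. ?G N (\<omega>, s) \<partial>lborel)" by simp
      show "0 \<le> ?I \<omega>" unfolding set_lebesgue_integral_def using nonneg by (intro integral_nonneg_AE) auto
    qed
    have "integrable M ?I"
      by (rule integrable_const_bound[where B="real N * C"])
         (use occupation_before_limit(2,3)[OF q_nonneg cont C'] in auto)
    then have "ennreal (occupation_before q N h) = (\<integral>\<^sup>+\<omega>. ennreal (?I \<omega>) \<partial>M)"
      unfolding occupation_before_def using inner(2) by (intro nn_integral_eq_integral[symmetric] AE_I2)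
    also have "\<dots> = (\<integral>\<^sup>+\<omega>. \<integral>\<^sup>+s. ?G N (\<omega>, s) \<partial>lborel \<partial>M)"
      using inner(1) by (intro nn_integral_cong)
    also have "\<dots> = (\<integral>\<^sup>+p. ?G N p \<partial>(M \<Otimes>\<^sub>M lborel))"
      by (intro lborel.nn_integral_fst) measurable
    finally show ?thesis .
  qed
  have "(\<lambda>N. \<integral>\<^sup>+p. ?G N p \<partial>(M \<Otimes>\<^sub>M lborel)) \<longlonglongrightarrow> (\<integral>\<^sup>+p. ?G' p \<partial>(M \<Otimes>\<^sub>M lborel))"
  proof (rule nn_integral_LIMSEQ)
    show "incseq ?G"
      by (auto simp: incseq_def le_fun_def intro!: mult_right_mono ennreal_leI)
    show "(\<lambda>N. ?G N p) \<longlonglongrightarrow> ?G' p" for p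
    proof (rule tendsto_eventually)
      obtain N0 where "snd p < real N0" using reals_Archimedean2 by blast
      then have "snd p < real N" if "N0 \<le> N" for N using that by linarith
      then have "eventually (\<lambda>N. snd p < real N) sequentially" by (auto simp: eventually_sequentially)
      then show "eventually (\<lambda>N. ?G N p = ?G' p) sequentially" by eventually_elim simp
    qed
  qed measurable
  also have "(\<integral>\<^sup>+p. ?G' p \<partial>(M \<Otimes>\<^sub>M lborel)) = (\<integral>\<^sup>+y. ennreal (h y) \<partial>occupation)"
    by (subst nn_integral_occupation, simp) (subst lborel.nn_integral_fst[symmetric], simp_all
        cong: if_cong)
  finally show ?thesis by (simp only: eq)
qed

text \<open>Take \<alpha> with \<open>q < \<phi> \<alpha>\<close>. The stopped exponential is at
  most \<open>exp (\<alpha> * a)\<close>, so the stopping identity bounds the exponential integral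
  of the occupation uniformly in the horizon, and on the support \<open>exp (\<alpha> * y)\<close>
  is at least \<open>exp (\<alpha> * b)\<close>. The argument includes \<open>q = 0\<close>.\<close>

lemma finite_measure_occupation: "finite_measure occupation"
proof
  obtain \<alpha> where \<alpha>: "0 \<le> \<alpha>" "q < \<phi> \<alpha>"
    using eventually_conj[OF \<phi>_large eventually_ge_at_top[of 0]] by (auto simp:
        eventually_at_top_linorder)
  have "ennreal (occupation_before q (Suc N) (\<lambda>y. exp (\<alpha> * y))) \<le> ennreal (exp (\<alpha> * a) / (\<phi> \<alpha> -
      q))" for N
  proof (rule ennreal_leI)
    have "expectation (\<lambda>\<omega>. exp (- q * stop (Suc N) \<omega>) * exp (\<alpha> * Y (stop (Suc N) \<omega>) \<omega>)) \<le>
        expectation (\<lambda>_. exp (\<alpha> * a))"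
    proof (rule integral_mono_AE')
      show "AE \<omega> in M. exp (- q * stop (Suc N) \<omega>) * exp (\<alpha> * Y (stop (Suc N) \<omega>) \<omega>) \<le> exp (\<alpha> * a)"
      proof (rule AE_I2)
        fix \<omega> assume "\<omega> \<in> space M"
        then interpret spectrally_negative_path "path \<omega>" a b by (rule spectrally_negative_path)
        have "exp (- q * stop (Suc N) \<omega>) * exp (\<alpha> * Y (stop (Suc N) \<omega>) \<omega>) \<le> 1 * exp (\<alpha> * a)"
          using q_nonneg exit_before_nonneg exit_before_value_le[OF zero_less_Suc] \<alpha> by (intro
              mult_mono) (auto simp: mult_left_mono)
        then show "exp (- q * stop (Suc N) \<omega>) * exp (\<alpha> * Y (stop (Suc N) \<omega>) \<omega>) \<le> exp (\<alpha> * a)" by simp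
      qed
    qed auto
    then have "exp (\<alpha> * x) + (\<phi> \<alpha> - q) * occupation_before q (Suc N) (\<lambda>y. exp (\<alpha> * y)) \<le> exp (\<alpha> * a)"
      unfolding exit_before_exponential[OF \<alpha>(1) zero_less_Suc] by (simp add: prob_space)
    moreover have "0 < exp (\<alpha> * x)" by simp
    ultimately have "(\<phi> \<alpha> - q) * occupation_before q (Suc N) (\<lambda>y. exp (\<alpha> * y)) \<le> exp (\<alpha> * a)" by linarith
    then show "occupation_before q (Suc N) (\<lambda>y. exp (\<alpha> * y)) \<le> exp (\<alpha> * a) / (\<phi> \<alpha> - q)"
      using \<alpha>(2) by (simp add: pos_le_divide_eq mult.commute)
  qed
  moreover have "(\<lambda>N. ennreal (occupation_before q (Suc N) (\<lambda>y. exp (\<alpha> * y)))) \<longlonglongrightarrow> (\<integral>\<^sup>+y. ennreal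
      (exp (\<alpha> * y)) \<partial>occupation)"
    using exp_bound[OF \<alpha>(1)] by (intro LIMSEQ_Suc occupation_before_tendsto[OF
        continuous_exp_times]) auto
  ultimately have fin: "(\<integral>\<^sup>+y. ennreal (exp (\<alpha> * y)) \<partial>occupation) \<le> ennreal (exp (\<alpha> * a) / (\<phi> \<alpha> - q))"
    by (intro LIMSEQ_le_const2) auto
  have "emeasure occupation (space occupation) = (\<integral>\<^sup>+y. 1 \<partial>occupation)" by simp
  also have "\<dots> \<le> (\<integral>\<^sup>+y. ennreal (exp (- (\<alpha> * b))) * ennreal (exp (\<alpha> * y)) \<partial>occupation)"
  proof (rule nn_integral_mono_AE)
    show "AE y in occupation. 1 \<le> ennreal (exp (- (\<alpha> * b))) * ennreal (exp (\<alpha> * y))"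
      using AE_occupation
    proof eventually_elim
      case (elim y)
      then have "0 \<le> - (\<alpha> * b) + \<alpha> * y" using \<alpha>(1) by (simp add: mult_left_mono)
      then have "1 \<le> exp (- (\<alpha> * b)) * exp (\<alpha> * y)" by (simp add: exp_add[symmetric])
      then show ?case by (simp add: ennreal_mult[symmetric] ennreal_leI flip: ennreal_1)
    qed
  qed
  also have "\<dots> = ennreal (exp (- (\<alpha> * b))) * (\<integral>\<^sup>+y. ennreal (exp (\<alpha> * y)) \<partial>occupation)"
    by (rule nn_integral_cmult) simp
  also have "\<dots> < \<infinity>" using fin by (auto simp: ennreal_mult_less_top intro: le_less_trans)
  finally show "emeasure occupation (space occupation) \<noteq> \<infinity>" by simp
qed

lemma occupation_before_tendsto_integral:
  assumes cont: "continuous_on UNIV h" and nonneg: "\<And>y. 0 \<le> h y"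
    and C: "\<And>y. b \<le> y \<Longrightarrow> y \<le> a \<Longrightarrow> h y \<le> C"
  shows "integrable occupation h" "(\<lambda>N. occupation_before q N h) \<longlonglongrightarrow> (\<integral>y. h y \<partial>occupation)"
proof -
  interpret O: finite_measure occupation by (rule finite_measure_occupation)
  have [measurable]: "h \<in> borel_measurable borel" using cont by (rule borel_measurable_continuous_onI)
  show i: "integrable occupation h"
  proof (rule O.integrable_const_bound[where B=C])
    show "AE y in occupation. norm (h y) \<le> C"
      using AE_occupation by eventually_elim (use nonneg C in auto)
  qed simp
  have nn: "0 \<le> occupation_before q N h" for N
    unfolding occupation_before_def set_lebesgue_integral_def
    using nonneg by (intro integral_nonneg_AE AE_I2) (auto intro!: integral_nonneg_AE)
  have "(\<lambda>N. ennreal (occupation_before q N h)) \<longlonglongrightarrow> ennreal (\<integral>y. h y \<partial>occupation)"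
    using occupation_before_tendsto[OF cont nonneg C] nn_integral_eq_integral[OF i] nonneg by simp
  then show "(\<lambda>N. occupation_before q N h) \<longlonglongrightarrow> (\<integral>y. h y \<partial>occupation)"
    using nn nonneg by (subst (asm) tendsto_ennreal_iff) (auto intro!: always_eventually
        integral_nonneg_AE)
qed

text \<open>Without discounting, the mass of \<open>occupation\<close> is the mean time before exit.
  Paths that never leave would each contribute infinite time, so finiteness makes them a null
  set.\<close>

lemma AE_escaped:
  assumes "q = 0" shows "AE \<omega> in M. escaped \<omega>"
proof -
  interpret O: finite_measure occupation by (rule finite_measure_occupation)
  have "(\<integral>\<^sup>+\<omega>. \<integral>\<^sup>+s. ennreal (if running \<omega> s then exp (- q * s) else 0) * 1 \<partial>lborel \<partial>M) = emeasure
      occupation (space occupation)"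
    by (subst nn_integral_occupation[symmetric]) simp_all
  then have "(\<integral>\<^sup>+\<omega>. \<integral>\<^sup>+s. ennreal (if running \<omega> s then exp (- q * s) else 0) \<partial>lborel \<partial>M) \<noteq> \<infinity>"
    using O.emeasure_finite by simp
  moreover have "(\<lambda>\<omega>. \<integral>\<^sup>+s. ennreal (if running \<omega> s then exp (- q * s) else 0) \<partial>lborel) \<in>
      borel_measurable M"
  proof -
    have "(\<lambda>p. ennreal (if running (fst p) (snd p) then exp (- q * snd p) else 0)) \<in>
        borel_measurable (M \<Otimes>\<^sub>M lborel)"
      by measurable
    from lborel.borel_measurable_nn_integral_fst[OF this] show ?thesis by simp
  qed
  ultimately have "AE \<omega> in M. (\<integral>\<^sup>+s. ennreal (if running \<omega> s then exp (- q * s) else 0) \<partial>lborel) \<noteq> \<infinity>"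
    by (intro nn_integral_PInf_AE)
  then show ?thesis
  proof eventually_elim
    case (elim \<omega>)
    show ?case
    proof (rule ccontr)
      assume "\<not> escaped \<omega>"
      then have "(\<integral>\<^sup>+s. ennreal (if running \<omega> s then exp (- q * s) else 0) \<partial>lborel) = (\<integral>\<^sup>+s.
          indicator {0::real<..} s \<partial>lborel)"
        using assms by (intro nn_integral_cong) (auto simp: running_def indicator_def)
      also have "\<dots> = \<infinity>" by (simp add: emeasure_lborel_greaterThan)
      finally show False using elim by simp
    qed
  qed
qed

text \<open>The horizon tends to infinity in \<open>exit_before_exponential\<close>. A path still
  inside at time \<open>N\<close> contributes at most
  \<open>exp (- q * N) * exp (\<alpha> * a)\<close>, which tends to 0 for positive \<open>q\<close>;
  for \<open>q = 0\<close> almost every path leaves.\<close>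

lemma exit_law_exponential:
  assumes \<alpha>: "0 \<le> \<alpha>"
  shows "integrable exit_law (\<lambda>y. exp (\<alpha> * y))"
    and "(\<integral>y. exp (\<alpha> * y) \<partial>exit_law) = exp (\<alpha> * x) + (\<phi> \<alpha> - q) * (\<integral>y. exp (\<alpha> * y) \<partial>occupation)"
proof -
  interpret E: finite_measure exit_law by (rule finite_measure_exit_law)
  show "integrable exit_law (\<lambda>y. exp (\<alpha> * y))"
  proof (rule E.integrable_const_bound[where B="exp (\<alpha> * a)"])
    show "AE y in exit_law. norm (exp (\<alpha> * y)) \<le> exp (\<alpha> * a)"
      using AE_exit_law by eventually_elim (use \<alpha> b_less less_a in \<open>auto intro!: mult_left_mono\<close>)
  qed simp
  let ?U = "\<lambda>\<omega>. (if escaped \<omega> then exp (- q * exit_at \<omega>) else 0) * exp (\<alpha> * exit_value \<omega>)"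
  let ?V = "\<lambda>N \<omega>. exp (- q * stop (Suc N) \<omega>) * exp (\<alpha> * Y (stop (Suc N) \<omega>) \<omega>)"
  have U: "(\<integral>y. exp (\<alpha> * y) \<partial>exit_law) = expectation ?U"
    unfolding exit_law_def
    by (subst integral_distr, simp_all) (subst integral_real_density, simp_all)
  have bound: "?V N \<omega> \<le> exp (- q * stop (Suc N) \<omega>) * exp (\<alpha> * a)" if "\<omega> \<in> space M" for N \<omega>
  proof -
    interpret spectrally_negative_path "path \<omega>" a b using that by (rule spectrally_negative_path)
    show ?thesis using exit_before_value_le[OF zero_less_Suc] \<alpha> by (intro mult_left_mono) (auto
        simp: mult_left_mono)
  qed
  have bound': "?V N \<omega> \<le> exp (\<alpha> * a)" if "\<omega> \<in> space M" for N \<omega>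
  proof -
    interpret spectrally_negative_path "path \<omega>" a b using that by (rule spectrally_negative_path)
    have "exp (- q * stop (Suc N) \<omega>) * exp (\<alpha> * a) \<le> 1 * exp (\<alpha> * a)"
      using q_nonneg exit_before_nonneg by (intro mult_right_mono) auto
    then show ?thesis using bound[OF that, of N] by linarith
  qed
  have "(\<lambda>N. expectation (?V N)) \<longlonglongrightarrow> expectation ?U"
  proof (rule integral_dominated_convergence[where w="\<lambda>_. exp (\<alpha> * a)"])
    note Y_exit_before_measurable[OF zero_less_Suc, measurable]
    show "?V N \<in> borel_measurable M" for N by measurable
    show "AE \<omega> in M. norm (?V N \<omega>) \<le> exp (\<alpha> * a)" for N using bound' by (intro AE_I2) simp
    have "AE \<omega> in M. escaped \<omega> \<or> 0 < q" using AE_escaped q_nonneg by (cases "q = 0") auto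
    then show "AE \<omega> in M. (\<lambda>N. ?V N \<omega>) \<longlonglongrightarrow> ?U \<omega>"
      using AE_space
    proof eventually_elim
      case (elim \<omega>)
      show ?case
      proof (cases "escaped \<omega>")
        case True
        have "eventually (\<lambda>N. stop (Suc N) \<omega> = exit_time a b (path \<omega>)) sequentially"
          using stop_eventually[OF elim(2) True] by (subst eventually_sequentially_Suc)
        then have "eventually (\<lambda>N. ?V N \<omega> = ?U \<omega>) sequentially"
          by eventually_elim (use True in \<open>simp add: exit_value_def exit_at_def\<close>)
        then show ?thesis by (rule tendsto_eventually)
      next
        case False
        then have q: "0 < q" and stop: "stop (Suc N) \<omega> = real (Suc N)" for N using elim by (auto
            simp: exit_before_def)
        have "(\<lambda>N. exp (- q * real (Suc N)) * exp (\<alpha> * a)) \<longlonglongrightarrow> 0 * exp (\<alpha> * a)"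
        proof (intro tendsto_intros)
          have "(\<lambda>N. exp (- q) ^ Suc N) \<longlonglongrightarrow> 0" using q by (intro LIMSEQ_Suc LIMSEQ_power_zero) simp
          then show "(\<lambda>N. exp (- q * real (Suc N))) \<longlonglongrightarrow> 0"
            by (simp only: exp_of_nat_mult[symmetric] mult.commute)
        qed
        then have lim0: "(\<lambda>N. exp (- q * real (Suc N)) * exp (\<alpha> * a)) \<longlonglongrightarrow> 0" by simp
        have "(\<lambda>N. ?V N \<omega>) \<longlonglongrightarrow> 0"
        proof (rule tendsto_sandwich[OF always_eventually always_eventually tendsto_const lim0])
          show "\<forall>N. ?V N \<omega> \<le> exp (- q * real (Suc N)) * exp (\<alpha> * a)"
            using bound[OF elim(2)] unfolding stop by blast
        qed simp
        then show ?thesis using False by simp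
      qed
    qed
  qed auto
  moreover have "(\<lambda>N. expectation (?V N)) \<longlonglongrightarrow> exp (\<alpha> * x) + (\<phi> \<alpha> - q) * (\<integral>y. exp (\<alpha> * y) \<partial>occupation)"
    unfolding exit_before_exponential[OF \<alpha> zero_less_Suc]
    using exp_bound[OF \<alpha>]
    by (intro tendsto_intros LIMSEQ_Suc occupation_before_tendsto_integral[OF continuous_exp_times]) auto
  ultimately show "(\<integral>y. exp (\<alpha> * y) \<partial>exit_law) = exp (\<alpha> * x) + (\<phi> \<alpha> - q) * (\<integral>y. exp (\<alpha> * y) \<partial>occupation)"
    unfolding U by (rule LIMSEQ_unique)
qed

lemma nn_integral_jump_law:
  assumes b: "0 \<le> b"
    and g: "\<And>y. v \<le> y \<Longrightarrow> g y = 0" and h: "\<And>y. - v \<le> y \<Longrightarrow> h y = 0"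
    and cont: "continuous_on UNIV g" "continuous_on UNIV h"
    and g01: "\<And>y. 0 \<le> g y" "\<And>y. g y \<le> 1" and h01: "\<And>y. 0 \<le> h y" "\<And>y. h y \<le> 1"
    and lim: "(\<lambda>n. real (Suc n) * (\<integral>u. h u \<partial>\<rho> (1 / real (Suc n)))) \<longlonglongrightarrow> l" and l: "0 \<le> l"
  shows "(\<integral>\<^sup>+p. ennreal (g (fst p)) * ennreal (h (snd p)) \<partial>jump_law) = (\<integral>\<^sup>+y. ennreal (g y)
      \<partial>occupation) * ennreal l"
proof -
  have abs: "\<bar>g y\<bar> \<le> 1" "\<bar>h y\<bar> \<le> 1" for y using g01[of y] h01[of y] by auto
  have [measurable]: "g \<in> borel_measurable borel" "h \<in> borel_measurable borel"
    using cont by (auto intro: borel_measurable_continuous_onI)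
  let ?Z = "\<lambda>\<omega>. (if jumped \<omega> then exp (- q * exit_at \<omega>) else 0) * (g (exit_left \<omega>) * h (exit_value
      \<omega> - exit_left \<omega>))"
  have J: "expectation (exit_jump (Suc N) g h) = occupation_before q (Suc N) g * l"
    "exit_jump (Suc N) g h \<in> borel_measurable M"
    "\<And>\<omega>. \<omega> \<in> space M \<Longrightarrow> \<bar>exit_jump (Suc N) g h \<omega>\<bar> \<le> 1" for N
    by (rule expectation_exit_jump[where v=v, OF b zero_less_Suc _ _ cont abs lim]; use g h in simp)+
  have Zlim: "(\<lambda>N. exit_jump (Suc N) g h \<omega>) \<longlonglongrightarrow> ?Z \<omega>" if \<omega>: "\<omega> \<in> space M" for \<omega>
  proof (rule tendsto_eventually)
    interpret spectrally_negative_path "path \<omega>" a b using \<omega> by (rule spectrally_negative_path)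
    show "eventually (\<lambda>N. exit_jump (Suc N) g h \<omega> = ?Z \<omega>) sequentially"
    proof (cases "escaped \<omega>")
      case True
      have "eventually (\<lambda>N. stop (Suc N) \<omega> = exit_time a b (path \<omega>)) sequentially"
        using stop_eventually[OF \<omega> True] by (subst eventually_sequentially_Suc)
      then show ?thesis
        by eventually_elim
          (use True in \<open>simp add: exit_value_def exit_at_def exit_jump_def jumped_def exit_left_def\<close>)
    next
      case False
      then have "alive a b (path \<omega>) (stop (Suc N) \<omega>)" for N using exit_before_nonneg by (auto simp:
          exits_def)
      then show ?thesis using False by (simp add: exit_jump_def jumped_def)
    qed
  qed
  have Z01: "0 \<le> ?Z \<omega>" for \<omega> using g01 h01 by simp
  have iZ: "integrable M ?Z"
  proof (rule integrable_const_bound[where B=1])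
    show "AE \<omega> in M. norm (?Z \<omega>) \<le> 1"
    proof (rule AE_I2)
      fix \<omega> assume \<omega>: "\<omega> \<in> space M"
      show "norm (?Z \<omega>) \<le> 1"
        using tendsto_rabs[OF Zlim[OF \<omega>]] J(3)[OF \<omega>] by (intro LIMSEQ_le_const2) auto
    qed
  qed measurable
  have "(\<lambda>N. expectation (exit_jump (Suc N) g h)) \<longlonglongrightarrow> expectation ?Z"
    by (rule integral_dominated_convergence[where w="\<lambda>_. 1"]) (use Zlim J(2,3) iZ in auto)
  moreover have "(\<lambda>N. expectation (exit_jump (Suc N) g h)) \<longlonglongrightarrow> (\<integral>y. g y \<partial>occupation) * l"
    unfolding J(1) using g01 by (intro tendsto_intros LIMSEQ_Suc
        occupation_before_tendsto_integral(2) cont) auto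
  ultimately have eq: "expectation ?Z = (\<integral>y. g y \<partial>occupation) * l" using LIMSEQ_unique by blast
  have "(\<integral>\<^sup>+p. ennreal (g (fst p)) * ennreal (h (snd p)) \<partial>jump_law) = (\<integral>\<^sup>+\<omega>. ennreal (?Z \<omega>) \<partial>M)"
    unfolding jump_law_def
    by (subst nn_integral_distr, simp_all add: borel_prod[symmetric])
       (subst nn_integral_density, simp_all add: ennreal_mult g01 h01)
  also have "\<dots> = ennreal (expectation ?Z)" using iZ Z01 by (intro nn_integral_eq_integral) auto
  also have "\<dots> = ennreal (\<integral>y. g y \<partial>occupation) * ennreal l"
    unfolding eq using l g01 by (intro ennreal_mult) (auto intro!: integral_nonneg_AE)
  also have "ennreal (\<integral>y. g y \<partial>occupation) = (\<integral>\<^sup>+y. ennreal (g y) \<partial>occupation)"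
    using g01 by (intro nn_integral_eq_integral[symmetric] occupation_before_tendsto_integral(1)
        cont) auto
  finally show ?thesis .
qed

end

section \<open>The scale function\<close>

text \<open>If \<open>f y\<close> exceeded \<open>g y\<close>, continuity would separate the
  functions by constants \<open>c1 > c2\<close> on a small interval around \<open>y\<close>, and the
  integrals over it would be ordered the wrong way.\<close>

lemma le_if_interval_integrals_le:
  fixes f g :: "real \<Rightarrow> real"
  assumes f: "continuous_on {l<..<u} f" and g: "continuous_on {l<..<u} g" and nonneg: "\<And>y. 0 \<le> g y"
    and le: "\<And>l' u'. l \<le> l' \<Longrightarrow> u' \<le> u \<Longrightarrow> (\<integral>\<^sup>+y\<in>{l'<..<u'}. ennreal (f y) \<partial>lborel) \<le> (\<integral>\<^sup>+y\<in>{l'<..<u'}.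
        ennreal (g y) \<partial>lborel)"
    and y: "l < y" "y < u"
  shows "f y \<le> g y"
proof (rule ccontr)
  assume "\<not> f y \<le> g y"
  then obtain c1 c2 where c: "g y < c2" "c2 < c1" "c1 < f y" by (metis dense not_le)
  have "isCont f y" "isCont g y" using f g y by (auto simp: continuous_on_eq_continuous_at)
  then have "eventually (\<lambda>z. c1 < f z \<and> g z < c2) (nhds y)"
    using c by (intro eventually_conj) (auto simp: isCont_def tendsto_at_iff_tendsto_nhds dest:
        order_tendstoD)
  then obtain e where e: "0 < e" "\<And>z. dist z y < e \<Longrightarrow> c1 < f z \<and> g z < c2"
    by (auto simp: eventually_nhds_metric)
  define l' where "l' = max l (y - e)"
  define u' where "u' = min u (y + e)"
  have lu: "l \<le> l'" "u' \<le> u" "l' < u'" using y e(1) by (auto simp: l'_def u'_def)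
  have fg: "c1 < f z \<and> g z < c2" if "z \<in> {l'<..<u'}" for z
    using that e(2)[of z] by (auto simp: l'_def u'_def dist_real_def abs_less_iff)
  have c2: "0 < c2" using c nonneg[of y] by linarith
  have "ennreal (c1 * (u' - l')) = (\<integral>\<^sup>+z\<in>{l'<..<u'}. ennreal c1 \<partial>lborel)"
    using lu c c2 by (simp add: nn_integral_cmult_indicator ennreal_mult)
  also have "\<dots> \<le> (\<integral>\<^sup>+z\<in>{l'<..<u'}. ennreal (f z) \<partial>lborel)"
    using fg by (intro nn_integral_mono) (auto simp: indicator_def less_imp_le intro!: ennreal_leI)
  also have "\<dots> \<le> (\<integral>\<^sup>+z\<in>{l'<..<u'}. ennreal (g z) \<partial>lborel)" by (rule le[OF lu(1,2)])
  also have "\<dots> \<le> (\<integral>\<^sup>+z\<in>{l'<..<u'}. ennreal c2 \<partial>lborel)"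
    using fg by (intro nn_integral_mono) (auto simp: indicator_def less_imp_le intro!: ennreal_leI)
  also have "\<dots> = ennreal (c2 * (u' - l'))"
    using lu c c2 by (simp add: nn_integral_cmult_indicator ennreal_mult)
  finally have "c1 * (u' - l') \<le> c2 * (u' - l')" using c2 lu by (simp add: ennreal_le_iff)
  then show False using lu c by simp
qed

text \<open>Below \<open>d\<close> the weight \<open>min (u\<^sup>2) 1\<close> is at least
  \<open>min (d\<^sup>2) 1\<close>, so a bounded function supported there is dominated by a multiple
  of it.\<close>

lemma levy_measure_integrable_away:
  fixes g :: "real \<Rightarrow> real"
  assumes \<nu>: "levy_measure_neg \<nu>" and d: "d < 0" and [measurable]: "g \<in> borel_measurable borel"
    and g: "\<And>u. \<bar>g u\<bar> \<le> 1" "\<And>u. d \<le> u \<Longrightarrow> g u = 0"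
  shows "integrable \<nu> g"
proof -
  have "set_integrable \<nu> {..<0} g"
  proof (rule levy_measure_set_integrable[OF \<nu>])
    fix u :: real assume u: "u < 0"
    have m: "0 < min (d\<^sup>2) 1" using d by simp
    show "\<bar>g u\<bar> \<le> (1 / min (d\<^sup>2) 1) * min (u\<^sup>2) 1"
    proof (cases "d \<le> u")
      case True then show ?thesis using m g(2) by simp
    next
      case False
      then have "(- d)\<^sup>2 \<le> (- u)\<^sup>2" using d by (intro power_mono) auto
      then have "min (d\<^sup>2) 1 \<le> min (u\<^sup>2) 1" by auto
      then have "1 \<le> (1 / min (d\<^sup>2) 1) * min (u\<^sup>2) 1" using m by (simp add: pos_le_divide_eq)
      then show ?thesis using g(1)[of u] by linarith
    qed
  qed measurable
  moreover have "indicator {..<0} u *\<^sub>R g u = g u" for u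
    using d g(2)[of u] by (auto simp: indicator_def)
  ultimately show ?thesis by (simp only: set_integrable_def)
qed

context killed_levy
begin

text \<open>The condition \<open>d \<le> - u\<close> places the rectangle where position plus jump
  is negative, as the compensation argument demands. With \<open>d < 0\<close> the jump side has
  finite Levy measure, so the two limits may be multiplied in the extended reals.\<close>

lemma emeasure_jump_law_rectangle:
  assumes b: "0 \<le> b" and \<nu>: "levy_measure_neg \<nu>"
    and small_time: "\<And>h c d. continuous_on UNIV h \<Longrightarrow> (\<And>u. u \<le> c \<Longrightarrow> h u = 0) \<Longrightarrow> (\<And>u. d \<le> u \<Longrightarrow> h u = 0) \<Longrightarrow>
        d < 0 \<Longrightarrow>
      (\<lambda>n. real (Suc n) * (\<integral>u. h u \<partial>\<rho> (1 / real (Suc n)))) \<longlonglongrightarrow> (\<integral>u. h u \<partial>\<nu>)"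
    and d: "d \<le> - u" "d < 0"
  shows "emeasure jump_law ({l<..<u} \<times> {c<..<d}) = emeasure occupation {l<..<u} * emeasure \<nu> {c<..<d}"
proof -
  have [measurable_cong]: "sets \<nu> = sets borel" using \<nu> by (simp add: levy_measure_neg_def)
  interpret O: finite_measure occupation by (rule finite_measure_occupation)
  have eq: "(\<integral>\<^sup>+p. ennreal (tent l u n (fst p)) * ennreal (tent c d n (snd p)) \<partial>jump_law)
     = (\<integral>\<^sup>+y. ennreal (tent l u n y) \<partial>occupation) * (\<integral>\<^sup>+y. ennreal (tent c d n y) \<partial>\<nu>)" for n
  proof -
    have "(\<integral>\<^sup>+y. ennreal (tent c d n y) \<partial>\<nu>) = ennreal (\<integral>y. tent c d n y \<partial>\<nu>)"
      using tent_nonneg tent_le_1 d(2)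
      by (intro nn_integral_eq_integral levy_measure_integrable_away[OF \<nu> d(2)] AE_I2)
        (auto simp: abs_le_iff tent_eq_0_right intro: order_trans[of _ 0])
    moreover have "(\<lambda>m. real (Suc m) * (\<integral>y. tent c d n y \<partial>\<rho> (1 / real (Suc m)))) \<longlonglongrightarrow> (\<integral>y. tent c d n y \<partial>\<nu>)"
      by (rule small_time[OF continuous_on_tent tent_eq_0_left tent_eq_0_right d(2)])
    then have "(\<integral>\<^sup>+p. ennreal (tent l u n (fst p)) * ennreal (tent c d n (snd p)) \<partial>jump_law)
       = (\<integral>\<^sup>+y. ennreal (tent l u n y) \<partial>occupation) * ennreal (\<integral>y. tent c d n y \<partial>\<nu>)"
      using d by (intro nn_integral_jump_law[OF b, where v=u])
        (auto intro!: tent_eq_0_right tent_nonneg tent_le_1 continuous_on_tent integral_nonneg_AE)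
    ultimately show ?thesis by simp
  qed
  have 1: "(\<lambda>n. \<integral>\<^sup>+y. ennreal (tent l u n y) \<partial>occupation) \<longlonglongrightarrow> emeasure occupation {l<..<u}"
    using nn_integral_tent_tendsto[of occupation "\<lambda>_. 1" l u] by simp
  have 2: "(\<lambda>n. \<integral>\<^sup>+y. ennreal (tent c d n y) \<partial>\<nu>) \<longlonglongrightarrow> emeasure \<nu> {c<..<d}"
    using nn_integral_tent_tendsto[of \<nu> "\<lambda>_. 1" c d] \<nu> by (simp add: levy_measure_neg_def)
  have fin: "emeasure \<nu> {c<..<d} \<noteq> \<infinity>"
  proof -
    have "integrable \<nu> (indicator {c<..<d} :: real \<Rightarrow> real)"
      by (rule levy_measure_integrable_away[OF \<nu> d(2)]) auto
    then show ?thesis by (simp add: integrable_indicator_iff)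
  qed
  have "(\<lambda>n. \<integral>\<^sup>+p. ennreal (tent l u n (fst p)) * ennreal (tent c d n (snd p)) \<partial>jump_law)
    \<longlonglongrightarrow> (\<integral>\<^sup>+p. indicator ({l<..<u} \<times> {c<..<d}) p \<partial>jump_law)"
  proof (rule nn_integral_LIMSEQ)
    show "incseq (\<lambda>n p. ennreal (tent l u n (fst p)) * ennreal (tent c d n (snd p)))"
      by (auto simp: incseq_def le_fun_def intro!: mult_mono ennreal_leI tent_mono)
    show "(\<lambda>n. ennreal (tent l u n (fst p)) * ennreal (tent c d n (snd p))) \<longlonglongrightarrow> indicator ({l<..<u} \<times>
        {c<..<d}) p" for p
    proof (cases "p \<in> {l<..<u} \<times> {c<..<d}")
      case True
      then have "eventually (\<lambda>n. tent l u n (fst p) = 1) sequentially" "eventually (\<lambda>n. tent c d n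
          (snd p) = 1) sequentially"
        by (auto intro!: tent_eventually_eq_1)
      then have "eventually (\<lambda>n. ennreal (tent l u n (fst p)) * ennreal (tent c d n (snd p)) =
          indicator ({l<..<u} \<times> {c<..<d}) p) sequentially"
        by eventually_elim (use True in simp)
      then show ?thesis by (rule tendsto_eventually)
    next
      case False
      then have "ennreal (tent l u n (fst p)) * ennreal (tent c d n (snd p)) = 0" for n
        by (cases p) (auto simp: tent_def)
      then show ?thesis unfolding indicator_simps(2)[OF False] by (simp only: tendsto_const)
    qed
    have "(\<lambda>p. ennreal (tent l u n (fst p)) * ennreal (tent c d n (snd p))) \<in> borel_measurable
        (borel \<Otimes>\<^sub>M borel)" for n
      by measurable
    then show "(\<lambda>p. ennreal (tent l u n (fst p)) * ennreal (tent c d n (snd p))) \<in> borel_measurable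
        jump_law" for n
      by (simp add: borel_prod measurable_cong_sets[OF sets_jump_law refl])
  qed
  also have "(\<integral>\<^sup>+p. indicator ({l<..<u} \<times> {c<..<d}) p \<partial>jump_law) = emeasure jump_law ({l<..<u} \<times>
      {c<..<d})"
    by (intro nn_integral_indicator) (auto intro!: borel_open open_Times)
  finally have "(\<lambda>n. (\<integral>\<^sup>+y. ennreal (tent l u n y) \<partial>occupation) * (\<integral>\<^sup>+y. ennreal (tent c d n y) \<partial>\<nu>))
    \<longlonglongrightarrow> emeasure jump_law ({l<..<u} \<times> {c<..<d})" unfolding eq .
  moreover have "(\<lambda>n. (\<integral>\<^sup>+y. ennreal (tent l u n y) \<partial>occupation) * (\<integral>\<^sup>+y. ennreal (tent c d n y) \<partial>\<nu>))
    \<longlonglongrightarrow> emeasure occupation {l<..<u} * emeasure \<nu> {c<..<d}"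
    using O.emeasure_finite fin by (intro tendsto_mult_ennreal 1 2) auto
  ultimately show ?thesis by (rule LIMSEQ_unique)
qed

text \<open>By right-continuity every path spends a positive time strictly inside before it leaves.
  This is the source of \<open>W (a - b) \<noteq> 0\<close>.\<close>

lemma emeasure_occupation_pos: "emeasure occupation {b<..<a} \<noteq> 0"
proof
  assume "emeasure occupation {b<..<a} = 0"
  moreover have "emeasure occupation {b<..<a} = (\<integral>\<^sup>+y. indicator {b<..<a} y \<partial>occupation)" by simp
  ultimately have 0: "(\<integral>\<^sup>+\<omega>. \<integral>\<^sup>+s. ennreal (if running \<omega> s then exp (- q * s) else 0) * indicator
      {b<..<a} (Y (max 0 s) \<omega>) \<partial>lborel \<partial>M) = 0"
    by (subst (asm) nn_integral_occupation) simp_all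
  have m: "(\<lambda>p. ennreal (if running (fst p) (snd p) then exp (- q * snd p) else 0) * indicator
      {b<..<a} (case p of (\<omega>, s) \<Rightarrow> Y (max 0 s) \<omega>)) \<in> borel_measurable (M \<Otimes>\<^sub>M lborel)"
    by measurable
  have "AE \<omega> in M. (\<integral>\<^sup>+s. ennreal (if running \<omega> s then exp (- q * s) else 0) * indicator {b<..<a}
      (Y (max 0 s) \<omega>) \<partial>lborel) = 0"
    using 0 lborel.borel_measurable_nn_integral_fst[OF m] by (subst (asm) nn_integral_0_iff_AE)
        (simp_all cong: if_cong)
  then have "AE \<omega> in M. False"
    using AE_space
  proof eventually_elim
    case (elim \<omega>)
    interpret spectrally_negative_path "path \<omega>" a b using elim(2) by (rule spectrally_negative_path)
    obtain \<epsilon>1 where e1: "0 < \<epsilon>1" "alive a b (path \<omega>) (0 + \<epsilon>1)"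
      using alive_extend[OF alive_0 order_refl start_less] by blast
    obtain \<epsilon>2 where e2: "0 < \<epsilon>2" "\<And>s. s \<in> {0..0 + \<epsilon>2} \<Longrightarrow> b < Y s \<omega> \<and> Y s \<omega> < a"
      using near_right[OF order_refl start_less start_gt] by blast
    \<comment> \<open>Before time \<open>e\<close> the path has not left, by the choice of
      \<open>\<epsilon>1\<close>, and it lies strictly below \<open>a\<close>, by the choice of
      \<open>\<epsilon>2\<close>.\<close>
    define e where "e = min \<epsilon>1 \<epsilon>2"
    have e: "0 < e" using e1 e2 by (simp add: e_def)
    have run: "running \<omega> s \<and> b < Y s \<omega> \<and> Y s \<omega> < a" if "0 < s" "s < e" for s
      using that e2(2)[of s] alive_imp_le_exit_time[OF _ _ e1(2)] e1(1)
      by (auto simp: running_def exit_at_def e_def)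
    have "ennreal (exp (- q * e)) * ennreal e = (\<integral>\<^sup>+s. ennreal (exp (- q * e)) * indicator {0<..<e}
        s \<partial>lborel)"
      using e by (simp add: nn_integral_cmult_indicator)
    also have "\<dots> \<le> (\<integral>\<^sup>+s. ennreal (if running \<omega> s then exp (- q * s) else 0) * indicator {b<..<a}
        (Y (max 0 s) \<omega>) \<partial>lborel)"
    proof (rule nn_integral_mono)
      fix s :: real
      show "ennreal (exp (- q * e)) * indicator {0<..<e} s \<le> ennreal (if running \<omega> s then exp (- q
          * s) else 0) * indicator {b<..<a} (Y (max 0 s) \<omega>)"
      proof (cases "0 < s \<and> s < e")
        case True
        then have "- q * e \<le> - q * s" using q_nonneg by (simp add: mult_left_mono)
        then show ?thesis using True run[of s] by (simp add: max_absorb2 ennreal_leI)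
      qed auto
    qed
    finally have "ennreal (exp (- q * e) * e) \<le> 0" using elim(1) e by (simp add: ennreal_mult)
    moreover have "0 < exp (- q * e) * e" using e by (intro mult_pos_pos) auto
    ultimately show False by (simp add: ennreal_eq_0_iff)
  qed
  then show False by simp
qed

end

text \<open>The transform is asked for large \<alpha> only: this is enough for inversion and avoids
  comparing exponents with \<open>right_inverse_exponent\<close>.\<close>

locale killed_levy_scale = killed_levy +
  fixes W :: "real \<Rightarrow> real"
  assumes W_nonneg: "\<And>y. 0 \<le> W y" and W_neg: "\<And>y. y < 0 \<Longrightarrow> W y = 0"
    and W_cont: "continuous_on {0<..} W"
    and W_laplace: "eventually (\<lambda>\<alpha>. set_integrable lborel {0..} (\<lambda>y. exp (- \<alpha> * y) * W y) \<and>
        (LINT y:{0..}|lborel. exp (- \<alpha> * y) * W y) = 1 / (\<phi> \<alpha> - q)) at_top"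
begin

lemma W_laplace_transform:
  obtains A where "0 \<le> A" "\<And>\<alpha>. A \<le> \<alpha> \<Longrightarrow> q < \<phi> \<alpha>"
    "\<And>\<alpha>. A \<le> \<alpha> \<Longrightarrow> has_bochner_integral lborel (\<lambda>y. exp (- \<alpha> * y) * W y) (1 / (\<phi> \<alpha> - q))"
proof -
  have *: "indicator {0..} y *\<^sub>R (exp (- \<alpha> * y) * W y) = exp (- \<alpha> * y) * W y" for y \<alpha>
    using W_neg[of y] by (auto simp: indicator_def)
  have "eventually (\<lambda>\<alpha>. 0 \<le> \<alpha> \<and> q < \<phi> \<alpha> \<and> has_bochner_integral lborel (\<lambda>y. exp (- \<alpha> * y) * W y) (1
      / (\<phi> \<alpha> - q))) at_top"
    using W_laplace \<phi>_large eventually_ge_at_top[of 0]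
    by eventually_elim (simp only: set_integrable_def set_lebesgue_integral_def
        has_bochner_integral_iff * simp_thms)
  then show ?thesis using that unfolding eventually_at_top_linorder by (metis order_refl)
qed

text \<open>Continuity of \<open>W\<close> is assumed on the positive half-line only; measurability
  on the line is read off from the integrability of \<open>exp (- A * y) * W y\<close>.\<close>

lemma W_measurable [measurable]: "W \<in> borel_measurable borel"
proof -
  obtain A where "has_bochner_integral lborel (\<lambda>y. exp (- A * y) * W y) (1 / (\<phi> A - q))"
    using W_laplace_transform by (metis order_refl)
  then have "integrable lborel (\<lambda>y. exp (- A * y) * W y)" by (simp only: has_bochner_integral_iff)
  then have [measurable]: "(\<lambda>y. exp (- A * y) * W y) \<in> borel_measurable lborel" by (rule
      borel_measurable_integrable)
  have "(\<lambda>y. exp (A * y) * (exp (- A * y) * W y)) \<in> borel_measurable lborel" by measurable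
  then show ?thesis by (simp add: exp_minus mult.assoc[symmetric])
qed

lemma W_shift:
  assumes "has_bochner_integral lborel (\<lambda>y. exp (- \<alpha> * y) * W y) c"
  shows "has_bochner_integral lborel (\<lambda>y. W (v - y) * exp (\<alpha> * y)) (exp (\<alpha> * v) * c)"
proof -
  have "has_bochner_integral lborel (\<lambda>y. exp (- \<alpha> * (v + (- 1) * y)) * W (v + (- 1) * y)) (c /\<^sub>R \<bar>- 1\<bar>)"
    using assms by (subst lborel_has_bochner_integral_real_affine_iff[symmetric]) simp_all
  then have "has_bochner_integral lborel (\<lambda>y. exp (\<alpha> * v) * (exp (- \<alpha> * (v - y)) * W (v - y))) (exp
      (\<alpha> * v) * c)"
    by (intro has_bochner_integral_mult_right) simp
  moreover have "exp (\<alpha> * v) * (exp (- \<alpha> * (v - y)) * W (v - y)) = W (v - y) * exp (\<alpha> * y)" for y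
    by (simp add: mult.assoc[symmetric] exp_add[symmetric] algebra_simps)
  ultimately show ?thesis by (simp only:)
qed

text \<open>The right-hand side of the inverted identity in the overview, not the law of an
  overshoot. Its exponential transform is that of \<open>exit_law\<close> divided by
  \<open>\<phi> \<alpha> - q\<close>.\<close>

definition overshoot :: "real measure" where
  "overshoot = density lborel (\<lambda>y. \<integral>\<^sup>+v. ennreal (W (v - y)) \<partial>exit_law)"

lemma overshoot_density_measurable [measurable]:
  "(\<lambda>y. \<integral>\<^sup>+v. ennreal (W (v - y)) \<partial>exit_law) \<in> borel_measurable borel"
proof -
  interpret E: finite_measure exit_law by (rule finite_measure_exit_law)
  have "(\<lambda>p. ennreal (W (snd p - fst p))) \<in> borel_measurable (borel \<Otimes>\<^sub>M exit_law)" by measurable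
  from E.borel_measurable_nn_integral_fst[OF this] show ?thesis by simp
qed

lemma overshoot_exponential:
  assumes \<alpha>: "0 \<le> \<alpha>" and L: "has_bochner_integral lborel (\<lambda>y. exp (- \<alpha> * y) * W y) c" "0 \<le> c"
  shows "has_bochner_integral overshoot (\<lambda>y. exp (\<alpha> * y)) ((\<integral>y. exp (\<alpha> * y) \<partial>exit_law) * c)"
proof (rule has_bochner_integral_nn_integral)
  interpret E: finite_measure exit_law by (rule finite_measure_exit_law)
  interpret pair_sigma_finite lborel exit_law ..
  have "(\<integral>\<^sup>+y. ennreal (exp (\<alpha> * y)) \<partial>overshoot) = (\<integral>\<^sup>+y. \<integral>\<^sup>+v. ennreal (W (v - y) * exp (\<alpha> * y))
      \<partial>exit_law \<partial>lborel)"
    unfolding overshoot_def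
    by (subst nn_integral_density, simp_all)
       (intro nn_integral_cong, simp add: nn_integral_multc[symmetric] ennreal_mult W_nonneg)
  also have "\<dots> = (\<integral>\<^sup>+v. \<integral>\<^sup>+y. ennreal (W (v - y) * exp (\<alpha> * y)) \<partial>lborel \<partial>exit_law)"
    by (rule Fubini'[symmetric]) simp
  also have "\<dots> = (\<integral>\<^sup>+v. ennreal (exp (\<alpha> * v) * c) \<partial>exit_law)"
  proof (rule nn_integral_cong)
    fix v
    show "(\<integral>\<^sup>+y. ennreal (W (v - y) * exp (\<alpha> * y)) \<partial>lborel) = ennreal (exp (\<alpha> * v) * c)"
      using W_shift[OF L(1), of v] W_nonneg nn_integral_eq_integral[of lborel "\<lambda>y. W (v - y) * exp
          (\<alpha> * y)"]
      by (simp add: has_bochner_integral_iff)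
  qed
  also have "\<dots> = ennreal (\<integral>v. exp (\<alpha> * v) * c \<partial>exit_law)"
    using exit_law_exponential(1)[OF \<alpha>] L(2) by (intro nn_integral_eq_integral) auto
  finally show "(\<integral>\<^sup>+y. ennreal (exp (\<alpha> * y)) \<partial>overshoot) = ennreal ((\<integral>y. exp (\<alpha> * y) \<partial>exit_law) * c)"
    by simp
qed (use L(2) in \<open>auto simp: overshoot_def intro!: mult_nonneg_nonneg integral_nonneg_AE\<close>)

lemma AE_overshoot: "AE y in overshoot. y \<le> a"
proof -
  have "(\<integral>\<^sup>+v. ennreal (W (v - y)) \<partial>exit_law) = 0" if "a < y" for y
  proof -
    have "AE v in exit_law. ennreal (W (v - y)) = 0"
      using AE_exit_law by eventually_elim (use that b_less less_a W_neg in auto)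
    then show ?thesis by (simp add: nn_integral_0_iff_AE)
  qed
  then show ?thesis unfolding overshoot_def by (subst AE_density) (auto simp: not_le[symmetric])
qed

text \<open>The identity \<open>exit_law_exponential\<close>, divided by
  \<open>\<phi> \<alpha> - q\<close>, says that the transforms of the two measures on the left add
  up to that of \<open>overshoot\<close>. It is evaluated at the exponents \<open>A + j\<close>,
  with \<open>A\<close> so large that the transform of \<open>W\<close> is available; all three
  measures live on \<open>{..a}\<close>.\<close>

lemma occupation_plus_scale_interval:
  "emeasure occupation {l<..<u} + (\<integral>\<^sup>+y\<in>{l<..<u}. ennreal (W (x - y)) \<partial>lborel) = emeasure overshoot
      {l<..<u}"
proof -
  interpret O: finite_measure occupation by (rule finite_measure_occupation)
  obtain A where A: "0 \<le> A" "\<And>\<alpha>. A \<le> \<alpha> \<Longrightarrow> q < \<phi> \<alpha>"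
    "\<And>\<alpha>. A \<le> \<alpha> \<Longrightarrow> has_bochner_integral lborel (\<lambda>y. exp (- \<alpha> * y) * W y) (1 / (\<phi> \<alpha> - q))"
    using W_laplace_transform by metis
  define N2 where "N2 = density lborel (\<lambda>y. ennreal (W (x - y)))"
  have sets: "sets N2 = sets borel" "sets overshoot = sets borel" by (simp_all add: N2_def overshoot_def)
  note sets[measurable_cong]
  have N2: "has_bochner_integral N2 (\<lambda>y. exp (\<alpha> * y)) (exp (\<alpha> * x) * (1 / (\<phi> \<alpha> - q)))" if "A \<le> \<alpha>" for \<alpha>
    using W_shift[OF A(3)[OF that], of x] W_nonneg
    by (simp add: N2_def has_bochner_integral_iff integrable_real_density integral_real_density)
  have N1: "integrable occupation (\<lambda>y. exp (\<alpha> * y))" if "A \<le> \<alpha>" for \<alpha>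
    using exp_bound[of \<alpha>] that A(1) by (intro occupation_before_tendsto_integral(1)[OF
        continuous_exp_times]) auto
  have N3: "has_bochner_integral overshoot (\<lambda>y. exp (\<alpha> * y)) ((\<integral>y. exp (\<alpha> * y) \<partial>exit_law) * (1 / (\<phi>
      \<alpha> - q)))" if "A \<le> \<alpha>" for \<alpha>
    using that A(1) A(2)[OF that] by (intro overshoot_exponential A(3)) auto
  have eq: "(\<integral>y. exp (\<alpha> * y) \<partial>occupation) + (\<integral>y. exp (\<alpha> * y) \<partial>N2) = (\<integral>y. exp (\<alpha> * y) \<partial>overshoot)"
      if "A \<le> \<alpha>" for \<alpha>
  proof -
    have "0 < \<phi> \<alpha> - q" using A(2)[OF that] by simp
    moreover have "0 \<le> \<alpha>" using A(1) that by simp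
    moreover have "r + X * (1 / K) = (X + K * r) * (1 / K)" if "0 < K" for r X K :: real
      using that by (simp add: field_simps)
    ultimately show ?thesis
      unfolding has_bochner_integral_integral_eq[OF N2[OF that]]
          has_bochner_integral_integral_eq[OF N3[OF that]]
      by (simp only: exit_law_exponential(2))
  qed
  have "0 < ennreal (W (x - y)) \<longrightarrow> y \<le> a" for y using W_neg[of "x - y"] less_a by (cases "y \<le> a") auto
  then have "AE y in N2. y \<le> a" unfolding N2_def by (subst AE_density) auto
  then have AE: "AE y in occupation. y \<le> a" "AE y in N2. y \<le> a" "AE y in overshoot. y \<le> a"
    using AE_occupation AE_overshoot by auto
  have int: "integrable occupation (tent l u n)" "integrable N2 (tent l u n)" "integrable overshoot
      (tent l u n)"
    "(\<integral>y. tent l u n y \<partial>occupation) + (\<integral>y. tent l u n y \<partial>N2) = (\<integral>y. tent l u n y \<partial>overshoot)" for n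
    by (rule laplace_additive_imp_integral_additive[where a=a and \<alpha>=A and l=l and ?N1.0=occupation
        and ?N2.0=N2 and ?N3.0=overshoot];
        (intro sets sets_occupation AE N1 integrable.intros[OF N2] integrable.intros[OF N3] eq
            continuous_on_tent tent_eq_0_left | assumption); simp)+
  have nn: "(\<integral>\<^sup>+y. ennreal (tent l u n y) \<partial>occupation) + (\<integral>\<^sup>+y. ennreal (tent l u n y) \<partial>N2) =
      (\<integral>\<^sup>+y. ennreal (tent l u n y) \<partial>overshoot)" for n
    using int[of n] by (simp add: nn_integral_eq_integral tent_nonneg ennreal_plus[symmetric]
        integral_nonneg_AE del: ennreal_plus)
  have lim: "(\<lambda>n. \<integral>\<^sup>+y. ennreal (tent l u n y) \<partial>N) \<longlonglongrightarrow> emeasure N {l<..<u}" if "sets N = sets borel" for N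
    using nn_integral_tent_tendsto[of N "\<lambda>_. 1" l u] that by simp
  have "(\<lambda>n. (\<integral>\<^sup>+y. ennreal (tent l u n y) \<partial>occupation) + (\<integral>\<^sup>+y. ennreal (tent l u n y) \<partial>N2))
     \<longlonglongrightarrow> emeasure occupation {l<..<u} + emeasure N2 {l<..<u}"
    by (intro tendsto_add lim sets sets_occupation)
  then have "emeasure occupation {l<..<u} + emeasure N2 {l<..<u} = emeasure overshoot {l<..<u}"
    unfolding nn by (rule LIMSEQ_unique) (intro lim sets)
  then show ?thesis by (simp add: N2_def emeasure_density)
qed

text \<open>The constant \<open>h\<close> of the overview: the discounted probability of leaving
  through \<open>a\<close>.\<close>

definition exit_mass :: real where "exit_mass = measure exit_law {a}"

lemma exit_mass_nonneg: "0 \<le> exit_mass"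
  by (simp add: exit_mass_def)

lemma overshoot_density_ge: "ennreal (exit_mass * W (a - y)) \<le> (\<integral>\<^sup>+v. ennreal (W (v - y)) \<partial>exit_law)"
proof -
  interpret E: finite_measure exit_law by (rule finite_measure_exit_law)
  have "ennreal (exit_mass * W (a - y)) = ennreal (W (a - y)) * emeasure exit_law {a}"
    by (simp add: exit_mass_def E.emeasure_eq_measure ennreal_mult W_nonneg mult.commute)
  also have "\<dots> = (\<integral>\<^sup>+v. ennreal (W (a - y)) * indicator {a} v \<partial>exit_law)"
    by (simp add: nn_integral_cmult_indicator)
  also have "\<dots> \<le> (\<integral>\<^sup>+v. ennreal (W (v - y)) \<partial>exit_law)"
    by (intro nn_integral_mono) (auto simp: indicator_def)
  finally show ?thesis .
qed

lemma overshoot_density_eq: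
  assumes "b < y"
  shows "(\<integral>\<^sup>+v. ennreal (W (v - y)) \<partial>exit_law) = ennreal (exit_mass * W (a - y))"
proof -
  interpret E: finite_measure exit_law by (rule finite_measure_exit_law)
  have "(\<integral>\<^sup>+v. ennreal (W (v - y)) \<partial>exit_law) = (\<integral>\<^sup>+v. ennreal (W (a - y)) * indicator {a} v \<partial>exit_law)"
  proof (rule nn_integral_cong_AE)
    show "AE v in exit_law. ennreal (W (v - y)) = ennreal (W (a - y)) * indicator {a} v"
      using AE_exit_law
    proof eventually_elim
      case (elim v)
      then show ?case using assms W_neg[of "v - y"] b_less less_a by (cases "v = a") auto
    qed
  qed
  also have "\<dots> = ennreal (W (a - y)) * emeasure exit_law {a}"
    by (simp add: nn_integral_cmult_indicator)
  also have "\<dots> = ennreal (exit_mass * W (a - y))"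
    by (simp add: exit_mass_def E.emeasure_eq_measure ennreal_mult W_nonneg mult.commute)
  finally show ?thesis .
qed

section \<open>The resolvent density and the value of \<open>exit_mass\<close>\<close>

lemma occupation_interval_eq:
  assumes "b \<le> l"
  shows "emeasure occupation {l<..<u} + (\<integral>\<^sup>+y\<in>{l<..<u}. ennreal (W (x - y)) \<partial>lborel)
    = (\<integral>\<^sup>+y\<in>{l<..<u}. ennreal (exit_mass * W (a - y)) \<partial>lborel)"
proof -
  have "emeasure overshoot {l<..<u} = (\<integral>\<^sup>+y\<in>{l<..<u}. ennreal (exit_mass * W (a - y)) \<partial>lborel)"
    unfolding overshoot_def using assms
    by (subst emeasure_density) (auto intro!: nn_integral_cong simp: overshoot_density_eq indicator_def)
  then show ?thesis using occupation_plus_scale_interval by simp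
qed

lemma scale_integral_ge_below:
  assumes "u \<le> b"
  shows "(\<integral>\<^sup>+y\<in>{l<..<u}. ennreal (exit_mass * W (a - y)) \<partial>lborel) \<le> (\<integral>\<^sup>+y\<in>{l<..<u}. ennreal (W (x -
      y)) \<partial>lborel)"
proof -
  have "emeasure occupation {l<..<u} = 0"
  proof -
    have "AE y in occupation. \<not> (y \<in> {l<..<u})"
      using AE_occupation by eventually_elim (use assms in auto)
    moreover have "{y \<in> space occupation. y \<in> {l<..<u}} = {l<..<u}"
      using sets_eq_imp_space_eq[OF sets_occupation] by auto
    ultimately show ?thesis by (metis emeasure_eq_0_AE)
  qed
  moreover have "(\<integral>\<^sup>+y\<in>{l<..<u}. ennreal (exit_mass * W (a - y)) \<partial>lborel) \<le> emeasure overshoot {l<..<u}"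
    unfolding overshoot_def
    by (subst emeasure_density) (auto intro!: nn_integral_mono mult_right_mono overshoot_density_ge)
  ultimately show ?thesis using occupation_plus_scale_interval[of l u] by simp
qed

lemma W_shift_cont: "continuous_on {..<v} (\<lambda>y. W (v - y))"
  by (rule continuous_on_compose2[OF W_cont]) (auto intro!: continuous_intros)

text \<open>The integrated inequality on intervals above \<open>b\<close> expresses that
  \<open>occupation\<close> is nonnegative. The point \<open>y = x\<close> is excluded because the
  value of \<open>W\<close> at 0 is left open.\<close>

lemma W_le_above:
  assumes "b < y" "y < a" "y \<noteq> x"
  shows "W (x - y) \<le> exit_mass * W (a - y)"
proof (cases "y < x")
  case True
  show ?thesis
  proof (rule le_if_interval_integrals_le[where l=b and u=x and f="\<lambda>y. W (x - y)" and g="\<lambda>y.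
      exit_mass * W (a - y)"])
    show "continuous_on {b<..<x} (\<lambda>y. W (x - y))" by (rule continuous_on_subset[OF W_shift_cont]) auto
    show "continuous_on {b<..<x} (\<lambda>y. exit_mass * W (a - y))"
      using less_a by (intro continuous_intros continuous_on_subset[OF W_shift_cont]) auto
    show "(\<integral>\<^sup>+y\<in>{l'<..<u'}. ennreal (W (x - y)) \<partial>lborel) \<le> (\<integral>\<^sup>+y\<in>{l'<..<u'}. ennreal (exit_mass * W
        (a - y)) \<partial>lborel)"
      if "b \<le> l'" for l' u'
      unfolding occupation_interval_eq[OF that, of u', symmetric] by (rule add_increasing) simp_all
  qed (use True assms exit_mass_nonneg W_nonneg in auto)
next
  case False
  then show ?thesis using assms W_neg[of "x - y"] exit_mass_nonneg W_nonneg by simp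
qed

lemma W_ge_below:
  assumes "y < b"
  shows "exit_mass * W (a - y) \<le> W (x - y)"
proof (rule le_if_interval_integrals_le[where l="y - 1" and u=b and f="\<lambda>y. exit_mass * W (a - y)"
    and g="\<lambda>y. W (x - y)"])
  show "continuous_on {y - 1<..<b} (\<lambda>y. W (x - y))"
    using b_less by (intro continuous_on_subset[OF W_shift_cont]) auto
  show "continuous_on {y - 1<..<b} (\<lambda>y. exit_mass * W (a - y))"
    using less_a b_less by (intro continuous_intros continuous_on_subset[OF W_shift_cont]) auto
qed (use assms W_nonneg scale_integral_ge_below in auto)

text \<open>Both \<open>W (x - y)\<close> and \<open>W (a - y)\<close> are continuous in
  \<open>y\<close> at \<open>b\<close>, so the inequality valid above \<open>b\<close> and the
  reverse one valid below \<open>b\<close> pass to the limit.\<close>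

lemma scale_at_boundary: "W (x - b) = exit_mass * W (a - b)"
proof (rule antisym)
  have cont: "((\<lambda>y. W (v - y)) \<longlongrightarrow> W (v - b)) (at b)" if "b < v" for v
    using W_shift_cont[of v] that by (simp add: continuous_on_eq_continuous_at isCont_def)
  have x: "((\<lambda>y. W (x - y)) \<longlongrightarrow> W (x - b)) (at b)" by (rule cont[OF b_less])
  have a: "((\<lambda>y. exit_mass * W (a - y)) \<longlongrightarrow> exit_mass * W (a - b)) (at b)"
    using b_less less_a by (intro tendsto_intros cont) auto
  show "W (x - b) \<le> exit_mass * W (a - b)"
  proof (rule tendsto_le[OF _ filterlim_mono[OF a order_refl] filterlim_mono[OF x order_refl]])
    show "eventually (\<lambda>y. W (x - y) \<le> exit_mass * W (a - y)) (at_right b)"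
      using b_less less_a W_le_above unfolding eventually_at_right_field by (intro exI[of _ x]) auto
  qed (auto intro: at_le)
  show "exit_mass * W (a - b) \<le> W (x - b)"
  proof (rule tendsto_le[OF _ filterlim_mono[OF x order_refl] filterlim_mono[OF a order_refl]])
    show "eventually (\<lambda>y. exit_mass * W (a - y) \<le> W (x - y)) (at_left b)"
      using W_ge_below unfolding eventually_at_left_field by (intro exI[of _ "b - 1"]) auto
  qed (auto intro: at_le)
qed

text \<open>The integral of \<open>exit_mass * W (a - y)\<close> dominates the occupation of the
  open interval, which is positive.\<close>

lemma scale_nonzero_if_resolvent:
  assumes "\<And>y. b < y \<Longrightarrow> y < a \<Longrightarrow> W (a - y) = 0" shows False
proof -
  have "(\<integral>\<^sup>+y\<in>{b<..<a}. ennreal (exit_mass * W (a - y)) \<partial>lborel) = (\<integral>\<^sup>+y. 0 \<partial>(lborel :: real measure))"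
    using assms by (intro nn_integral_cong) (auto simp: indicator_def)
  then show False using occupation_interval_eq[of b a] emeasure_occupation_pos by simp
qed

lemma emeasure_occupation_interval:
  assumes "b \<le> l" "u \<le> a"
  shows "emeasure occupation {l<..<u} = (\<integral>\<^sup>+y\<in>{l<..<u}. ennreal (exit_mass * W (a - y) - W (x - y))
      \<partial>lborel)"
proof -
  let ?R = "\<integral>\<^sup>+y\<in>{l<..<u}. ennreal (exit_mass * W (a - y) - W (x - y)) \<partial>lborel"
  let ?B = "\<integral>\<^sup>+y\<in>{l<..<u}. ennreal (W (x - y)) \<partial>lborel"
  obtain A where A: "has_bochner_integral lborel (\<lambda>y. exp (- A * y) * W y) (1 / (\<phi> A - q))"
    using W_laplace_transform by (metis order_refl)
  \<comment> \<open>Cancelling \<open>?B\<close> in the extended reals requires it to be finite.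
    \<open>W\<close> is integrable over bounded intervals because its exponentially weighted
    integral is finite and the weight is bounded below there.\<close>
  have "?B \<le> (\<integral>\<^sup>+y. ennreal (exp (\<bar>A\<bar> * (\<bar>l\<bar> + \<bar>u\<bar>))) * ennreal (W (x - y) * exp (A * y)) \<partial>lborel)"
  proof (rule nn_integral_mono)
    fix y :: real
    show "ennreal (W (x - y)) * indicator {l<..<u} y \<le> ennreal (exp (\<bar>A\<bar> * (\<bar>l\<bar> + \<bar>u\<bar>))) * ennreal
        (W (x - y) * exp (A * y))"
    proof (cases "l < y \<and> y < u")
      case True
      have "\<bar>A * y\<bar> \<le> \<bar>A\<bar> * (\<bar>l\<bar> + \<bar>u\<bar>)" unfolding abs_mult using True by (intro mult_left_mono) auto
      then have "1 \<le> exp (\<bar>A\<bar> * (\<bar>l\<bar> + \<bar>u\<bar>)) * exp (A * y)" by (simp add: exp_add[symmetric] abs_le_iff)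
      then have "W (x - y) * 1 \<le> W (x - y) * (exp (\<bar>A\<bar> * (\<bar>l\<bar> + \<bar>u\<bar>)) * exp (A * y))"
        using W_nonneg by (intro mult_left_mono) auto
      then show ?thesis using True W_nonneg
        by (simp add: ennreal_mult[symmetric] mult.left_commute ennreal_leI)
    qed auto
  qed
  also have "\<dots> = ennreal (exp (\<bar>A\<bar> * (\<bar>l\<bar> + \<bar>u\<bar>))) * (\<integral>\<^sup>+y. ennreal (W (x - y) * exp (A * y)) \<partial>lborel)"
    by (rule nn_integral_cmult) measurable
  also have "(\<integral>\<^sup>+y. ennreal (W (x - y) * exp (A * y)) \<partial>lborel) = ennreal (exp (A * x) * (1 / (\<phi> A - q)))"
    using W_shift[OF A, of x] W_nonneg nn_integral_eq_integral[of lborel "\<lambda>y. W (x - y) * exp (A * y)"]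
    by (simp add: has_bochner_integral_iff)
  finally have fin: "?B \<noteq> \<infinity>" by (auto simp: ennreal_mult[symmetric] top_unique ennreal_mult_eq_top_iff)
  have "?R + ?B = (\<integral>\<^sup>+y\<in>{l<..<u}. ennreal (exit_mass * W (a - y)) \<partial>lborel)"
  proof -
    have "?R + ?B = (\<integral>\<^sup>+y. ennreal (exit_mass * W (a - y) - W (x - y)) * indicator {l<..<u} y +
        ennreal (W (x - y)) * indicator {l<..<u} y \<partial>lborel)"
      by (rule nn_integral_add[symmetric]) measurable
    also have "\<dots> = (\<integral>\<^sup>+y\<in>{l<..<u}. ennreal (exit_mass * W (a - y)) \<partial>lborel)"
    proof (rule nn_integral_cong_AE)
      show "AE y in lborel. ennreal (exit_mass * W (a - y) - W (x - y)) * indicator {l<..<u} y +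
          ennreal (W (x - y)) * indicator {l<..<u} y
         = ennreal (exit_mass * W (a - y)) * indicator {l<..<u} y"
        using AE_lborel_singleton[of x]
      proof eventually_elim
        case (elim y)
        show ?case
        proof (cases "l < y \<and> y < u")
          case True
          then have "W (x - y) \<le> exit_mass * W (a - y)" using assms elim by (intro W_le_above) auto
          then show ?thesis using True W_nonneg by (simp add: ennreal_plus[symmetric] del: ennreal_plus)
        qed auto
      qed
    qed
    finally show ?thesis .
  qed
  then have "?R + ?B = emeasure occupation {l<..<u} + ?B" using occupation_interval_eq[OF assms(1),
      of u] by simp
  then have "emeasure occupation {l<..<u} + ?B = ?R + ?B" by (rule sym)
  then have "?B + emeasure occupation {l<..<u} = ?B + ?R" by (simp only: add.commute)
  then show ?thesis using fin by (simp only: ennreal_add_left_cancel) blast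
qed

end

section \<open>Ruin by a jump\<close>

lemma box_real_pair: "box p r = {fst p<..<fst r} \<times> {snd p<..<snd r}" for p r :: "real \<times> real"
  by (cases p; cases r) (auto simp: box_def Basis_prod_def)

lemma greaterThanLessThan_Int: "{l<..<u} \<inter> {l'<..<u'} = {max l l'<..<min u u'}" for l :: "'b::linorder"
  by auto

text \<open>The region where position plus jump is negative is no rectangle, and equality is known
  only on rectangles inside it. Within one of them, uniqueness on the intersection-stable boxes
  applies; countably many rational rectangles cover the region and are made disjoint.\<close>

lemma emeasure_eq_if_eq_on_rectangles:
  fixes J K :: "(real \<times> real) measure" and b a :: real
  assumes sets: "sets J = sets borel" "sets K = sets borel" and fin: "finite_measure J"
    and b: "0 \<le> b"
    and eq: "\<And>l u c d. b \<le> l \<Longrightarrow> u \<le> a \<Longrightarrow> d \<le> - u \<Longrightarrow> d < 0 \<Longrightarrow>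
      emeasure J ({l<..<u} \<times> {c<..<d}) = emeasure K ({l<..<u} \<times> {c<..<d})"
    and B: "B \<in> sets borel" "B \<subseteq> {(y, w). b < y \<and> y < a \<and> y + w < 0}"
  shows "emeasure J B = emeasure K B"
proof -
  note sets[measurable_cong]
  have rect: "{l<..<u} \<times> {c<..<d} \<in> sets (borel :: (real \<times> real) measure)" for l u c d :: real
    by (intro borel_open open_Times) auto
  have local: "emeasure J (C \<inter> ({l<..<u} \<times> {c<..<d})) = emeasure K (C \<inter> ({l<..<u} \<times> {c<..<d}))"
    if C: "C \<in> sets borel" and lu: "b \<le> l" "u \<le> a" "d \<le> - u" "d < 0" for C l u c d
  proof -
    let ?Q = "{l<..<u} \<times> {c<..<d}"
    define J' where "J' = density J (indicator ?Q)"
    define K' where "K' = density K (indicator ?Q)"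
    have J': "emeasure J' D = emeasure J (D \<inter> ?Q)" "emeasure K' D = emeasure K (D \<inter> ?Q)" if "D \<in>
        sets borel" for D
      using that rect[of l u c d] sets by (simp_all add: J'_def K'_def emeasure_restricted Int_commute)
    have boxes: "emeasure J' (box p r) = emeasure K' (box p r)" for p r
    proof -
      \<comment> \<open>Shrinking a rectangle preserves \<open>b \<le> l\<close>,
        \<open>u \<le> a\<close>, \<open>d \<le> - u\<close> and \<open>d < 0\<close>, so its
        intersections with boxes stay admissible.\<close>
      have "box p r \<inter> ?Q = {max (fst p) l<..<min (fst r) u} \<times> {max (snd p) c<..<min (snd r) d}"
        unfolding box_real_pair Times_Int_Times greaterThanLessThan_Int ..
      moreover have "emeasure J ({max (fst p) l<..<min (fst r) u} \<times> {max (snd p) c<..<min (snd r) d})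
        = emeasure K ({max (fst p) l<..<min (fst r) u} \<times> {max (snd p) c<..<min (snd r) d})" using
            lu by (intro eq) auto
      ultimately show ?thesis by (simp add: J')
    qed
    have "J' = K'"
    proof (rule measure_eqI_generator_eq[where E="range (\<lambda>(p, r). box p r)" and \<Omega>=UNIV and
        A="\<lambda>n::nat. box (- real n, - real n) (real n, real n)"])
      show "Int_stable (range (\<lambda>(p, r). box p r :: (real \<times> real) set))"
      proof (rule Int_stableI)
        fix S T assume "S \<in> range (\<lambda>(p, r). box p r :: (real \<times> real) set)" "T \<in> range (\<lambda>(p, r). box
            p r :: (real \<times> real) set)"
        then obtain p r p' r' where "S = box p r" "T = box p' r'" by auto
        then have "S \<inter> T = box (max (fst p) (fst p'), max (snd p) (snd p')) (min (fst r) (fst r'),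
            min (snd r) (snd r'))"
          by (simp add: box_real_pair Times_Int_Times greaterThanLessThan_Int)
        then show "S \<inter> T \<in> range (\<lambda>(p, r). box p r :: (real \<times> real) set)" by auto
      qed
      show "sets J' = sigma_sets UNIV (range (\<lambda>(p, r). box p r))" "sets K' = sigma_sets UNIV (range
          (\<lambda>(p, r). box p r))"
        using sets by (simp_all add: J'_def K'_def borel_eq_box)
      show "(\<Union>n. box (- real n, - real n) (real n, real n)) = (UNIV :: (real \<times> real) set)"
      proof (intro equalityI subsetI)
        fix p :: "real \<times> real"
        obtain n where "max \<bar>fst p\<bar> \<bar>snd p\<bar> < real n" using reals_Archimedean2 by blast
        then show "p \<in> (\<Union>n. box (- real n, - real n) (real n, real n))"
          by (cases p) (auto simp: box_real_pair abs_less_iff intro!: exI[of _ n])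
      qed simp
      show "emeasure J' (box (- real n, - real n) (real n, real n)) \<noteq> \<infinity>" for n
        using finite_measure.emeasure_finite[OF fin] by (subst J'(1)) simp_all
    qed (use boxes in auto)
    then show ?thesis using J'[OF C] by simp
  qed
  define I where "I = {(l, u, c, d). l \<in> \<rat> \<and> u \<in> \<rat> \<and> (c :: real) \<in> \<rat> \<and> d \<in> \<rat> \<and> b \<le> l \<and> u \<le> a \<and> d \<le>
      - u \<and> d < (0::real)}"
  define R where "R = (\<lambda>(l, u, c, d). {l<..<u} \<times> {c<..<d :: real} :: (real \<times> real) set)"
  have "I \<subseteq> \<rat> \<times> \<rat> \<times> \<rat> \<times> \<rat>" by (auto simp: I_def)
  then have cI: "countable I" by (rule countable_subset) (intro countable_SIGMA countable_rat)
  have cover: "B \<subseteq> (\<Union>i\<in>I. R i)"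
  proof
    fix p assume "p \<in> B"
    then obtain y w where p: "p = (y, w)" "b < y" "y < a" "y + w < 0" using B(2) by auto
    obtain l where l: "l \<in> \<rat>" "b < l" "l < y" using Rats_dense_in_real[OF p(2)] by auto
    obtain u where u: "u \<in> \<rat>" "y < u" "u < min a (- w)" using Rats_dense_in_real[of y "min a (-
        w)"] p by auto
    obtain d where d: "d \<in> \<rat>" "w < d" "d < - u" using Rats_dense_in_real[of w "- u"] u by auto
    obtain c where c: "c \<in> \<rat>" "c < w" using Rats_dense_in_real[of "w - 1" w] by auto
    have "(l, u, c, d) \<in> I" using l u d c p b by (auto simp: I_def)
    moreover have "p \<in> R (l, u, c, d)" using l u d c p by (auto simp: R_def)
    ultimately show "p \<in> (\<Union>i\<in>I. R i)" by blast
  qed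
  show ?thesis
  proof (cases "I = {}")
    case True
    then have "B = {}" using cover by auto
    then show ?thesis by simp
  next
    case False
    define Q where "Q n = R (from_nat_into I n)" for n
    have Q: "\<exists>l u c d. b \<le> l \<and> u \<le> a \<and> d \<le> - u \<and> d < 0 \<and> Q n = {l<..<u} \<times> {c<..<d}" for n
    proof -
      obtain l u c d where i: "from_nat_into I n = (l, u, c, d)" by (metis prod_cases4)
      have "(l, u, c, d) \<in> I" using from_nat_into[OF False, of n] by (simp add: i)
      then have "b \<le> l \<and> u \<le> a \<and> d \<le> - u \<and> d < 0" by (simp add: I_def)
      moreover have "Q n = {l<..<u} \<times> {c<..<d}" by (simp add: Q_def i R_def)
      ultimately show ?thesis by blast
    qed
    have Q_borel: "Q n \<in> sets borel" for n using Q[of n] rect by metis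
    have UQ: "(\<Union>n. Q n) = (\<Union>i\<in>I. R i)"
      unfolding Q_def using range_from_nat_into[OF False cI] by (metis image_image)
    define D where "D n = B \<inter> disjointed Q n" for n
    have D_borel: "D n \<in> sets borel" for n
      unfolding D_def using B(1) sets.range_disjointed_sets[of Q borel] Q_borel by auto
    have "B = (\<Union>n. D n)" unfolding D_def using cover UQ UN_disjointed_eq[of Q] by auto
    moreover have "disjoint_family D"
      unfolding D_def using disjoint_family_disjointed[of Q] by (auto simp: disjoint_family_on_def)
    moreover have "emeasure J (D n) = emeasure K (D n)" for n
    proof -
      obtain l u c d where q: "b \<le> l" "u \<le> a" "d \<le> - u" "d < 0" "Q n = {l<..<u} \<times> {c<..<d}" using Q
          by metis
      have "D n = D n \<inter> Q n" using disjointed_subset[of Q n] by (auto simp: D_def)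
      then show ?thesis using local[OF D_borel q(1-4), of n c] q(5) by simp
    qed
    ultimately show ?thesis
      using suminf_emeasure[of D J] suminf_emeasure[of D K] D_borel sets by (simp add: image_subset_iff)
  qed
qed

section \<open>Boundedness of paths and left limits of their running extrema\<close>

lemma cadlag_bounded:
  assumes f: "cadlag f"
  obtains B where "\<And>s. s \<in> {0..t} \<Longrightarrow> \<bar>f s\<bar> \<le> B"
proof -
  \<comment> \<open>The two one-sided limits bound the path near \<open>s\<close>, and compactness
    reduces the local bounds to finitely many. At \<open>s = 0\<close> the left side contains no
    time of the interval.\<close>
  have "\<exists>U C. open U \<and> s \<in> U \<and> (\<forall>u\<in>U \<inter> {0..t}. \<bar>f u\<bar> \<le> C)" if s: "s \<in> {0..t}" for s
  proof -
    have "(f \<longlongrightarrow> f s) (at_right s)" using f s by (simp add: cadlag_def)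
    then have "((\<lambda>u. \<bar>f u\<bar>) \<longlongrightarrow> \<bar>f s\<bar>) (at_right s)" by (rule tendsto_rabs)
    then have r: "eventually (\<lambda>u. \<bar>f u\<bar> < \<bar>f s\<bar> + 1) (at_right s)" by (rule order_tendstoD) simp
    have l: "\<exists>C. eventually (\<lambda>u. u \<in> {0..t} \<longrightarrow> \<bar>f u\<bar> \<le> C) (at_left s)"
    proof (cases "s = 0")
      case True
      then show ?thesis by (auto simp: eventually_at_left_field intro!: exI[of _ "- 1"])
    next
      case False
      then have "0 < s" using s by simp
      then obtain l where "(f \<longlongrightarrow> l) (at_left s)" using f unfolding cadlag_def by blast
      then have "((\<lambda>u. \<bar>f u\<bar>) \<longlongrightarrow> \<bar>l\<bar>) (at_left s)" by (rule tendsto_rabs)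
      then have "eventually (\<lambda>u. \<bar>f u\<bar> < \<bar>l\<bar> + 1) (at_left s)" by (rule order_tendstoD) simp
      then show ?thesis by (intro exI[of _ "\<bar>l\<bar> + 1"]) (auto elim: eventually_mono)
    qed
    then obtain C where C: "eventually (\<lambda>u. u \<in> {0..t} \<longrightarrow> \<bar>f u\<bar> \<le> C) (at_left s)" by blast
    define C' where "C' = max C (\<bar>f s\<bar> + 1)"
    have "eventually (\<lambda>u. u \<in> {0..t} \<longrightarrow> \<bar>f u\<bar> \<le> C') (at s)"
      unfolding eventually_at_split using r C by (auto simp: C'_def elim: eventually_mono)
    then have "eventually (\<lambda>u. u \<in> {0..t} \<longrightarrow> \<bar>f u\<bar> \<le> C') (nhds s)"
      unfolding eventually_nhds_conv_at by (auto simp: C'_def)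
    then show ?thesis unfolding eventually_nhds by blast
  qed
  then obtain U C where UC: "\<And>s. s \<in> {0..t} \<Longrightarrow> open (U s)" "\<And>s. s \<in> {0..t} \<Longrightarrow> s \<in> U s"
    "\<And>s u. s \<in> {0..t} \<Longrightarrow> u \<in> U s \<inter> {0..t} \<Longrightarrow> \<bar>f u\<bar> \<le> C s" by metis
  obtain T where T: "T \<subseteq> {0..t}" "finite T" "{0..t} \<subseteq> (\<Union>s\<in>T. U s)"
    by (rule compactE_image[OF compact_Icc[of 0 t], where C="{0..t}" and f=U]) (use UC in auto)
  show ?thesis
  proof (rule that)
    fix u assume u: "u \<in> {0..t}"
    then obtain s where s: "s \<in> T" "u \<in> U s" using T by blast
    then have "\<bar>f u\<bar> \<le> C s" using UC(3)[of s u] T u by blast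
    also have "C s \<le> \<bar>C s\<bar>" by simp
    also have "\<dots> \<le> (\<Sum>s\<in>T. \<bar>C s\<bar>)" using s(1) T(2) by (intro member_le_sum) auto
    finally show "\<bar>f u\<bar> \<le> (\<Sum>s\<in>T. \<bar>C s\<bar>)" .
  qed
qed

text \<open>The left limit of a bounded increasing function is its supremum. The lemma is applied to
  the running supremum and to minus the running infimum.\<close>

lemma mono_left_limit:
  fixes g :: "real \<Rightarrow> real"
  assumes t: "0 < t" and mono: "\<And>s s'. 0 \<le> s \<Longrightarrow> s \<le> s' \<Longrightarrow> s' < t \<Longrightarrow> g s \<le> g s'"
    and B: "\<And>s. 0 \<le> s \<Longrightarrow> s < t \<Longrightarrow> g s \<le> B"
  shows "\<And>s. 0 \<le> s \<Longrightarrow> s < t \<Longrightarrow> g s \<le> left_limit g t" "left_limit g t \<le> B"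
    "(g \<longlongrightarrow> left_limit g t) (at_left t)"
proof -
  let ?L = "SUP s\<in>{0..<t}. g s"
  have bdd: "bdd_above (g ` {0..<t})" using B by (intro bdd_aboveI[of _ B]) auto
  have le: "g s \<le> ?L" if "0 \<le> s" "s < t" for s using that by (intro cSUP_upper bdd) auto
  have "(g \<longlongrightarrow> ?L) (at_left t)"
  proof (rule order_tendstoI)
    fix c assume "c < ?L"
    then obtain s where s: "0 \<le> s" "s < t" "c < g s" using t bdd by (auto simp: less_cSUP_iff)
    then show "eventually (\<lambda>u. c < g u) (at_left t)"
      unfolding eventually_at_left_field
    proof (intro exI[of _ s] conjI allI impI)
      fix u assume "s < u" "u < t"
      then have "g s \<le> g u" using s by (intro mono) auto
      with s show "c < g u" by simp
    qed (use s in simp)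
  next
    fix c assume "?L < c"
    then show "eventually (\<lambda>u. g u < c) (at_left t)"
      unfolding eventually_at_left_field using le t by (intro exI[of _ 0]) (meson le_less_trans
          less_imp_le)
  qed
  moreover from this have "left_limit g t = ?L"
    unfolding left_limit_def by (intro tendsto_Lim) auto
  ultimately show "(g \<longlongrightarrow> left_limit g t) (at_left t)" "\<And>s. 0 \<le> s \<Longrightarrow> s < t \<Longrightarrow> g s \<le> left_limit g t"
      "left_limit g t \<le> B"
    using le B t by (auto intro!: cSUP_least)
qed

lemma left_limit_uminus:
  assumes "(g \<longlongrightarrow> l) (at_left t)"
  shows "left_limit (\<lambda>s. - g s) t = - l"
  unfolding left_limit_def using assms by (intro tendsto_Lim tendsto_minus) auto

context
  fixes f :: "real \<Rightarrow> real" and t :: real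
  assumes f: "cadlag f" and t: "0 < t"
begin

lemma bdd_path: "bdd_above (f ` {0..s})" "bdd_below (f ` {0..s})"
proof -
  obtain B where B: "\<And>u. u \<in> {0..s} \<Longrightarrow> \<bar>f u\<bar> \<le> B" using cadlag_bounded[OF f] by blast
  show "bdd_above (f ` {0..s})" using B by (intro bdd_aboveI[of _ B]) (auto simp: abs_le_iff)
  show "bdd_below (f ` {0..s})" using B by (intro bdd_belowI[of _ "- B"]) (force simp: abs_le_iff)
qed

lemma left_limit_running_sup_le_iff:
  "left_limit (running_sup f) t \<le> u \<longleftrightarrow> (\<forall>s. 0 \<le> s \<longrightarrow> s < t \<longrightarrow> f s \<le> u)"
proof -
  obtain B where B: "\<And>s. s \<in> {0..t} \<Longrightarrow> \<bar>f s\<bar> \<le> B" using cadlag_bounded[OF f] by blast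
  have mono: "running_sup f s \<le> running_sup f s'" if "0 \<le> s" "s \<le> s'" for s s'
    unfolding running_sup_def using that by (intro cSUP_subset_mono bdd_path) auto
  have le: "running_sup f s \<le> c" if "\<And>v. 0 \<le> v \<Longrightarrow> v < t \<Longrightarrow> f v \<le> c" "0 \<le> s" "s < t" for s c
    unfolding running_sup_def using that by (intro cSUP_least) auto
  have bound: "running_sup f s \<le> B" if "0 \<le> s" "s < t" for s
    using B that by (intro le) (auto simp: abs_le_iff)
  note * = mono_left_limit[OF t, of "running_sup f", OF mono]
  show ?thesis
  proof (intro iffI allI impI)
    fix s assume u: "left_limit (running_sup f) t \<le> u" and s: "0 \<le> s" "s < t"
    have "f s \<le> running_sup f s" unfolding running_sup_def using s by (intro cSUP_upper bdd_path) auto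
    also have "\<dots> \<le> left_limit (running_sup f) t" by (rule *(1)[OF _ _ bound]) (use s in auto)
    finally show "f s \<le> u" using u by simp
  next
    assume "\<forall>s. 0 \<le> s \<longrightarrow> s < t \<longrightarrow> f s \<le> u"
    then show "left_limit (running_sup f) t \<le> u" by (intro *(2)) (auto intro: le)
  qed
qed

text \<open>Strictness of the left limit turns into a margin \<open>c\<close>, the form of the lower
  condition in \<open>alive\<close>; requiring \<open>l < f s\<close> for each \<open>s\<close>
  separately would be weaker.\<close>

lemma less_left_limit_running_inf_iff:
  "l < left_limit (running_inf f) t \<longleftrightarrow> (\<exists>c>l. \<forall>s. 0 \<le> s \<longrightarrow> s < t \<longrightarrow> c \<le> f s)"
proof -
  obtain B where B: "\<And>s. s \<in> {0..t} \<Longrightarrow> \<bar>f s\<bar> \<le> B" using cadlag_bounded[OF f] by blast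
  have mono: "- running_inf f s \<le> - running_inf f s'" if "0 \<le> s" "s \<le> s'" for s s'
    unfolding running_inf_def neg_le_iff_le using that by (intro cINF_superset_mono bdd_path) auto
  have le: "- running_inf f s \<le> - c" if "\<And>v. 0 \<le> v \<Longrightarrow> v < t \<Longrightarrow> c \<le> f v" "0 \<le> s" "s < t" for s c
    unfolding running_inf_def neg_le_iff_le using that by (intro cINF_greatest) auto
  have bound: "- running_inf f s \<le> - (- B)" if "0 \<le> s" "s < t" for s
  proof (rule le)
    fix v assume "0 \<le> v" "v < t" then show "- B \<le> f v" using B[of v] by (auto simp: abs_le_iff)
  qed (use that in auto)
  note * = mono_left_limit[OF t, of "\<lambda>s. - running_inf f s", OF mono]
  have "((\<lambda>s. - running_inf f s) \<longlongrightarrow> left_limit (\<lambda>s. - running_inf f s) t) (at_left t)"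
    by (rule *(3)[OF _ _ bound]) auto
  from left_limit_uminus[OF this] have eq: "left_limit (\<lambda>s. - running_inf f s) t = - left_limit
      (running_inf f) t" by simp
  show ?thesis
  proof (intro iffI exI conjI allI impI)
    assume "l < left_limit (running_inf f) t" then show "l < left_limit (running_inf f) t" .
    fix s assume s: "0 \<le> s" "s < t"
    have "- running_inf f s \<le> left_limit (\<lambda>s. - running_inf f s) t" by (rule *(1)[OF _ _ bound])
        (use s in auto)
    then have "left_limit (running_inf f) t \<le> running_inf f s" using eq by simp
    also have "running_inf f s \<le> f s" unfolding running_inf_def using s by (intro cINF_lower
        bdd_path) auto
    finally show "left_limit (running_inf f) t \<le> f s" .
  next
    assume "\<exists>c>l. \<forall>s. 0 \<le> s \<longrightarrow> s < t \<longrightarrow> c \<le> f s"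
    then obtain c where c: "l < c" "\<And>s. 0 \<le> s \<Longrightarrow> s < t \<Longrightarrow> c \<le> f s" by blast
    have "left_limit (\<lambda>s. - running_inf f s) t \<le> - c"
    proof (rule *(2))
      fix s assume "0 \<le> s" "s < t" then show "- running_inf f s \<le> - c" by (intro le) (auto intro: c(2))
    qed auto
    then show "l < left_limit (running_inf f) t" using eq c by simp
  qed
qed

end

section \<open>Ruin as an exit by a jump\<close>

context spectrally_negative_path
begin

text \<open>A path that leaves at \<open>e\<close> with a negative value was above \<open>b\<close>,
  hence nonnegative, at all earlier times, so \<open>e\<close> is the ruin time. Conversely the
  conditions on the extrema before ruin keep the path alive until then, and the negative value at
  ruin kills it.\<close>

lemma ruin_by_jump_iff:
  fixes A :: "(real \<times> real) set"
  assumes b: "0 \<le> b" and A: "A \<subseteq> {(y, z). 0 < y \<and> 0 < z \<and> b < y \<and> y < a}"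
  defines "T \<equiv> ruin_time f" and "\<tau> \<equiv> real_of_ereal (ruin_time f)" and "e \<equiv> exit_time a b f"
  shows "(left_limit f \<tau>, \<bar>f \<tau>\<bar>) \<in> A \<and> left_limit (running_inf f) \<tau> > b \<and>
      left_limit (running_sup f) \<tau> \<le> a \<and> T < \<infinity> \<longleftrightarrow>
      exits a b f \<and> \<not> alive a b f e \<and> (left_limit f e, - f e) \<in> A" (is "?l \<longleftrightarrow> ?r")
    and "exits a b f \<and> \<not> alive a b f e \<and> (left_limit f e, - f e) \<in> A \<Longrightarrow> \<tau> = e"
proof -
  have right: "\<tau> = e \<and> ?l" if r: ?r
  proof -
    have e: "0 < e" unfolding e_def using r by (intro exit_time_pos) auto
    have al: "alive a b f s" if "s < e" for s using less_exit_time_imp_alive that r by (auto simp: e_def)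
    have fe: "f e < 0" "b < left_limit f e" using r A by auto
    have pos: "b < f s" "f s \<le> a" if "0 \<le> s" "s < e" for s using alive_bounds[OF al[OF that(2)]
        that(1)] by auto
    have "T = ereal e"
      unfolding T_def ruin_time_def
    proof (rule antisym)
      show "(INF t\<in>{t. 0 \<le> t \<and> f t < 0}. ereal t) \<le> ereal e" using e fe by (intro INF_lower) auto
      show "ereal e \<le> (INF t\<in>{t. 0 \<le> t \<and> f t < 0}. ereal t)"
        using pos b by (intro INF_greatest) (force simp: not_less[symmetric])
    qed
    then have T: "T < \<infinity>" "\<tau> = e" by (simp_all add: \<tau>_def T_def)
    obtain c where c: "b < c" "\<And>s. 0 \<le> s \<Longrightarrow> s < e \<Longrightarrow> c \<le> f s"
      using alive_if_left_limit[OF al e fe(2)] by metis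
    show ?thesis
      using T r fe c pos by (auto simp: less_left_limit_running_inf_iff[OF cadlag e]
          left_limit_running_sup_le_iff[OF cadlag e])
  qed
  have left: ?r if l: ?l
  proof -
    define S where "S = {t. 0 \<le> t \<and> f t < 0}"
    have T_eq: "T = (INF t\<in>S. ereal t)" by (simp add: T_def ruin_time_def S_def)
    have S: "S \<noteq> {}" using l by (auto simp: T_eq top_ereal_def)
    have "0 \<le> T" unfolding T_eq by (intro INF_greatest) (auto simp: S_def)
    then have T: "T = ereal \<tau>" "0 \<le> \<tau>" using l by (cases T; auto simp: \<tau>_def T_def)+
    have before: "0 \<le> f s" if "0 \<le> s" "s < \<tau>" for s
    proof (rule ccontr)
      assume "\<not> 0 \<le> f s"
      then have "T \<le> ereal s" unfolding T_eq using that by (intro INF_lower) (auto simp: S_def)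
      then show False using T that by simp
    qed
    have near: "\<exists>t\<in>S. t < \<tau> + \<epsilon>" if "0 < \<epsilon>" for \<epsilon>
    proof -
      have "(INF t\<in>S. ereal t) < ereal (\<tau> + \<epsilon>)" using T(1) that by (simp add: T_eq)
      then show ?thesis by (auto simp: INF_less_iff)
    qed
    have ge: "\<tau> \<le> t" if "t \<in> S" for t
    proof -
      have "T \<le> ereal t" unfolding T_eq using that by (intro INF_lower)
      then show ?thesis using T by simp
    qed
    have "f \<tau> \<le> 0"
    proof (rule ccontr)
      assume "\<not> f \<tau> \<le> 0"
      then obtain \<epsilon> where "0 < \<epsilon>" "\<And>s. s \<in> {\<tau>..\<tau> + \<epsilon>} \<Longrightarrow> 0 < f s \<and> f s < f \<tau> + 1"
        using near_right[OF T(2), of "f \<tau> + 1" 0] by auto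
      then show False using near[of \<epsilon>] ge by (force simp: S_def)
    qed
    \<comment> \<open>Right-continuity alone gives \<open>f \<tau> \<le> 0\<close>; strictness comes
      from the second coordinate, which is positive on \<open>A\<close>.\<close>
    moreover have "0 < \<bar>f \<tau>\<bar>" using l A by auto
    ultimately have f\<tau>: "f \<tau> < 0" by simp
    have "\<tau> \<noteq> 0" using f\<tau> start_gt b by auto
    then have \<tau>: "0 < \<tau>" using T by simp
    from l have l': "left_limit (running_inf f) \<tau> > b" "left_limit (running_sup f) \<tau> \<le> a" by auto
    obtain c where c: "b < c" "\<And>s. 0 \<le> s \<Longrightarrow> s < \<tau> \<Longrightarrow> c \<le> f s"
      using l'(1) unfolding less_left_limit_running_inf_iff[OF cadlag \<tau>] by blast
    have u: "f s \<le> a" if "0 \<le> s" "s < \<tau>" for s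
      using l'(2) that unfolding left_limit_running_sup_le_iff[OF cadlag \<tau>] by blast
    have al: "alive a b f s" if "s < \<tau>" for s
      unfolding alive_def using that c u by (intro conjI exI[of _ c]) auto
    have dead: "\<not> alive a b f \<tau>" using alive_bounds[of a b f \<tau>] f\<tau> b \<tau> by auto
    then have ex: "exits a b f" using \<tau> by (auto simp: exits_def intro!: exI[of _ \<tau>])
    have "e = \<tau>"
    proof (rule antisym)
      show "e \<le> \<tau>" unfolding e_def using not_alive_imp_exit_time_le[OF T(2) dead] .
      show "\<tau> \<le> e"
      proof (rule dense_le_bounded[OF \<tau>])
        fix s assume "0 < s" "s < \<tau>"
        then show "s \<le> e" unfolding e_def using alive_imp_le_exit_time[OF ex _ al] by simp
      qed
    qed
    then show ?r using ex dead l f\<tau> by auto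
  qed
  show "?l \<longleftrightarrow> ?r" using left right by blast
  show "?r \<Longrightarrow> \<tau> = e" using right by blast
qed

end

definition ruin_functional :: "real \<Rightarrow> real \<Rightarrow> real \<Rightarrow> (real \<times> real) set \<Rightarrow> (real \<Rightarrow> real) \<Rightarrow> real" where
  "ruin_functional q a b A = (\<lambda>\<xi>. let T = ruin_time \<xi>; \<tau> = real_of_ereal T in
        exp (- q * \<tau>) *
        of_bool ((left_limit \<xi> \<tau>, \<bar>\<xi> \<tau>\<bar>) \<in> A \<and>
          left_limit (running_inf \<xi>) \<tau> > b \<and> left_limit (running_sup \<xi>) \<tau> \<le> a \<and> T < \<infinity>))"

lemma (in killed_levy) finite_measure_jump_law: "finite_measure jump_law"
proof
  have v: "(\<lambda>\<omega>. (exit_left \<omega>, exit_value \<omega> - exit_left \<omega>)) \<in> borel_measurable M"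
    by (simp add: borel_prod[symmetric])
  have "emeasure jump_law (space jump_law) = (\<integral>\<^sup>+\<omega>. ennreal (if jumped \<omega> then exp (- q * exit_at \<omega>)
      else 0) \<partial>M)"
    unfolding jump_law_def using v by (simp add: emeasure_distr emeasure_density cong: nn_integral_cong)
  also have "\<dots> \<le> (\<integral>\<^sup>+\<omega>. 1 \<partial>M)"
    using exit_at_nonneg q_nonneg by (intro nn_integral_mono) (auto simp flip: ennreal_1 intro!:
        ennreal_leI)
  also have "\<dots> = 1" by (simp add: emeasure_space_1)
  finally show "emeasure jump_law (space jump_law) \<noteq> \<infinity>" by (auto simp: top_unique)
qed

context killed_levy_scale
begin

text \<open>On admissible rectangles the law is \<open>occupation\<close> times \<nu>, and both
  factors have densities there; the comparison of measures on rectangles extends the product density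
  to Borel sets of the ruin region.\<close>

lemma emeasure_jump_law_eq:
  assumes b: "0 \<le> b" and \<nu>: "levy_measure_neg \<nu>" and [measurable]: "p \<in> borel_measurable borel"
    and \<nu>_eq: "\<nu> = density lborel p"
    and small_time: "\<And>h c d. continuous_on UNIV h \<Longrightarrow> (\<And>u. u \<le> c \<Longrightarrow> h u = 0) \<Longrightarrow> (\<And>u. d \<le> u \<Longrightarrow> h u = 0) \<Longrightarrow>
        d < 0 \<Longrightarrow>
      (\<lambda>n. real (Suc n) * (\<integral>u. h u \<partial>\<rho> (1 / real (Suc n)))) \<longlonglongrightarrow> (\<integral>u. h u \<partial>\<nu>)"
    and B: "B \<in> sets borel" "B \<subseteq> {(y, w). b < y \<and> y < a \<and> y + w < 0}"
  shows "emeasure jump_law B = (\<integral>\<^sup>+v\<in>B. ennreal (exit_mass * W (a - fst v) - W (x - fst v)) * p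
      (snd v) \<partial>lborel)"
proof -
  define r where "r y = ennreal (exit_mass * W (a - y) - W (x - y))" for y
  have [measurable]: "r \<in> borel_measurable borel" unfolding r_def by measurable
  have m: "(\<lambda>v. r (fst v) * p (snd v)) \<in> borel_measurable (borel :: (real \<times> real) measure)"
    by (simp add: borel_prod[symmetric])
  define K where "K = density lborel (\<lambda>v. r (fst v) * p (snd v))"
  have "emeasure jump_law B = emeasure K B"
  proof (rule emeasure_eq_if_eq_on_rectangles[OF _ _ finite_measure_jump_law b _ B])
    show "sets jump_law = sets borel" by (rule sets_jump_law)
    show "sets K = sets borel" by (simp add: K_def)
    fix l u c d :: real
    assume lu: "b \<le> l" "u \<le> a" "d \<le> - u" "d < 0"
    have rect: "{l<..<u} \<times> {c<..<d} \<in> sets (borel :: (real \<times> real) measure)"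
      by (intro borel_open open_Times) auto
    have "emeasure K ({l<..<u} \<times> {c<..<d}) = (\<integral>\<^sup>+v. (r (fst v) * indicator {l<..<u} (fst v)) * (p
        (snd v) * indicator {c<..<d} (snd v)) \<partial>lborel)"
      unfolding K_def using m rect
      by (subst emeasure_density) (auto intro!: nn_integral_cong simp: indicator_times mult.assoc
          mult.left_commute)
    also have "\<dots> = (\<integral>\<^sup>+y. \<integral>\<^sup>+w. (r y * indicator {l<..<u} y) * (p w * indicator {c<..<d} w) \<partial>lborel
        \<partial>lborel)"
      unfolding lborel_prod[symmetric] by (subst lborel.nn_integral_fst[symmetric]) simp_all
    also have "\<dots> = (\<integral>\<^sup>+y. (r y * indicator {l<..<u} y) * emeasure \<nu> {c<..<d} \<partial>lborel)"
      by (simp add: nn_integral_cmult \<nu>_eq emeasure_density)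
    also have "\<dots> = emeasure occupation {l<..<u} * emeasure \<nu> {c<..<d}"
      by (simp add: nn_integral_multc emeasure_occupation_interval[OF lu(1,2)] r_def)
    also have "\<dots> = emeasure jump_law ({l<..<u} \<times> {c<..<d})"
      by (rule emeasure_jump_law_rectangle[OF b \<nu> small_time lu(3,4), symmetric])
    finally show "emeasure jump_law ({l<..<u} \<times> {c<..<d}) = emeasure K ({l<..<u} \<times> {c<..<d})" ..
  qed
  also have "\<dots> = (\<integral>\<^sup>+v\<in>B. r (fst v) * p (snd v) \<partial>lborel)"
    unfolding K_def using m B by (subst emeasure_density) auto
  finally show ?thesis by (simp add: r_def)
qed

lemma nn_integral_ruin_functional:
  assumes b: "0 \<le> b" and \<nu>: "levy_measure_neg \<nu>" and [measurable]: "p \<in> borel_measurable borel"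
    and \<nu>_eq: "\<nu> = density lborel p"
    and small_time: "\<And>h c d. continuous_on UNIV h \<Longrightarrow> (\<And>u. u \<le> c \<Longrightarrow> h u = 0) \<Longrightarrow> (\<And>u. d \<le> u \<Longrightarrow> h u = 0) \<Longrightarrow>
        d < 0 \<Longrightarrow>
      (\<lambda>n. real (Suc n) * (\<integral>u. h u \<partial>\<rho> (1 / real (Suc n)))) \<longlonglongrightarrow> (\<integral>u. h u \<partial>\<nu>)"
    and A: "A \<in> sets borel" "A \<subseteq> {(y, z). 0 < y \<and> 0 < z \<and> b < y \<and> y < a}"
  shows "(\<lambda>\<omega>. ruin_functional q a b A (path \<omega>)) \<in> borel_measurable M"
    and "(\<integral>\<^sup>+\<omega>. ennreal (ruin_functional q a b A (path \<omega>)) \<partial>M)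
      = (\<integral>\<^sup>+v\<in>A. ennreal (exit_mass * W (a - fst v) - W (x - fst v)) * p (- snd v - fst v) \<partial>lborel)"
    and "(\<integral>\<^sup>+\<omega>. ennreal (ruin_functional q a b A (path \<omega>)) \<partial>M) < \<infinity>"
proof -
  \<comment> \<open>The deficit at ruin is minus the sum of the position before and the jump.
    \<open>S\<close> is the involution between the coordinates position and deficit of the theorem
    and the coordinates position and jump of \<open>jump_law\<close>.\<close>
  define S where "S v = (fst v, - (fst v + snd v))" for v :: "real \<times> real"
  have S: "S \<in> borel_measurable borel"
    unfolding S_def by (intro borel_measurable_continuous_onI continuous_intros)
  define B where "B = S -` A"
  have B: "B \<in> sets borel" using measurable_sets[OF S A(1)] by (simp add: B_def)
  have B': "B \<subseteq> {(y, w). b < y \<and> y < a \<and> y + w < 0}" using A(2) by (auto simp: B_def S_def)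
  let ?w = "\<lambda>\<omega>. if jumped \<omega> then exp (- q * exit_at \<omega>) else 0"
  let ?v = "\<lambda>\<omega>. (exit_left \<omega>, exit_value \<omega> - exit_left \<omega>)"
  have v: "?v \<in> borel_measurable M" by (simp add: borel_prod[symmetric])
  have eq: "ruin_functional q a b A (path \<omega>) = ?w \<omega> * indicator B (?v \<omega>)" if \<omega>: "\<omega> \<in> space M" for \<omega>
  proof -
    interpret P: spectrally_negative_path "path \<omega>" a b using \<omega> by (rule spectrally_negative_path)
    note iff = P.ruin_by_jump_iff[OF b A(2)]
    show ?thesis
    proof (cases "exits a b (path \<omega>) \<and> \<not> alive a b (path \<omega>) (exit_time a b (path \<omega>)) \<and>
        (left_limit (path \<omega>) (exit_time a b (path \<omega>)), - Y (exit_time a b (path \<omega>)) \<omega>) \<in> A")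
      case True
      then show ?thesis using iff(1) iff(2)[OF True]
        by (simp add: ruin_functional_def Let_def jumped_def exit_at_def exit_left_def
            exit_value_def B_def S_def)
    next
      case False
      then have "ruin_functional q a b A (path \<omega>) = 0" using iff(1) by (simp add:
          ruin_functional_def Let_def)
      moreover have "?w \<omega> * indicator B (?v \<omega>) = 0"
        using False by (auto simp: jumped_def exit_at_def exit_left_def exit_value_def B_def S_def)
      ultimately show ?thesis by simp
    qed
  qed
  have m: "(\<lambda>\<omega>. ?w \<omega> * indicator B (?v \<omega>)) \<in> borel_measurable M"
    using v B by measurable
  then show "(\<lambda>\<omega>. ruin_functional q a b A (path \<omega>)) \<in> borel_measurable M"
    using eq by (simp cong: measurable_cong)
  have "(\<integral>\<^sup>+\<omega>. ennreal (ruin_functional q a b A (path \<omega>)) \<partial>M) = (\<integral>\<^sup>+\<omega>. ennreal (?w \<omega>) * indicator B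
      (?v \<omega>) \<partial>M)"
    by (intro nn_integral_cong) (simp add: eq indicator_def)
  also have "\<dots> = emeasure jump_law B"
    unfolding jump_law_def using v B
    by (subst emeasure_distr, simp_all)
       (subst emeasure_density, auto intro!: nn_integral_cong simp: indicator_def)
  finally have J: "(\<integral>\<^sup>+\<omega>. ennreal (ruin_functional q a b A (path \<omega>)) \<partial>M) = emeasure jump_law B" .
  then show "(\<integral>\<^sup>+\<omega>. ennreal (ruin_functional q a b A (path \<omega>)) \<partial>M) < \<infinity>"
    using finite_measure.emeasure_finite[OF finite_measure_jump_law, of B] by (simp add:
        top.not_eq_extremum)
  define r where "r y = ennreal (exit_mass * W (a - y) - W (x - y))" for y
  have [measurable]: "r \<in> borel_measurable borel" unfolding r_def by measurable
  have [measurable]: "Measurable.pred (borel \<Otimes>\<^sub>M borel) (\<lambda>v. v \<in> A)" "Measurable.pred (borel \<Otimes>\<^sub>M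
      borel) (\<lambda>v. v \<in> B)"
    using A(1) B by (simp_all add: pred_def borel_prod)
  have "emeasure jump_law B = (\<integral>\<^sup>+v. r (fst v) * p (snd v) * indicator B v \<partial>lborel)"
    unfolding r_def by (rule emeasure_jump_law_eq[OF b \<nu> assms(3) \<nu>_eq _ B B'], rule small_time)
  also have "\<dots> = (\<integral>\<^sup>+y. \<integral>\<^sup>+w. r y * p w * indicator B (y, w) \<partial>lborel \<partial>lborel)"
    unfolding lborel_prod[symmetric] by (subst lborel.nn_integral_fst[symmetric]) simp_all
  also have "\<dots> = (\<integral>\<^sup>+y. \<integral>\<^sup>+z. r y * p (- z - y) * indicator A (y, z) \<partial>lborel \<partial>lborel)"
  proof (rule nn_integral_cong)
    fix y :: real
    have "(\<integral>\<^sup>+w. r y * p w * indicator B (y, w) \<partial>lborel)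
      = ennreal \<bar>- 1\<bar> * (\<integral>\<^sup>+z. r y * p (- y + - 1 * z) * indicator B (y, - y + - 1 * z) \<partial>lborel)"
      by (rule nn_integral_real_affine) simp_all
    also have "\<dots> = (\<integral>\<^sup>+z. r y * p (- z - y) * indicator A (y, z) \<partial>lborel)"
      by (simp add: B_def S_def indicator_def minus_diff_commute)
    finally show "(\<integral>\<^sup>+w. r y * p w * indicator B (y, w) \<partial>lborel) = (\<integral>\<^sup>+z. r y * p (- z - y) *
        indicator A (y, z) \<partial>lborel)" .
  qed
  also have "\<dots> = (\<integral>\<^sup>+v. r (fst v) * p (- snd v - fst v) * indicator A v \<partial>lborel)"
    unfolding lborel_prod[symmetric] by (subst lborel.nn_integral_fst[symmetric]) simp_all
  finally show "(\<integral>\<^sup>+\<omega>. ennreal (ruin_functional q a b A (path \<omega>)) \<partial>M)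
      = (\<integral>\<^sup>+v\<in>A. ennreal (exit_mass * W (a - fst v) - W (x - fst v)) * p (- snd v - fst v) \<partial>lborel)"
    unfolding J r_def .
qed

end

lemma laplace_exponent_0: "laplace_exponent \<mu> \<sigma> \<nu> 0 = 0"
  by (simp add: laplace_exponent_def)

section \<open>Increment laws and growth of the exponent\<close>

context spectrally_negative_levy
begin

abbreviation exponent :: "real \<Rightarrow> real" where "exponent \<equiv> laplace_exponent \<mu> \<sigma> \<nu>"

definition law :: "real \<Rightarrow> real measure" where "law t = distr M borel (X t)"

lemma X_measurable: "0 \<le> t \<Longrightarrow> X t \<in> borel_measurable M"
  using measurable_from_subalg[OF F_subalgebra adapted] .

lemma law_laplace:
  assumes "0 \<le> t" "0 \<le> \<alpha>"
  shows "has_bochner_integral (law t) (\<lambda>u. exp (\<alpha> * u)) (exp (t * exponent \<alpha>))"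
  using laplace[OF assms] X_measurable[OF assms(1)]
  by (simp add: law_def has_bochner_integral_iff integrable_distr_eq integral_distr)

text \<open>Independence is assumed for \<sigma>-algebras; \<open>V\<close> and the function of the
  increment generate smaller ones, so their means factor. Stationarity replaces the law of the
  increment by that of \<open>X (t - s)\<close>.\<close>

lemma increments_independent:
  fixes V :: "'a \<Rightarrow> real" and g :: "real \<Rightarrow> real"
  assumes s: "0 \<le> s" "s \<le> t" and V: "V \<in> borel_measurable (F s)" "integrable M V"
    and g: "integrable (law (t - s)) g"
  shows "has_bochner_integral M (\<lambda>\<omega>. V \<omega> * g (X t \<omega> - X s \<omega>)) (expectation V * (\<integral>u. g u \<partial>law (t - s)))"
proof -
  have t: "0 \<le> t" using s by simp
  note X_measurable[OF s(1), measurable] X_measurable[OF t, measurable]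
  have [measurable]: "g \<in> borel_measurable borel"
    using borel_measurable_integrable[OF g] by (simp add: law_def)
  have law_eq: "law (t - s) = distr M borel (\<lambda>\<omega>. X t \<omega> - X s \<omega>)"
    unfolding law_def by (rule stationary_increments[OF s, symmetric])
  have V_M: "V \<in> borel_measurable M" using V(2) by simp
  have ig: "integrable M (\<lambda>\<omega>. g (X t \<omega> - X s \<omega>))"
    using g unfolding law_eq by (simp add: integrable_distr_eq)
  have "indep_set (sigma_sets (space M) {V -` A \<inter> space M | A. A \<in> sets borel})
     (sigma_sets (space M) {(\<lambda>\<omega>. g (X t \<omega> - X s \<omega>)) -` A \<inter> space M | A. A \<in> sets borel})"
    unfolding indep_set_def
  proof (rule indep_sets_mono_sets[OF independent_increments[OF s, unfolded indep_set_def]])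
    fix i :: bool
    show "case_bool (sigma_sets (space M) {V -` A \<inter> space M | A. A \<in> sets borel})
        (sigma_sets (space M) {(\<lambda>\<omega>. g (X t \<omega> - X s \<omega>)) -` A \<inter> space M | A. A \<in> sets borel}) i
      \<subseteq> case_bool (sets (F s)) (sets (vimage_algebra (space M) (\<lambda>\<omega>. X t \<omega> - X s \<omega>) borel)) i"
    proof (cases i)
      case True
      have "{V -` A \<inter> space M | A. A \<in> sets borel} \<subseteq> sets (F s)"
        using measurable_sets[OF V(1)] space_F[of s] by auto
      then show ?thesis using True sets.sigma_sets_subset[of _ "F s"] space_F[of s] by simp
    next
      case False
      let ?V = "vimage_algebra (space M) (\<lambda>\<omega>. X t \<omega> - X s \<omega>) borel"
      have "(\<lambda>\<omega>. g (X t \<omega> - X s \<omega>)) \<in> borel_measurable ?V"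
        by (rule measurable_compose[OF measurable_vimage_algebra1]) auto
      from measurable_sets[OF this]
      have "{(\<lambda>\<omega>. g (X t \<omega> - X s \<omega>)) -` A \<inter> space M | A. A \<in> sets borel} \<subseteq> sets ?V" by auto
      then show ?thesis using False sets.sigma_sets_subset[of _ ?V] by simp
    qed
  qed
  then have "indep_var borel V borel (\<lambda>\<omega>. g (X t \<omega> - X s \<omega>))"
    unfolding indep_var_eq using V_M by simp
  note indep_var_lebesgue_integral[OF this V(2) ig] indep_var_integrable[OF this V(2) ig]
  then show ?thesis unfolding law_eq by (simp add: has_bochner_integral_iff integral_distr)
qed

text \<open>If no increment were positive with positive probability, the paths would be decreasing along the
  rationals, hence everywhere by right-continuity.\<close>

lemma exists_positive_increment: "\<exists>t>0. \<not> (AE \<omega> in M. X t \<omega> \<le> 0)"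
proof (rule ccontr)
  assume "\<not> ?thesis"
  then have neg: "AE \<omega> in M. X t \<omega> \<le> 0" if "0 < t" for t using that by blast
  have incr: "AE \<omega> in M. X t \<omega> \<le> X s \<omega>" if "0 \<le> s" "s \<le> t" for s t
  proof (cases "s = t")
    case False
    then have st: "0 < t - s" using that by simp
    have [measurable]: "X s \<in> borel_measurable M" "X t \<in> borel_measurable M" "X (t - s) \<in>
        borel_measurable M"
      using that by (auto intro: X_measurable)
    have "AE u in distr M borel (X (t - s)). u \<le> 0" using neg[OF st] by (subst AE_distr_iff) auto
    then have "AE u in distr M borel (\<lambda>\<omega>. X t \<omega> - X s \<omega>). u \<le> 0" unfolding stationary_increments[OF
        that] .
    then have "AE \<omega> in M. X t \<omega> - X s \<omega> \<le> 0" by (subst (asm) AE_distr_iff) auto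
    then show ?thesis by simp
  qed simp
  have "AE \<omega> in M. \<forall>s\<in>\<rat> \<inter> {0..}. \<forall>t\<in>\<rat> \<inter> {0..}. s \<le> t \<longrightarrow> X t \<omega> \<le> X s \<omega>"
    using incr by (intro AE_ball_countable' AE_impI) (auto intro: countable_subset[OF _ countable_rat])
  with cadlag_paths have "AE \<omega> in M. monotone_on {0..} (\<le>) (\<ge>) (\<lambda>t. X t \<omega>)"
  proof eventually_elim
    case (elim \<omega>)
    show ?case
    proof (rule monotone_onI)
      fix s t :: real assume st: "s \<in> {0..}" "t \<in> {0..}" "s \<le> t"
      show "X s \<omega> \<ge> X t \<omega>"
      proof (cases "s = t")
        case False
        then have "s < t" using st by simp
        \<comment> \<open>The rational times approaching \<open>s\<close> stay below
          \<open>t\<close> and those approaching \<open>t\<close> lie above it, so the inequality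
          for rationals applies term by term.\<close>
        obtain S where S: "\<And>n. S n \<in> \<rat>" "\<And>n. s < S n" "\<And>n. S n < t" "(\<lambda>n. X (S n) \<omega>) \<longlonglongrightarrow> X s \<omega>"
          using cadlag_rational_sequence[OF elim(1) _ \<open>s < t\<close>] st by auto
        obtain T where T: "\<And>n. T n \<in> \<rat>" "\<And>n. t < T n" "(\<lambda>n. X (T n) \<omega>) \<longlonglongrightarrow> X t \<omega>"
        proof (rule cadlag_rational_sequence[OF elim(1), of t "t + 1"])
        qed (use st in auto)
        have "X (T n) \<omega> \<le> X (S n) \<omega>" for n
        proof -
          have "S n \<le> T n" "0 \<le> S n" "0 \<le> T n" using S(2,3)[of n] T(2)[of n] st by auto
          then show ?thesis using elim(2) S(1) T(1) by blast
        qed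
        then show ?thesis by (intro LIMSEQ_le[OF T(3) S(4)]) auto
      qed simp
    qed
  qed
  with not_decreasing show False by simp
qed

text \<open>Some \<open>X t\<close> exceeds some \<open>e > 0\<close> with probability
  \<open>p > 0\<close>. Hence \<open>exp (t * exponent \<alpha>)\<close> is at least
  \<open>p * exp (\<alpha> * e)\<close>, and the exponent grows at least linearly.\<close>

lemma exponent_at_top: "filterlim exponent at_top at_top"
proof -
  obtain t where t: "0 < t" "\<not> (AE \<omega> in M. X t \<omega> \<le> 0)" using exists_positive_increment by blast
  have [measurable]: "X t \<in> borel_measurable M" using t by (intro X_measurable) simp
  have "\<exists>n. \<not> (AE \<omega> in M. X t \<omega> \<le> 1 / real (Suc n))"
  proof (rule ccontr)
    assume "\<not> ?thesis"
    then have "AE \<omega> in M. \<forall>n. X t \<omega> \<le> 1 / real (Suc n)" by (subst AE_all_countable) auto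
    then have "AE \<omega> in M. X t \<omega> \<le> 0"
    proof eventually_elim
      case (elim \<omega>)
      show ?case
        by (rule LIMSEQ_le_const[OF LIMSEQ_Suc[OF lim_const_over_n[of 1]]]) (use elim in auto)
    qed
    with t show False by simp
  qed
  then obtain e where e: "0 < e" "\<not> (AE \<omega> in M. X t \<omega> \<le> e)" by (metis zero_less_divide_1_iff
      of_nat_0_less_iff zero_less_Suc)
  define p where "p = prob {\<omega> \<in> space M. e < X t \<omega>}"
  have "p \<noteq> 0"
  proof
    assume "p = 0"
    then have "AE \<omega> in M. \<not> e < X t \<omega>" unfolding p_def by (subst (asm) prob_eq_0) auto
    then show False using e(2) by (simp add: not_less)
  qed
  then have p: "0 < p" by (simp add: p_def zero_less_measure_iff)
  have lower: "(\<alpha> * e + ln p) / t \<le> exponent \<alpha>" if \<alpha>: "0 \<le> \<alpha>" for \<alpha>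
  proof -
    note L = laplace[OF less_imp_le[OF t(1)] \<alpha>]
    have "p * exp (\<alpha> * e) = expectation (\<lambda>\<omega>. exp (\<alpha> * e) * indicator {\<omega> \<in> space M. e < X t \<omega>} \<omega>)"
      by (simp add: p_def)
    also have "\<dots> \<le> expectation (\<lambda>\<omega>. exp (\<alpha> * X t \<omega>))"
      using L \<alpha> by (intro integral_mono integrable_mult_right integrable_real_indicator)
        (auto simp: has_bochner_integral_iff indicator_def emeasure_eq_measure intro!: mult_left_mono)
    also have "\<dots> = exp (t * exponent \<alpha>)" using L by (simp add: has_bochner_integral_iff)
    finally have "ln (p * exp (\<alpha> * e)) \<le> ln (exp (t * exponent \<alpha>))" using p by (subst
        ln_le_cancel_iff) auto
    then show ?thesis using t p by (simp add: ln_mult field_simps)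
  qed
  have "filterlim (\<lambda>\<alpha>. (\<alpha> * e + ln p) / t) at_top at_top"
    using e(1) t(1) by real_asymp
  then show ?thesis
    by (rule filterlim_at_top_mono) (use lower in \<open>auto intro: eventually_mono[OF
        eventually_ge_at_top[of 0]]\<close>)
qed

end

section \<open>The main theorem\<close>

text \<open>Transfers measurability of the ruin functional from a regular version to
  \<open>x + X\<close>. Without it the integral in \<open>expectation_from\<close> would be 0 by
  convention.\<close>

lemma (in complete_measure) measurable_if_AE_eq:
  assumes g: "g \<in> measurable M N" and eq: "AE \<omega> in M. f \<omega> = g \<omega>" and f: "\<And>\<omega>. \<omega> \<in> space M \<Longrightarrow> f \<omega> \<in> space N"
  shows "f \<in> measurable M N"
proof (rule measurableI[OF f])
  fix S assume "S \<in> sets N"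
  then have S: "g -` S \<inter> space M \<in> sets M" by (rule measurable_sets[OF g])
  have "AE \<omega> in M. \<omega> \<in> g -` S \<inter> space M \<longleftrightarrow> \<omega> \<in> f -` S \<inter> space M"
    using eq by eventually_elim simp
  from in_sets_AE[OF this S] show "f -` S \<inter> space M \<in> sets M" by simp
qed

lemma cadlag_add_const: "cadlag f \<Longrightarrow> cadlag (\<lambda>t. c + f t)"
  unfolding cadlag_def
proof (elim conjE, intro conjI allI impI)
  fix t :: real assume "\<forall>t\<ge>0. (f \<longlongrightarrow> f t) (at_right t)" "0 \<le> t"
  then show "((\<lambda>t. c + f t) \<longlongrightarrow> c + f t) (at_right t)" by (intro tendsto_intros) auto
next
  fix t :: real assume "\<forall>t>0. \<exists>l. (f \<longlongrightarrow> l) (at_left t)" "0 < t"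
  then obtain l where "(f \<longlongrightarrow> l) (at_left t)" by blast
  then have "((\<lambda>t. c + f t) \<longlongrightarrow> c + l) (at_left t)" by (intro tendsto_intros)
  then show "\<exists>l. ((\<lambda>t. c + f t) \<longlongrightarrow> l) (at_left t)" by blast
qed

section \<open>A version with regular paths, and positivity of the scale function\<close>

context spectrally_negative_levy
begin

lemma small_time:
  assumes "continuous_on UNIV h" "\<And>u. u \<le> c \<Longrightarrow> h u = 0" "\<And>u. d \<le> u \<Longrightarrow> h u = 0" "d < 0"
  shows "(\<lambda>n. real (Suc n) * (\<integral>u. h u \<partial>law (1 / real (Suc n)))) \<longlonglongrightarrow> (\<integral>u. h u \<partial>\<nu>)"
proof (rule small_time_limit[OF levy_measure _ _ assms(1)])
  show "has_bochner_integral (law (1 / real (Suc n))) (\<lambda>u. exp (\<alpha> * u)) (exp (exponent \<alpha> / real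
      (Suc n)))"
    if "0 \<le> \<alpha>" for n \<alpha> using law_laplace[of "1 / real (Suc n)" \<alpha>] that by simp
qed (use assms in \<open>auto simp: law_def\<close>)

text \<open>On the exceptional null set the path is replaced by the constant \<open>x\<close>, which
  meets all pathwise requirements. The usual conditions place this set in \<open>F 0\<close>, so the
  version stays adapted.\<close>

lemma killed_levy_version:
  assumes "b < x" "x < a" "0 \<le> q"
  obtains Y where "killed_levy M F Y a b x q exponent law" "AE \<omega> in M. (\<lambda>t. Y t \<omega>) = (\<lambda>t. x + X t \<omega>)"
proof -
  have "AE \<omega> in M. X 0 \<omega> = 0 \<and> cadlag (\<lambda>t. X t \<omega>) \<and> no_positive_jumps (\<lambda>t. X t \<omega>)"
    using start cadlag_paths no_positive_jumps by eventually_elim simp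
  then obtain N where N: "{\<omega> \<in> space M. \<not> (X 0 \<omega> = 0 \<and> cadlag (\<lambda>t. X t \<omega>) \<and> no_positive_jumps (\<lambda>t.
      X t \<omega>))} \<subseteq> N"
    "N \<in> null_sets M" unfolding eventually_ae_filter by auto
  define Y where "Y t \<omega> = (if \<omega> \<in> N then x else x + X t \<omega>)" for t \<omega>
  have good: "X 0 \<omega> = 0" "cadlag (\<lambda>t. X t \<omega>)" "no_positive_jumps (\<lambda>t. X t \<omega>)" if "\<omega> \<in> space M" "\<omega> \<notin>
      N" for \<omega>
    using N(1) that by auto
  have AE_N: "AE \<omega> in M. \<omega> \<notin> N" using N(2) by (rule AE_not_in)
  have left_const: "left_limit (\<lambda>_. c) t = c" for c t :: real
    unfolding left_limit_def by (intro tendsto_Lim) auto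
  have left_shift: "left_limit (\<lambda>t. c + f t) t = c + left_limit f t" if "cadlag f" "0 < t" for f c t
    unfolding left_limit_def[of "\<lambda>t. c + f t"]
    by (intro tendsto_Lim tendsto_add tendsto_const cadlag_left_limit that) auto
  have adaptY: "Y t \<in> borel_measurable (F t)" if t: "0 \<le> t" for t
  proof -
    have [measurable]: "N \<in> sets (F t)" using N(2) F_null_sets sets_F_mono[OF t] by auto
    note adapted[OF t, measurable]
    show ?thesis unfolding Y_def by measurable
  qed
  have Y_M: "Y t \<in> borel_measurable M" if "0 \<le> t" for t
    using measurable_from_subalg[OF F_subalgebra[OF that] adaptY[OF that]] .
  have "killed_levy M F Y a b x q exponent law"
  proof unfold_locales
    fix \<omega> assume \<omega>: "\<omega> \<in> space M"
    show "cadlag (\<lambda>t. Y t \<omega>)"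
    proof (cases "\<omega> \<in> N")
      case False
      then have "cadlag (\<lambda>t. x + X t \<omega>)" using good(2)[OF \<omega>] by (intro cadlag_add_const)
      then show ?thesis using False by (simp add: Y_def)
    qed (auto simp: Y_def cadlag_def)
    show "no_positive_jumps (\<lambda>t. Y t \<omega>)"
      using good[OF \<omega>] by (cases "\<omega> \<in> N") (auto simp: Y_def no_positive_jumps_def left_const left_shift)
    show "Y 0 \<omega> = x" using good(1)[OF \<omega>] by (simp add: Y_def)
  next
    fix s t :: real and V :: "'a \<Rightarrow> real" and g :: "real \<Rightarrow> real"
    assume s: "0 \<le> s" "s \<le> t" and V: "V \<in> borel_measurable (F s)" "integrable M V" and g:
        "integrable (law (t - s)) g"
    have t: "0 \<le> t" using s by simp
    note X_measurable[OF s(1), measurable] X_measurable[OF t, measurable] Y_M[OF s(1), measurable]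
        Y_M[OF t, measurable]
    have [measurable]: "g \<in> borel_measurable borel" "V \<in> borel_measurable M"
      using borel_measurable_integrable[OF g] V(2) by (simp_all add: law_def)
    have "AE \<omega> in M. V \<omega> * g (X t \<omega> - X s \<omega>) = V \<omega> * g (Y t \<omega> - Y s \<omega>)"
      using AE_N by eventually_elim (simp add: Y_def)
    from has_bochner_integral_cong_AE[OF _ _ this]
    show "has_bochner_integral M (\<lambda>\<omega>. V \<omega> * g (Y t \<omega> - Y s \<omega>)) (expectation V * (\<integral>u. g u \<partial>law (t - s)))"
      using increments_independent[OF s V g] by simp
  next
    show "eventually (\<lambda>\<alpha>. q < exponent \<alpha>) at_top"
      using exponent_at_top by (auto simp: filterlim_at_top_dense)
    show "sets (F s) \<subseteq> sets (F t)" if "0 \<le> s" "s \<le> t" for s t using sets_F_mono[OF that(2)] .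
    show "sets (law t) = sets borel" for t by (simp add: law_def)
  qed (use assms adaptY F_subalgebra law_laplace in \<open>auto simp: laplace_exponent_0\<close>)
  moreover have "AE \<omega> in M. (\<lambda>t. Y t \<omega>) = (\<lambda>t. x + X t \<omega>)"
    using AE_N by eventually_elim (auto simp: Y_def)
  ultimately show ?thesis by (rule that)
qed

lemma killed_levy_scale_version:
  assumes "b < x" "x < a" "0 \<le> q" and W: "is_scale_function exponent q W"
  obtains Y where "killed_levy_scale M F Y a b x q exponent law W" "AE \<omega> in M. (\<lambda>t. Y t \<omega>) = (\<lambda>t. x
      + X t \<omega>)"
proof -
  obtain Y where Y: "killed_levy M F Y a b x q exponent law" "AE \<omega> in M. (\<lambda>t. Y t \<omega>) = (\<lambda>t. x + X t \<omega>)"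
    using killed_levy_version[OF assms(1-3)] by blast
  have "killed_levy_scale M F Y a b x q exponent law W"
  proof (intro killed_levy_scale.intro killed_levy_scale_axioms.intro Y(1))
    show "eventually (\<lambda>\<alpha>. set_integrable lborel {0..} (\<lambda>y. exp (- \<alpha> * y) * W y) \<and>
        (LINT y:{0..}|lborel. exp (- \<alpha> * y) * W y) = 1 / (exponent \<alpha> - q)) at_top"
      using eventually_gt_at_top[of "right_inverse_exponent exponent q"]
      by eventually_elim (use W in \<open>auto simp: is_scale_function_def\<close>)
  qed (use W in \<open>auto simp: is_scale_function_def\<close>)
  then show ?thesis using Y(2) that by blast
qed

text \<open>For the starting point \<open>a - y + b\<close>, again inside the interval,
  \<open>scale_at_boundary\<close> expresses \<open>W (a - y)\<close> as a multiple of
  \<open>W (a - b)\<close>. If the latter were 0, \<open>W (a - y)\<close> would vanish for all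
  \<open>y\<close> between \<open>b\<close> and \<open>a\<close>, against the positive occupation of
  that interval.\<close>

lemma scale_function_nonzero:
  assumes "b < a" "0 \<le> q" and W: "is_scale_function exponent q W"
  shows "W (a - b) \<noteq> 0"
proof
  assume 0: "W (a - b) = 0"
  have zero: "W (a - y) = 0" if y: "b < y" "y < a" for y
  proof -
    obtain Y where "killed_levy_scale M F Y a b (a - y + b) q exponent law W"
      using killed_levy_scale_version[of b "a - y + b" a q W] y assms by auto
    from killed_levy_scale.scale_at_boundary[OF this] 0 show ?thesis by simp
  qed
  obtain Y where "killed_levy_scale M F Y a b ((a + b) / 2) q exponent law W"
    using killed_levy_scale_version[of b "(a + b) / 2" a q W] assms by auto
  from killed_levy_scale.scale_nonzero_if_resolvent[OF this zero] show False .
qed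

end

theorem theorem3p1:
  fixes M :: "'a measure" and F :: "real \<Rightarrow> 'a measure" and X :: "real \<Rightarrow> 'a \<Rightarrow> real"
    and \<mu> \<sigma> :: real and \<nu> :: "real measure" and \<pi> W :: "real \<Rightarrow> real"
    and q x a b :: real and A :: "(real \<times> real) set"
  assumes "spectrally_negative_levy M F X \<mu> \<sigma> \<nu>"
    and "\<pi> \<in> borel_measurable borel" and "\<And>u. u < 0 \<Longrightarrow> 0 \<le> \<pi> u"
    and "\<nu> = density lborel (\<lambda>u. ennreal (\<pi> u) * indicator {..<0} u)"
    and "0 \<le> q" and "is_scale_function (laplace_exponent \<mu> \<sigma> \<nu>) q W"
    and "0 < x" and "0 < a" and "0 < b" and "b < min a x" and "x < a"
    and "A \<in> sets borel"
    and "A \<subseteq> {(y, z). 0 < y \<and> 0 < z \<and> b < y \<and> y < a}"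
  shows "set_integrable lborel A
      (\<lambda>(y, z). \<pi> (- z - y) * (W (x - b) / W (a - b) * W (a - y) - W (x - y)))
    \<and> expectation_from M X x (\<lambda>\<xi>. let T = ruin_time \<xi>; \<tau> = real_of_ereal T in
        exp (- q * \<tau>) *
        of_bool ((left_limit \<xi> \<tau>, \<bar>\<xi> \<tau>\<bar>) \<in> A \<and>
          left_limit (running_inf \<xi>) \<tau> > b \<and> left_limit (running_sup \<xi>) \<tau> \<le> a \<and> T < \<infinity>))
      = (LINT (y, z):A|lborel.
          \<pi> (- z - y) * (W (x - b) / W (a - b) * W (a - y) - W (x - y)))"
proof -
  interpret L: spectrally_negative_levy M F X \<mu> \<sigma> \<nu> by fact
  note \<pi>[measurable] = assms(2)
  have bx: "b < x" "b < a" "0 \<le> b" using assms by auto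
  obtain Y where Y: "killed_levy_scale M F Y a b x q L.exponent L.law W"
    and XY: "AE \<omega> in M. (\<lambda>t. Y t \<omega>) = (\<lambda>t. x + X t \<omega>)"
    using L.killed_levy_scale_version[OF bx(1) \<open>x < a\<close> \<open>0 \<le> q\<close> assms(6)] by blast
  interpret K: killed_levy_scale M F Y a b x q L.exponent L.law W by (rule Y)
  let ?p = "\<lambda>u. ennreal (\<pi> u) * indicator {..<0} u"
  let ?\<Psi> = "ruin_functional q a b A"
  let ?k = "\<lambda>v. \<pi> (- snd v - fst v) * (W (x - b) / W (a - b) * W (a - fst v) - W (x - fst v))"
  have mass: "K.exit_mass = W (x - b) / W (a - b)"
    using K.scale_at_boundary L.scale_function_nonzero[OF bx(2) assms(5,6)] by simp
  have p: "?p \<in> borel_measurable borel" by measurable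
  note \<Psi> = K.nn_integral_ruin_functional[OF bx(3) L.levy_measure p assms(4) _ assms(12,13)]
  have \<Psi>_M: "(\<lambda>\<omega>. ?\<Psi> (\<lambda>t. Y t \<omega>)) \<in> borel_measurable M"
    by (rule \<Psi>(1), rule L.small_time)
  have \<Psi>_eq: "(\<integral>\<^sup>+\<omega>. ennreal (?\<Psi> (\<lambda>t. Y t \<omega>)) \<partial>M)
      = (\<integral>\<^sup>+v\<in>A. ennreal (K.exit_mass * W (a - fst v) - W (x - fst v)) * ?p (- snd v - fst v) \<partial>lborel)"
    by (rule \<Psi>(2), rule L.small_time)
  have \<Psi>_fin: "(\<integral>\<^sup>+\<omega>. ennreal (?\<Psi> (\<lambda>t. Y t \<omega>)) \<partial>M) < \<infinity>"
    by (rule \<Psi>(3), rule L.small_time)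
  define c where "c = enn2real (\<integral>\<^sup>+\<omega>. ennreal (?\<Psi> (\<lambda>t. Y t \<omega>)) \<partial>M)"
  have c: "(\<integral>\<^sup>+\<omega>. ennreal (?\<Psi> (\<lambda>t. Y t \<omega>)) \<partial>M) = ennreal c" "0 \<le> c"
    using \<Psi>_fin by (simp_all add: c_def)
  have \<Psi>_nonneg: "0 \<le> ?\<Psi> \<xi>" for \<xi> by (simp add: ruin_functional_def Let_def)
  have "has_bochner_integral M (\<lambda>\<omega>. ?\<Psi> (\<lambda>t. Y t \<omega>)) c"
    using \<Psi>_M \<Psi>_nonneg c by (intro has_bochner_integral_nn_integral) auto
  moreover have AE_\<Psi>: "AE \<omega> in M. ?\<Psi> (\<lambda>t. x + X t \<omega>) = ?\<Psi> (\<lambda>t. Y t \<omega>)"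
    using XY by eventually_elim simp
  moreover have "(\<lambda>\<omega>. ?\<Psi> (\<lambda>t. x + X t \<omega>)) \<in> borel_measurable M"
    by (rule L.measurable_if_AE_eq[OF \<Psi>_M AE_\<Psi>]) simp
  ultimately have "expectation_from M X x ?\<Psi> = c"
    using \<Psi>_M unfolding expectation_from_def
    by (subst integral_cong_AE[of _ _ "\<lambda>\<omega>. ?\<Psi> (\<lambda>t. Y t \<omega>)"]) (auto simp: has_bochner_integral_iff)
  moreover have "has_bochner_integral lborel (\<lambda>v. indicator A v *\<^sub>R ?k v) c"
  proof (rule has_bochner_integral_nn_integral)
    have "?k \<in> borel_measurable (borel \<Otimes>\<^sub>M borel)" by measurable
    then have "?k \<in> borel_measurable borel" by (simp only: borel_prod)
    then show "(\<lambda>v. indicator A v *\<^sub>R ?k v) \<in> borel_measurable lborel" using assms(12) by measurable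
    \<comment> \<open>The line \<open>y = x\<close> is discarded: there \<open>W (x - y)\<close> is
      \<open>W 0\<close>, whose value is left open, and the density might be negative.\<close>
    have "emeasure lborel ({x} \<times> (UNIV :: real set)) = 0"
      unfolding lborel_prod[symmetric] by (subst lborel.emeasure_pair_measure_Times) auto
    then have ne: "AE v in (lborel :: (real \<times> real) measure). fst v \<noteq> x"
      by (intro AE_I[of _ _ "{x} \<times> (UNIV :: real set)"]) (auto intro!: borel_closed closed_Times)
    have *: "0 \<le> \<pi> (- snd v - fst v)" "0 \<le> K.exit_mass * W (a - fst v) - W (x - fst v)" "- snd v -
        fst v < 0"
      if "v \<in> A" "fst v \<noteq> x" for v
      using that assms(13) K.W_le_above[of "fst v"] by (auto intro!: assms(3))
    show "AE v in lborel. 0 \<le> indicator A v *\<^sub>R ?k v"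
      using ne by eventually_elim (use * in \<open>auto simp: mass indicator_def\<close>)
    have "(\<integral>\<^sup>+v. ennreal (indicator A v *\<^sub>R ?k v) \<partial>lborel)
      = (\<integral>\<^sup>+v\<in>A. ennreal (K.exit_mass * W (a - fst v) - W (x - fst v)) * ?p (- snd v - fst v) \<partial>lborel)"
    proof (rule nn_integral_cong_AE)
      show "AE v in lborel. ennreal (indicator A v *\<^sub>R ?k v)
        = ennreal (K.exit_mass * W (a - fst v) - W (x - fst v)) * ?p (- snd v - fst v) * indicator A v"
        using ne
      proof eventually_elim
        case (elim v)
        show ?case
        proof (cases "v \<in> A")
          case True
          then show ?thesis using *[OF True elim] by (simp add: mass ennreal_mult mult.commute)
        qed simp
      qed
    qed
    then show "(\<integral>\<^sup>+v. ennreal (indicator A v *\<^sub>R ?k v) \<partial>lborel) = ennreal c"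
      using \<Psi>_eq c by simp
  qed (rule c)
  ultimately show ?thesis
    unfolding ruin_functional_def set_integrable_def set_lebesgue_integral_def case_prod_beta'
    by (simp add: has_bochner_integral_iff)
qed

end
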